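(* Let $\psi: C\to E$ be a covering of even degree $n$ from a genus 2 curve $C$ to an elliptic curve $E$ over $\mathbb{C}$, and let $\phi:\mathbb{P}^1\to\mathbb{P}^1$ be the corresponding Frey-Kani covering. Up to the order of the branch points: If $\psi$ is in Case I (generic case), then the ramification of $\phi$ is one of the following three: I. $\left((2)^{\frac{n-2}{2}},(2)^{\frac{n-2}{2}},(2)^{\frac{n-2}{2}},(2)^{\frac n2},(2)\right)$, II. $\left((2)^{\frac{n-4}{2}},(2)^{\frac{n-2}{2}},(2)^{\frac{n}{2}},(2)^{\frac n2},(2)\right)$, III. $\left((2)^{\frac{n-6}{2}},(2)^{\frac{n}{2}},(2)^{\frac{n}{2}},(2)^{\frac n2},(2)\right)$. These have the following degenerations (two of the branch points collapse to one), i.e. if $\psi$ has only one branch point (Case II or Case III for $\psi$), then the ramification of $\phi$ is one of the following. Degenerations of I: 1. $\left((2)^{\frac n2},(2)^{\frac{n-2}2},(2)^{\frac{n-2}2},(2)^{\frac n2}\right)$, 2. $\left((2)^{\frac{n-2}2},(2)^{\frac{n-2}2},(4)(2)^{\frac{n-6}2},(2)^{\frac n2}\right)$, 3. $\left((2)^{\frac{n-2}2},(2)^{\frac{n-2}2},(2)^{\frac{n-2}2},(4)(2)^{\frac{n-4}2}\right)$, 4. $\left((3)(2)^{\frac{n-4}2},(2)^{\frac{n-2}2},(2)^{\frac{n-2}2},(2)^{\frac n2}\right)$. Degenerations of II: 1. $\left((2)^{\frac{n-2}2},(2)^{\frac{n-2}2},(2)^{\frac n2},(2)^{\frac n2}\right)$,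 2. $\left((2)^{\frac{n-4}2},(2)^{\frac n2},(2)^{\frac n2},(2)^{\frac n2}\right)$, 3. $\left((4)(2)^{\frac{n-8}2},(2)^{\frac{n-2}2},(2)^{\frac n2},(2)^{\frac n2}\right)$, 4. $\left((2)^{\frac{n-4}2},(4)(2)^{\frac{n-6}2},(2)^{\frac n2},(2)^{\frac n2}\right)$, 5. $\left((2)^{\frac{n-4}2},(2)^{\frac{n-2}2},(4)(2)^{\frac{n-4}2},(2)^{\frac n2}\right)$, 6. $\left((3)(2)^{\frac{n-6}2},(2)^{\frac{n-2}2},(2)^{\frac n2},(2)^{\frac n2}\right)$, 7. $\left((2)^{\frac{n-4}2},(3)(2)^{\frac{n-4}2},(2)^{\frac n2},(2)^{\frac n2}\right)$. Degenerations of III: 1. $\left((2)^{\frac{n-4}2},(2)^{\frac n2},(2)^{\frac n2},(2)^{\frac n2}\right)$, 2. $\left((2)^{\frac{n-6}2},(4)(2)^{\frac{n-4}2},(2)^{\frac n2},(2)^{\frac n2}\right)$, 3. $\left((2)^{\frac n2},(2)^{\frac n2},(2)^{\frac n2},(4)(2)^{\frac{n-10}2}\right)$, 4. $\left((3)(2)^{\frac{n-8}2},(2)^{\frac n2},(2)^{\frac n2},(2)^{\frac n2}\right)$.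
   Context: Curves are smooth, projective, over $\mathbb{C}$. $C$ has genus 2, $E$ has genus 1, $\psi:C\to E$ is a covering of degree $n$, and $e_\psi(P)$ is the ramification index of $\psi$ at $P$. By Riemann-Hurwitz, exactly one of the following holds. Case I: there are two points $P_1\neq P_2$ of $C$ with $e_\psi(P_1)=e_\psi(P_2)=2$, $\psi(P_1)\ne\psi(P_2)$, and $\psi$ is unramified at all other points. Case II: there are two points $P_1\neq P_2$ of $C$ with $e_\psi(P_1)=e_\psi(P_2)=2$, $\psi(P_1)=\psi(P_2)$, and $\psi$ is unramified at all other points. Case III: there is one point $P_1$ with $e_\psi(P_1)=3$, and $\psi$ is unramified at all other points. Let $w$ be the hyperelliptic involution of $C$. The origin $\mathcal{O}$ of $E$ is chosen so that $\psi\circ w=v\circ\psi$, where $v(P)=-P$ on $E$. Let $\pi_C:C\to C/\langle w\rangle\cong\mathbb{P}^1$ and $\pi_E:E\to E/\langle v\rangle\cong\mathbb{P}^1$ be the natural degree 2 projections. The Frey-Kani covering corresponding to $\psi$ is the degree $n$ map $\phi:\mathbb{P}^1\to\mathbb{P}^1$ with $\phi\circ\pi_C=\pi_E\circ\psi$. Notation for ramification: the data of different branch points of $\phi$ are separated by commas. For one branch point, $(m)^k$ means that its fiber contains $k$ points of ramification index $m$ (and $(m)=(m)^1$); juxtaposed symbols refer to the same fiber, and unramified points in the fiber are omitted. An exponent $0$ means no ramified points of that index, and a type in which a negative exponent appears does not occur for that $n$. *)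

theory Defs
  imports "HOL-Analysis.Analysis" "HOL-Library.FuncSet" "HOL-Library.Multiset"
begin

section \<open>Projective space over the complex numbers\<close>

text \<open>The type \<open>'n proj_space\<close> is projective space of dimension \<open>CARD('n) - 1\<close>:
  nonzero vectors up to nonzero scalars. In particular \<open>2 proj_space\<close> is the projective line.\<close>

quotient_type 'n proj_space =
  "complex ^ 'n" / partial: "\<lambda>x y. x \<noteq> 0 \<and> (\<exists>c. c \<noteq> 0 \<and> y = c *s x)"
proof (rule part_equivpI)
  let ?R = "\<lambda>x y :: complex ^ 'n. x \<noteq> 0 \<and> (\<exists>c. c \<noteq> 0 \<and> y = c *s x)"
  have "(1 :: complex ^ 'n) \<noteq> 0" by (simp add: vec_eq_iff)
  moreover have "\<exists>c. c \<noteq> 0 \<and> (1 :: complex ^ 'n) = c *s 1"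
    by (rule exI[of _ 1]) simp
  ultimately show "\<exists>x. ?R x x" by blast
  show "symp ?R"
  proof (rule sympI)
    fix x y :: "complex ^ 'n"
    assume "?R x y"
    then obtain c where c: "x \<noteq> 0" "c \<noteq> 0" "y = c *s x" by blast
    have "x = inverse c *s y" using c by (simp add: vector_smult_assoc)
    moreover have "inverse c \<noteq> 0" "y \<noteq> 0" using c by auto
    ultimately show "?R y x" by blast
  qed
  show "transp ?R"
  proof (rule transpI)
    fix x y z :: "complex ^ 'n"
    assume "?R x y" "?R y z"
    then obtain c d where cd: "x \<noteq> 0" "c \<noteq> 0" "y = c *s x" "d \<noteq> 0" "z = d *s y" by blast
    hence "z = (d * c) *s x" "d * c \<noteq> 0" by (auto simp: vector_smult_assoc)
    with cd(1) show "?R x z" by blast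
  qed
qed

text \<open>\<open>hcoords p\<close> is one choice of homogeneous coordinates of \<open>p\<close>. Below it is used only for
  conditions and quotients that do not depend on this choice.\<close>

definition hcoords :: "'n::finite proj_space \<Rightarrow> complex ^ 'n" where
  "hcoords p = rep_proj_space p"

definition hpoint :: "complex ^ 'n::finite \<Rightarrow> 'n proj_space" where
  "hpoint x = abs_proj_space x"

lemma hcoords_nonzero: "hcoords p \<noteq> 0"
  using Quotient3_rep_reflp[OF Quotient3_proj_space] by (auto simp: hcoords_def)

lemma hpoint_hcoords: "hpoint (hcoords p) = p"
  by (simp add: hpoint_def hcoords_def Quotient3_abs_rep[OF Quotient3_proj_space])

lemma hpoint_eq_iff:
  assumes "x \<noteq> 0" "y \<noteq> 0"
  shows "hpoint x = hpoint y \<longleftrightarrow> (\<exists>c. c \<noteq> 0 \<and> y = c *s x)"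
proof -
  have refl: "z \<noteq> 0 \<Longrightarrow> z \<noteq> 0 \<and> (\<exists>c. c \<noteq> 0 \<and> z = c *s z)" for z :: "complex ^ 'a"
    by (intro conjI exI[of _ 1]) auto
  show ?thesis
    using Quotient3_rel[OF Quotient3_proj_space, of x y] refl[OF assms(1)] refl[OF assms(2)]
      assms by (auto simp: hpoint_def)
qed

definition homogeneous_poly :: "nat \<Rightarrow> (complex ^ 'n::finite \<Rightarrow> complex) \<Rightarrow> bool" where
  "homogeneous_poly d F \<longleftrightarrow>
     (\<exists>c. F = (\<lambda>x. \<Sum>m | (\<Sum>i\<in>UNIV. m i) = d. c m * (\<Prod>i\<in>UNIV. (x $ i) ^ m i)))"

lemma finite_monomials: "finite {m :: 'n::finite \<Rightarrow> nat. (\<Sum>i\<in>UNIV. m i) = d}"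
proof (rule finite_subset)
  show "{m :: 'n \<Rightarrow> nat. (\<Sum>i\<in>UNIV. m i) = d} \<subseteq> (\<Pi>\<^sub>E i\<in>UNIV. {..d})"
    by (auto intro!: member_le_sum)
  show "finite (\<Pi>\<^sub>E i\<in>(UNIV :: 'n set). {..d})"
    by (rule finite_PiE) auto
qed

lemma homogeneous_poly_scale:
  assumes "homogeneous_poly d F"
  shows "F (a *s x) = a ^ d * F x"
proof -
  obtain c where F: "F = (\<lambda>x. \<Sum>m | (\<Sum>i\<in>UNIV. m i) = d. c m * (\<Prod>i\<in>UNIV. (x $ i) ^ m i))"
    using assms by (auto simp: homogeneous_poly_def)
  show ?thesis
    unfolding F sum_distrib_left
    by (rule sum.cong) (auto simp: power_mult_distrib prod.distrib power_sum[symmetric])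
qed

definition zariski_closed :: "'n::finite proj_space set \<Rightarrow> bool" where
  "zariski_closed Z \<longleftrightarrow>
     (\<exists>S. (\<forall>F\<in>S. \<exists>d. homogeneous_poly d F) \<and> Z = {p. \<forall>F\<in>S. F (hcoords p) = 0})"

definition projective_variety :: "'n::finite proj_space set \<Rightarrow> bool" where
  "projective_variety X \<longleftrightarrow> zariski_closed X \<and> X \<noteq> {} \<and>
     (\<forall>Z1 Z2. zariski_closed Z1 \<and> zariski_closed Z2 \<and> X \<subseteq> Z1 \<union> Z2 \<longrightarrow> X \<subseteq> Z1 \<or> X \<subseteq> Z2)"


section \<open>Rational functions and local rings\<close>

definition regular_at :: "'n::finite proj_space set \<Rightarrow> 'n proj_space \<Rightarrow> ('n proj_space \<Rightarrow> complex) \<Rightarrow> bool" where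
  "regular_at X p f \<longleftrightarrow>
     (\<exists>d F G. homogeneous_poly d F \<and> homogeneous_poly d G \<and> G (hcoords p) \<noteq> 0 \<and>
        (\<forall>q\<in>X. G (hcoords q) \<noteq> 0 \<longrightarrow> f q = F (hcoords q) / G (hcoords q)))"

definition generically :: "'n::finite proj_space set \<Rightarrow> ('n proj_space \<Rightarrow> bool) \<Rightarrow> bool" where
  "generically X P \<longleftrightarrow> (\<exists>Z. zariski_closed Z \<and> \<not> X \<subseteq> Z \<and> (\<forall>q\<in>X - Z. P q))"

text \<open>A rational function on a variety \<open>X\<close> is represented by any function that is regular on a
  nonempty Zariski-open subset of \<open>X\<close>; its values elsewhere are irrelevant. The elements of the
  function field of \<open>X\<close> are the classes of such functions modulo \<open>rat_eq X\<close>.\<close>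

definition rational_fun :: "'n::finite proj_space set \<Rightarrow> ('n proj_space \<Rightarrow> complex) \<Rightarrow> bool" where
  "rational_fun X f \<longleftrightarrow> generically X (\<lambda>p. regular_at X p f)"

definition rat_eq :: "'n::finite proj_space set \<Rightarrow> ('n proj_space \<Rightarrow> complex) \<Rightarrow> ('n proj_space \<Rightarrow> complex) \<Rightarrow> bool" where
  "rat_eq X f g \<longleftrightarrow> generically X (\<lambda>p. f p = g p)"

text \<open>The class of \<open>f\<close> is a unit, respectively lies in the maximal ideal, of the local ring of
  \<open>X\<close> at \<open>p\<close>.\<close>

definition local_unit :: "'n::finite proj_space set \<Rightarrow> 'n proj_space \<Rightarrow> ('n proj_space \<Rightarrow> complex) \<Rightarrow> bool" where
  "local_unit X p f \<longleftrightarrow> (\<exists>g. regular_at X p g \<and> g p \<noteq> 0 \<and> rat_eq X f g)"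

definition local_max_ideal :: "'n::finite proj_space set \<Rightarrow> 'n proj_space \<Rightarrow> ('n proj_space \<Rightarrow> complex) \<Rightarrow> bool" where
  "local_max_ideal X p f \<longleftrightarrow> (\<exists>g. regular_at X p g \<and> g p = 0 \<and> rat_eq X f g)"

definition uniformizer :: "'n::finite proj_space set \<Rightarrow> 'n proj_space \<Rightarrow> ('n proj_space \<Rightarrow> complex) \<Rightarrow> bool" where
  "uniformizer X p t \<longleftrightarrow> local_max_ideal X p t \<and> \<not> rat_eq X t (\<lambda>_. 0) \<and>
     (\<forall>f. rational_fun X f \<and> \<not> rat_eq X f (\<lambda>_. 0) \<longrightarrow>
        (\<exists>(k::int) u. local_unit X p u \<and> rat_eq X f (\<lambda>q. t q powi k * u q)))"

text \<open>A smooth projective curve is a projective variety whose local ring at every point is a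
  regular local ring of dimension 1, that is, a discrete valuation ring (with the function field
  as its field of fractions).\<close>

definition smooth_projective_curve :: "'n::finite proj_space set \<Rightarrow> bool" where
  "smooth_projective_curve X \<longleftrightarrow> projective_variety X \<and> (\<forall>p\<in>X. \<exists>t. uniformizer X p t)"

text \<open>The order of vanishing at \<open>p\<close>; meaningful only for rational functions that are not zero.\<close>

definition ord_at :: "'n::finite proj_space set \<Rightarrow> 'n proj_space \<Rightarrow> ('n proj_space \<Rightarrow> complex) \<Rightarrow> int" where
  "ord_at X p f =
     (THE k. \<exists>t u. uniformizer X p t \<and> local_unit X p u \<and> rat_eq X f (\<lambda>q. t q powi k * u q))"


section \<open>Divisors and genus\<close>

definition divisors :: "'n::finite proj_space set \<Rightarrow> ('n proj_space \<Rightarrow> int) set" where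
  "divisors X = {D. finite {p. D p \<noteq> 0} \<and> {p. D p \<noteq> 0} \<subseteq> X}"

definition divisor_degree :: "('n::finite proj_space \<Rightarrow> int) \<Rightarrow> int" where
  "divisor_degree D = (\<Sum>p | D p \<noteq> 0. D p)"

definition point_divisor :: "'n::finite proj_space \<Rightarrow> 'n proj_space \<Rightarrow> int" where
  "point_divisor P = (\<lambda>Q. if Q = P then 1 else 0)"

definition lin_equiv :: "'n::finite proj_space set \<Rightarrow> ('n proj_space \<Rightarrow> int) \<Rightarrow> ('n proj_space \<Rightarrow> int) \<Rightarrow> bool" where
  "lin_equiv X D D' \<longleftrightarrow>
     (\<exists>f. rational_fun X f \<and> \<not> rat_eq X f (\<lambda>_. 0) \<and> (\<forall>p\<in>X. D p - D' p = ord_at X p f))"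

definition rr_space :: "'n::finite proj_space set \<Rightarrow> ('n proj_space \<Rightarrow> int) \<Rightarrow> ('n proj_space \<Rightarrow> complex) set" where
  "rr_space X D =
     {f. rational_fun X f \<and> (rat_eq X f (\<lambda>_. 0) \<or> (\<forall>p\<in>X. ord_at X p f + D p \<ge> 0))}"

text \<open>The Riemann-Roch space of \<open>D\<close>, as a subspace of the function field, has a basis of length
  \<open>l\<close>. (Elements of the function field are functions modulo \<open>rat_eq X\<close>, so the library's notion
  of dimension does not apply directly.)\<close>

definition rr_dim :: "'n::finite proj_space set \<Rightarrow> ('n proj_space \<Rightarrow> int) \<Rightarrow> nat \<Rightarrow> bool" where
  "rr_dim X D l \<longleftrightarrow>
     (\<exists>b. (\<forall>i<l. b i \<in> rr_space X D) \<and>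
        (\<forall>f\<in>rr_space X D. \<exists>!c :: nat \<Rightarrow> complex.
           c \<in> {..<l} \<rightarrow>\<^sub>E UNIV \<and> rat_eq X f (\<lambda>p. \<Sum>i<l. c i * b i p)))"

text \<open>The genus is the maximum of \<open>deg D - \<ell>(D) + 1\<close> over all divisors \<open>D\<close>.\<close>

definition has_genus :: "'n::finite proj_space set \<Rightarrow> nat \<Rightarrow> bool" where
  "has_genus X g \<longleftrightarrow>
     (\<forall>D\<in>divisors X. \<exists>l. rr_dim X D l \<and> divisor_degree D - int l + 1 \<le> int g) \<and>
     (\<exists>D\<in>divisors X. \<exists>l. rr_dim X D l \<and> divisor_degree D - int l + 1 = int g)"

text \<open>The group law of an elliptic curve, that is, of a curve \<open>E\<close> of genus 1 with origin \<open>Or\<close>: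
  \<open>P + Q = R\<close> if and only if \<open>(P) + (Q)\<close> and \<open>(R) + (Or)\<close> are linearly equivalent.\<close>

definition ell_add :: "'n::finite proj_space set \<Rightarrow> 'n proj_space \<Rightarrow> 'n proj_space \<Rightarrow> 'n proj_space \<Rightarrow> 'n proj_space" where
  "ell_add E Or P Q = (THE R. R \<in> E \<and>
     lin_equiv E (\<lambda>S. point_divisor P S + point_divisor Q S)
                 (\<lambda>S. point_divisor R S + point_divisor Or S))"

definition ell_neg :: "'n::finite proj_space set \<Rightarrow> 'n proj_space \<Rightarrow> 'n proj_space \<Rightarrow> 'n proj_space" where
  "ell_neg E Or P = (THE Q. Q \<in> E \<and> ell_add E Or P Q = Or)"


section \<open>Morphisms and ramification\<close>

definition morphism :: "'n::finite proj_space set \<Rightarrow> 'm::finite proj_space set \<Rightarrow> ('n proj_space \<Rightarrow> 'm proj_space) \<Rightarrow> bool" where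
  "morphism X Y f \<longleftrightarrow> f ` X \<subseteq> Y \<and>
     (\<forall>p\<in>X. \<exists>d F. (\<forall>j. homogeneous_poly d (F j)) \<and> (\<exists>j. F j (hcoords p) \<noteq> 0) \<and>
        (\<forall>q\<in>X. (\<exists>j. F j (hcoords q) \<noteq> 0) \<longrightarrow> f q = hpoint (\<chi> j. F j (hcoords q))))"

text \<open>The order at \<open>p\<close> of the pullback of a uniformizer at \<open>f p\<close>, for a nonconstant morphism
  of curves; the choice of the uniformizer does not matter.\<close>

definition ram_index :: "'n::finite proj_space set \<Rightarrow> 'm::finite proj_space set \<Rightarrow> ('n proj_space \<Rightarrow> 'm proj_space) \<Rightarrow> 'n proj_space \<Rightarrow> nat" where
  "ram_index X Y f p = nat (ord_at X p ((SOME t. uniformizer Y (f p) t) \<circ> f))"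

definition fiber :: "'n::finite proj_space set \<Rightarrow> ('n proj_space \<Rightarrow> 'm::finite proj_space) \<Rightarrow> 'm proj_space \<Rightarrow> 'n proj_space set" where
  "fiber X f q = {p\<in>X. f p = q}"

text \<open>The degree is the number of points in any fiber, counted with multiplicity.\<close>

definition covering :: "'n::finite proj_space set \<Rightarrow> 'm::finite proj_space set \<Rightarrow> ('n proj_space \<Rightarrow> 'm proj_space) \<Rightarrow> nat \<Rightarrow> bool" where
  "covering X Y f n \<longleftrightarrow> morphism X Y f \<and>
     (\<forall>q\<in>Y. finite (fiber X f q) \<and> (\<Sum>p\<in>fiber X f q. ram_index X Y f p) = n)"

abbreviation P1 :: "2 proj_space set" where
  "P1 \<equiv> UNIV"

definition involution_of :: "'n::finite proj_space set \<Rightarrow> ('n proj_space \<Rightarrow> 'n proj_space) \<Rightarrow> bool" where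
  "involution_of X s \<longleftrightarrow> morphism X X s \<and> (\<forall>p\<in>X. s (s p) = p) \<and> (\<exists>p\<in>X. s p \<noteq> p)"

text \<open>\<open>\<pi>\<close> is the degree 2 projection of \<open>X\<close> to the quotient by \<open>s\<close>, identified with the
  projective line: the fibers of \<open>\<pi>\<close> are the orbits of \<open>s\<close>.\<close>

definition P1_quotient :: "'n::finite proj_space set \<Rightarrow> ('n proj_space \<Rightarrow> 'n proj_space) \<Rightarrow> ('n proj_space \<Rightarrow> 2 proj_space) \<Rightarrow> bool" where
  "P1_quotient X s \<pi> \<longleftrightarrow> covering X P1 \<pi> 2 \<and>
     (\<forall>p\<in>X. \<forall>q\<in>X. \<pi> p = \<pi> q \<longleftrightarrow> q = p \<or> q = s p)"

definition hyperelliptic_involution :: "'n::finite proj_space set \<Rightarrow> ('n proj_space \<Rightarrow> 'n proj_space) \<Rightarrow> bool" where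
  "hyperelliptic_involution X w \<longleftrightarrow> involution_of X w \<and> (\<exists>\<pi>. P1_quotient X w \<pi>)"

definition frey_kani_covering ::
  "'n::finite proj_space set \<Rightarrow> 'm::finite proj_space set \<Rightarrow> ('n proj_space \<Rightarrow> 'm proj_space) \<Rightarrow> nat \<Rightarrow>
   ('n proj_space \<Rightarrow> 2 proj_space) \<Rightarrow> ('m proj_space \<Rightarrow> 2 proj_space) \<Rightarrow>
   (2 proj_space \<Rightarrow> 2 proj_space) \<Rightarrow> bool" where
  "frey_kani_covering C E \<psi> n \<pi>C \<pi>E \<phi> \<longleftrightarrow>
     covering P1 P1 \<phi> n \<and> (\<forall>p\<in>C. \<phi> (\<pi>C p) = \<pi>E (\<psi> p))"


section \<open>Ramification types\<close>

definition case_I :: "'n::finite proj_space set \<Rightarrow> 'm::finite proj_space set \<Rightarrow> ('n proj_space \<Rightarrow> 'm proj_space) \<Rightarrow> bool" where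
  "case_I C E \<psi> \<longleftrightarrow> (\<exists>p1\<in>C. \<exists>p2\<in>C. p1 \<noteq> p2 \<and> ram_index C E \<psi> p1 = 2 \<and> ram_index C E \<psi> p2 = 2 \<and>
     \<psi> p1 \<noteq> \<psi> p2 \<and> (\<forall>p\<in>C - {p1, p2}. ram_index C E \<psi> p = 1))"

definition case_II :: "'n::finite proj_space set \<Rightarrow> 'm::finite proj_space set \<Rightarrow> ('n proj_space \<Rightarrow> 'm proj_space) \<Rightarrow> bool" where
  "case_II C E \<psi> \<longleftrightarrow> (\<exists>p1\<in>C. \<exists>p2\<in>C. p1 \<noteq> p2 \<and> ram_index C E \<psi> p1 = 2 \<and> ram_index C E \<psi> p2 = 2 \<and>
     \<psi> p1 = \<psi> p2 \<and> (\<forall>p\<in>C - {p1, p2}. ram_index C E \<psi> p = 1))"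

definition case_III :: "'n::finite proj_space set \<Rightarrow> 'm::finite proj_space set \<Rightarrow> ('n proj_space \<Rightarrow> 'm proj_space) \<Rightarrow> bool" where
  "case_III C E \<psi> \<longleftrightarrow>
     (\<exists>p1\<in>C. ram_index C E \<psi> p1 = 3 \<and> (\<forall>p\<in>C - {p1}. ram_index C E \<psi> p = 1))"

definition fiber_ramification :: "'n::finite proj_space set \<Rightarrow> 'm::finite proj_space set \<Rightarrow> ('n proj_space \<Rightarrow> 'm proj_space) \<Rightarrow> 'm proj_space \<Rightarrow> nat multiset" where
  "fiber_ramification X Y f q =
     filter_mset (\<lambda>e. e \<noteq> 1) (image_mset (ram_index X Y f) (mset_set (fiber X f q)))"

text \<open>A fiber with \<open>k\<close> points of ramification index \<open>m\<close> and \<open>k'\<close> points of index \<open>m'\<close>, all others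
  being unramified, is described by \<open>[(m, k), (m', k')]\<close>, and a
  ramification type is the list of the data of its fibers. Exponents are integers, so that a type
  with a negative exponent can be recognized; such a type does not occur.\<close>

type_synonym fiber_data = "(nat \<times> int) list"

definition fiber_data_mset :: "fiber_data \<Rightarrow> nat multiset" where
  "fiber_data_mset xs = (\<Sum>(m, k)\<leftarrow>xs. replicate_mset (nat k) m)"

text \<open>The points \<open>qs\<close> may come in any order. An entry of \<open>T\<close> without ramified points belongs to
  a point \<open>q\<close> that is not a branch point.\<close>

definition has_ramification :: "'n::finite proj_space set \<Rightarrow> 'm::finite proj_space set \<Rightarrow> ('n proj_space \<Rightarrow> 'm proj_space) \<Rightarrow> fiber_data list \<Rightarrow> bool" where
  "has_ramification X Y f T \<longleftrightarrow>
     (\<forall>xs\<in>set T. \<forall>(m, k)\<in>set xs. k \<ge> 0) \<and>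
     (\<exists>qs. distinct qs \<and> set qs \<subseteq> Y \<and>
        map (fiber_ramification X Y f) qs = map fiber_data_mset T \<and>
        (\<forall>q\<in>Y - set qs. fiber_ramification X Y f q = {#}))"

definition generic_types :: "int \<Rightarrow> fiber_data list set" where
  "generic_types n = {
     [[(2, (n-2) div 2)], [(2, (n-2) div 2)], [(2, (n-2) div 2)], [(2, n div 2)], [(2, 1)]],
     [[(2, (n-4) div 2)], [(2, (n-2) div 2)], [(2, n div 2)],     [(2, n div 2)], [(2, 1)]],
     [[(2, (n-6) div 2)], [(2, n div 2)],     [(2, n div 2)],     [(2, n div 2)], [(2, 1)]]}"

definition degenerations_I :: "int \<Rightarrow> fiber_data list set" where
  "degenerations_I n = {
     [[(2, n div 2)], [(2, (n-2) div 2)], [(2, (n-2) div 2)], [(2, n div 2)]],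
     [[(2, (n-2) div 2)], [(2, (n-2) div 2)], [(4, 1), (2, (n-6) div 2)], [(2, n div 2)]],
     [[(2, (n-2) div 2)], [(2, (n-2) div 2)], [(2, (n-2) div 2)], [(4, 1), (2, (n-4) div 2)]],
     [[(3, 1), (2, (n-4) div 2)], [(2, (n-2) div 2)], [(2, (n-2) div 2)], [(2, n div 2)]]}"

definition degenerations_II :: "int \<Rightarrow> fiber_data list set" where
  "degenerations_II n = {
     [[(2, (n-2) div 2)], [(2, (n-2) div 2)], [(2, n div 2)], [(2, n div 2)]],
     [[(2, (n-4) div 2)], [(2, n div 2)], [(2, n div 2)], [(2, n div 2)]],
     [[(4, 1), (2, (n-8) div 2)], [(2, (n-2) div 2)], [(2, n div 2)], [(2, n div 2)]],
     [[(2, (n-4) div 2)], [(4, 1), (2, (n-6) div 2)], [(2, n div 2)], [(2, n div 2)]],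
     [[(2, (n-4) div 2)], [(2, (n-2) div 2)], [(4, 1), (2, (n-4) div 2)], [(2, n div 2)]],
     [[(3, 1), (2, (n-6) div 2)], [(2, (n-2) div 2)], [(2, n div 2)], [(2, n div 2)]],
     [[(2, (n-4) div 2)], [(3, 1), (2, (n-4) div 2)], [(2, n div 2)], [(2, n div 2)]]}"

definition degenerations_III :: "int \<Rightarrow> fiber_data list set" where
  "degenerations_III n = {
     [[(2, (n-4) div 2)], [(2, n div 2)], [(2, n div 2)], [(2, n div 2)]],
     [[(2, (n-6) div 2)], [(4, 1), (2, (n-4) div 2)], [(2, n div 2)], [(2, n div 2)]],
     [[(2, n div 2)], [(2, n div 2)], [(2, n div 2)], [(4, 1), (2, (n-10) div 2)]],
     [[(3, 1), (2, (n-8) div 2)], [(2, n div 2)], [(2, n div 2)], [(2, n div 2)]]}"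

end

theory Submission
  imports Defs "HOL-Computational_Algebra.Fundamental_Theorem_Algebra"
begin

text \<open>
  A double cover \<open>\<pi> : X \<rightarrow> P1\<close> of genus \<open>g\<close> is given by an equation \<open>y\<^sup>2 = f(x)\<close> with \<open>f\<close> squarefree: the
  dimensions of the spaces \<open>L(kF)\<close>, where \<open>F\<close> is the fiber at infinity, force the function field to have
  degree 2 over the field of functions of \<open>x\<close>, and comparing them with the genus shows that there are
  \<open>2g + 2\<close> ramification points. The function \<open>y\<close> is anti-invariant under the involution, and every
  anti-invariant function has odd order at the fixed points.

  Hence \<open>w\<close> has 6 fixed points on \<open>C\<close> and \<open>v\<close> has 4 on \<open>E\<close>, and \<open>\<psi>\<close> has odd ramification index
  at the fixed points of \<open>w\<close>, because the pullback of an anti-invariant function on \<open>E\<close> is anti-invariant.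
  By multiplicativity of ramification indices, over the 4 branch points of \<open>\<pi>E\<close> the index of \<open>\<phi>\<close>
  at a point \<open>\<pi>C p\<close> is that of \<open>\<psi>\<close> at \<open>p\<close> if \<open>p\<close> is fixed by \<open>w\<close> and twice that otherwise, so the type of
  \<open>\<phi>\<close> is determined by how the 6 branch points of \<open>\<pi>C\<close> are distributed. As \<open>n\<close> is even, each of the
  4 fibers contains an even number of them, which leaves (2,2,2,0), (4,2,0,0) and (6,0,0,0).
\<close>

section \<open>Homogeneous polynomials\<close>

text \<open>The genus is given only as a maximum of \<open>deg D - l(D) + 1\<close>, so it is
  exploited from both sides: every divisor yields a lower bound for \<open>l(D)\<close>, and every
  divisor above a maximising one yields an upper bound. Three functions independent over C(x),
  multiplied by powers of x, would fill \<open>L(kF)\<close> at rate 3k, but kF has degree 2k and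
  cannot raise the dimension faster than 2k; this bounds the degree of the function field by 2. With
  \<open>\<delta>\<close> half the degree of f, rounded up, \<open>L(kF)\<close> consists of the
  A(x) + B(x) y with deg A \<le> k and deg B \<le> k - \<open>\<delta>\<close>, and the two bounds
  give \<open>\<delta>\<close> = g + 1. The delicate point is that A and B have no poles:
  cancellation between a and b y must be excluded, by parity at fixed points and elsewhere by the
  fact that y takes different values at the two points of a fiber. The parity of the distribution
  comes from the fibers of \<open>\<phi>\<close>: over a branch point of \<open>\<pi>E\<close> the
  indices add up to n, and exactly the branch points of \<open>\<pi>C\<close> contribute odd
  ones.\<close>

lemma hp_zero [simp, intro]: "homogeneous_poly d (\<lambda>x. 0)"
  unfolding homogeneous_poly_def by (intro exI[of _ "\<lambda>_. 0"]) simp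

lemma hp_add [intro]:
  assumes "homogeneous_poly d F" "homogeneous_poly d G"
  shows "homogeneous_poly d (\<lambda>x. F x + G x)"
proof -
  obtain a b where "F = (\<lambda>x. \<Sum>m | (\<Sum>i\<in>UNIV. m i) = d. a m * (\<Prod>i\<in>UNIV. (x $ i) ^ m i))"
     "G = (\<lambda>x. \<Sum>m | (\<Sum>i\<in>UNIV. m i) = d. b m * (\<Prod>i\<in>UNIV. (x $ i) ^ m i))"
    using assms by (auto simp: homogeneous_poly_def)
  then show ?thesis unfolding homogeneous_poly_def
    by (intro exI[of _ "\<lambda>m. a m + b m"]) (auto simp: sum.distrib algebra_simps)
qed

lemma hp_cmult [intro]:
  assumes "homogeneous_poly d F"
  shows "homogeneous_poly d (\<lambda>x. c * F x)"
proof -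
  obtain a where "F = (\<lambda>x. \<Sum>m | (\<Sum>i\<in>UNIV. m i) = d. a m * (\<Prod>i\<in>UNIV. (x $ i) ^ m i))"
    using assms by (auto simp: homogeneous_poly_def)
  then show ?thesis unfolding homogeneous_poly_def
    by (intro exI[of _ "\<lambda>m. c * a m"]) (auto simp: sum_distrib_left algebra_simps)
qed

lemma hp_diff [intro]:
  assumes "homogeneous_poly d F" "homogeneous_poly d G"
  shows "homogeneous_poly d (\<lambda>x. F x - G x)"
  using hp_add[OF assms(1) hp_cmult[OF assms(2), of "-1"]] by simp

lemma hp_sum [intro]:
  "(\<And>i. i \<in> I \<Longrightarrow> homogeneous_poly d (F i)) \<Longrightarrow> homogeneous_poly d (\<lambda>x. \<Sum>i\<in>I. F i x)"
  by (induction I rule: infinite_finite_induct) auto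

lemma hp_monomial:
  fixes m :: "'n::finite \<Rightarrow> nat"
  assumes "(\<Sum>i\<in>UNIV. m i) = d"
  shows "homogeneous_poly d (\<lambda>x. \<Prod>i\<in>UNIV. (x $ i) ^ m i)"
  unfolding homogeneous_poly_def
proof (intro exI[of _ "\<lambda>m'. if m' = m then 1 else 0"] ext)
  fix x :: "complex ^ 'n"
  have "(\<Sum>m' | (\<Sum>i\<in>UNIV. m' i) = d. (if m' = m then 1 else 0) * (\<Prod>i\<in>UNIV. (x $ i) ^ m' i))
      = (\<Sum>m' | (\<Sum>i\<in>UNIV. m' i) = d. (if m' = m then (\<Prod>i\<in>UNIV. (x $ i) ^ m' i) else 0))"
    by (intro sum.cong) auto
  also have "\<dots> = (\<Prod>i\<in>UNIV. (x $ i) ^ m i)"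
    using assms by (subst sum.delta) (auto simp: finite_monomials)
  finally show "(\<Prod>i\<in>UNIV. (x $ i) ^ m i) =
     (\<Sum>m' | (\<Sum>i\<in>UNIV. m' i) = d. (if m' = m then 1 else 0) * (\<Prod>i\<in>UNIV. (x $ i) ^ m' i))" by simp
qed

lemma hp_mult [intro]:
  fixes F G :: "complex ^ 'n::finite \<Rightarrow> complex"
  assumes "homogeneous_poly d F" "homogeneous_poly e G"
  shows "homogeneous_poly (d + e) (\<lambda>x. F x * G x)"
proof -
  obtain a b where FG: "F = (\<lambda>x. \<Sum>m | (\<Sum>i\<in>UNIV. m i) = d. a m * (\<Prod>i\<in>UNIV. (x $ i) ^ m i))"
     "G = (\<lambda>x. \<Sum>m | (\<Sum>i\<in>UNIV. m i) = e. b m * (\<Prod>i\<in>UNIV. (x $ i) ^ m i))"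
    using assms by (auto simp: homogeneous_poly_def)
  have "homogeneous_poly (d + e) (\<lambda>x :: complex ^ 'n. \<Sum>m | (\<Sum>i\<in>UNIV. m i) = d.
     \<Sum>m' | (\<Sum>i\<in>UNIV. m' i) = e. (a m * b m') * (\<Prod>i\<in>UNIV. (x $ i) ^ (m i + m' i)))"
    by (intro hp_sum hp_cmult hp_monomial) (auto simp: sum.distrib)
  also have "(\<lambda>x :: complex ^ 'n. \<Sum>m | (\<Sum>i\<in>UNIV. m i) = d.
     \<Sum>m' | (\<Sum>i\<in>UNIV. m' i) = e. (a m * b m') * (\<Prod>i\<in>UNIV. (x $ i) ^ (m i + m' i)))
     = (\<lambda>x. F x * G x)"
    unfolding FG sum_product
    by (intro ext sum.cong) (auto simp: power_add prod.distrib)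
  finally show ?thesis .
qed

lemma hp_const [simp, intro]: "homogeneous_poly 0 (\<lambda>x :: complex ^ 'n::finite. c)"
  using hp_cmult[OF hp_monomial[of "\<lambda>_ :: 'n. 0" 0], of c] by simp

lemma hp_coord [simp, intro]: "homogeneous_poly (Suc 0) (\<lambda>x :: complex ^ 'n::finite. x $ j)"
proof -
  have "homogeneous_poly (Suc 0) (\<lambda>x :: complex ^ 'n. \<Prod>i\<in>UNIV. (x $ i) ^ (if i = j then 1 else 0))"
    by (rule hp_monomial) simp
  also have "(\<lambda>x :: complex ^ 'n. \<Prod>i\<in>UNIV. (x $ i) ^ (if i = j then 1 else 0)) = (\<lambda>x. x $ j)"
  proof
    fix x :: "complex ^ 'n"
    have "(\<Prod>i\<in>UNIV. (x $ i) ^ (if i = j then 1 else 0)) = (\<Prod>i\<in>UNIV. if i = j then x $ i else 1)"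
      by (intro prod.cong) auto
    then show "(\<Prod>i\<in>UNIV. (x $ i) ^ (if i = j then 1 else 0)) = x $ j" by simp
  qed
  finally show ?thesis .
qed

lemma hp_power [intro]:
  assumes "homogeneous_poly d F"
  shows "homogeneous_poly (k * d) (\<lambda>x. F x ^ k)"
proof (induction k)
  case (Suc k)
  then show ?case using hp_mult[OF assms Suc] by simp
qed auto

lemma hp_prod:
  assumes "\<And>i. i \<in> I \<Longrightarrow> homogeneous_poly (d i) (F i)"
  shows "homogeneous_poly (\<Sum>i\<in>I. d i) (\<lambda>x. \<Prod>i\<in>I. F i x)"
  using assms by (induction I rule: infinite_finite_induct) auto

lemma hp_compose:
  fixes F :: "complex ^ 'm::finite \<Rightarrow> complex" and G :: "'m \<Rightarrow> complex ^ 'n::finite \<Rightarrow> complex"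
  assumes "homogeneous_poly d F" "\<And>j. homogeneous_poly e (G j)"
  shows "homogeneous_poly (d * e) (\<lambda>x. F (\<chi> j. G j x))"
proof -
  obtain a where F: "F = (\<lambda>x. \<Sum>m | (\<Sum>i\<in>UNIV. m i) = d. a m * (\<Prod>i\<in>UNIV. (x $ i) ^ m i))"
    using assms by (auto simp: homogeneous_poly_def)
  have "homogeneous_poly (d * e) (\<lambda>x. \<Prod>i\<in>UNIV. G i x ^ m i)" if "(\<Sum>i\<in>UNIV. m i) = d" for m
    using hp_prod[of UNIV "\<lambda>i. m i * e" "\<lambda>i x. G i x ^ m i"] assms(2) that
    by (auto simp: sum_distrib_right[symmetric])
  then show ?thesis unfolding F by (auto intro!: hp_sum hp_cmult)
qed

lemma hp_continuous: "homogeneous_poly d F \<Longrightarrow> continuous_on A F"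
  by (auto simp: homogeneous_poly_def intro!: continuous_intros)

lemma hp_hpoint:
  assumes "homogeneous_poly d F" "x \<noteq> 0"
  shows "F (hcoords (hpoint x)) = 0 \<longleftrightarrow> F x = 0"
proof -
  have "hpoint (hcoords (hpoint x)) = hpoint x" by (rule hpoint_hcoords)
  then obtain c where "c \<noteq> 0" "x = c *s hcoords (hpoint x)"
    using hpoint_eq_iff[OF hcoords_nonzero assms(2)] by blast
  then show ?thesis using homogeneous_poly_scale[OF assms(1), of c "hcoords (hpoint x)"] by auto
qed

lemma hpoint_scale: "c \<noteq> 0 \<Longrightarrow> x \<noteq> 0 \<Longrightarrow> hpoint (c *s x) = hpoint x"
  using hpoint_eq_iff[of x "c *s x"] by auto

lemma hcoords_hpoint:
  assumes "x \<noteq> 0" obtains c where "c \<noteq> 0" "hcoords (hpoint x) = c *s x"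
  using hpoint_eq_iff[OF assms hcoords_nonzero] hpoint_hcoords by metis

text \<open>Proportionality by vanishing 2x2 minors: the coordinate \<open>i0\<close> supplies the
  scalar \<open>y $ i0 / x $ i0\<close>, which is nonzero because \<open>y\<close> is.\<close>

lemma proj_eqI:
  assumes "x \<noteq> 0" "x $ i0 \<noteq> 0" "y \<noteq> 0" "\<And>i. y $ i * x $ i0 = y $ i0 * x $ i"
  shows "hpoint x = hpoint y"
proof -
  have eq: "y = (y $ i0 / x $ i0) *s x"
    using assms(2,4) by (simp add: vec_eq_iff field_simps)
  moreover have "y $ i0 / x $ i0 \<noteq> 0"
    using eq assms(3) by (metis vector_smult_lzero)
  ultimately show ?thesis using hpoint_eq_iff[OF assms(1,3)] by blast
qed

text \<open>Distinct points are not proportional, so some 2x2 minor is nonzero; read as a function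
  of its second vector, this minor is the form.\<close>

lemma linear_form_sep:
  fixes p q :: "'n::finite proj_space"
  assumes "p \<noteq> q"
  obtains F where "homogeneous_poly (Suc 0) F" "F (hcoords p) = 0" "F (hcoords q) \<noteq> 0"
proof -
  have "hcoords p \<noteq> 0" by (rule hcoords_nonzero)
  then obtain i0 where i0: "hcoords p $ i0 \<noteq> 0" by (auto simp: vec_eq_iff)
  have "\<exists>i. hcoords q $ i * hcoords p $ i0 \<noteq> hcoords q $ i0 * hcoords p $ i"
    using proj_eqI[OF hcoords_nonzero i0 hcoords_nonzero, of q] assms by (auto simp: hpoint_hcoords)
  then obtain i where i: "hcoords q $ i * hcoords p $ i0 \<noteq> hcoords q $ i0 * hcoords p $ i" by blast
  show ?thesis
  proof (rule that)
    show "homogeneous_poly (Suc 0) (\<lambda>x. hcoords p $ i0 * x $ i - hcoords p $ i * x $ i0)"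
      by (intro hp_diff hp_cmult hp_coord)
  qed (use i in \<open>simp_all add: mult.commute\<close>)
qed

lemma linear_form_nonzero2:
  fixes p q :: "'n::finite proj_space"
  obtains F where "homogeneous_poly (Suc 0) F" "F (hcoords p) \<noteq> 0" "F (hcoords q) \<noteq> 0"
proof -
  obtain i j where ij: "hcoords p $ i \<noteq> 0" "hcoords q $ j \<noteq> 0"
    using hcoords_nonzero[of p] hcoords_nonzero[of q] by (auto simp: vec_eq_iff)
  show ?thesis
  proof (cases "hcoords p $ j = 0 \<and> hcoords q $ i = 0")
    case True
    then show ?thesis using ij by (intro that[of "\<lambda>x. x $ i + x $ j"]) auto
  next
    case False
    then show ?thesis using ij that[of "\<lambda>x. x $ i"] that[of "\<lambda>x. x $ j"] by auto
  qed
qed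

section \<open>Zariski neighbourhoods\<close>

text \<open>Neighbourhoods in the Zariski topology, through the basis of principal open sets. A
  single form suffices because finite intersections correspond to products of forms.\<close>

definition near :: "'n::finite proj_space set \<Rightarrow> 'n proj_space \<Rightarrow> ('n proj_space \<Rightarrow> bool) \<Rightarrow> bool" where
  "near X p P \<longleftrightarrow> (\<exists>d H. homogeneous_poly d H \<and> H (hcoords p) \<noteq> 0 \<and>
     (\<forall>q\<in>X. H (hcoords q) \<noteq> 0 \<longrightarrow> P q))"

lemma nearI:
  "homogeneous_poly d H \<Longrightarrow> H (hcoords p) \<noteq> 0 \<Longrightarrow> (\<And>q. q \<in> X \<Longrightarrow> H (hcoords q) \<noteq> 0 \<Longrightarrow> P q) \<Longrightarrow> near X p P"
  unfolding near_def by blast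

lemma near_mono: "near X p P \<Longrightarrow> (\<And>q. q \<in> X \<Longrightarrow> P q \<Longrightarrow> Q q) \<Longrightarrow> near X p Q"
  unfolding near_def by blast

lemma near_always: "(\<And>q. q \<in> X \<Longrightarrow> P q) \<Longrightarrow> near X p P"
  by (rule nearI[of 0 "\<lambda>_. 1"]) auto

lemma near_conj: "near X p P \<Longrightarrow> near X p Q \<Longrightarrow> near X p (\<lambda>q. P q \<and> Q q)"
proof -
  assume "near X p P" "near X p Q"
  then obtain d H d' H' where "homogeneous_poly d H" "H (hcoords p) \<noteq> 0"
     "\<forall>q\<in>X. H (hcoords q) \<noteq> 0 \<longrightarrow> P q"
     "homogeneous_poly d' H'" "H' (hcoords p) \<noteq> 0" "\<forall>q\<in>X. H' (hcoords q) \<noteq> 0 \<longrightarrow> Q q"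
    unfolding near_def by blast
  then show ?thesis by (intro nearI[of "d + d'" "\<lambda>x. H x * H' x"]) auto
qed

lemma near_ball_finite:
  "finite I \<Longrightarrow> (\<And>i. i \<in> I \<Longrightarrow> near X p (P i)) \<Longrightarrow> near X p (\<lambda>q. \<forall>i\<in>I. P i q)"
proof (induction I rule: finite_induct)
  case empty
  then show ?case by (simp add: near_always)
next
  case (insert i I)
  then have "near X p (\<lambda>q. P i q \<and> (\<forall>i\<in>I. P i q))" by (intro near_conj) auto
  then show ?case by (rule near_mono) auto
qed

lemma near_point: "near X p P \<Longrightarrow> p \<in> X \<Longrightarrow> P p"
  unfolding near_def by blast

lemma closed_hp: 
  assumes "homogeneous_poly d F" shows "zariski_closed {p. F (hcoords p) = 0}"
  unfolding zariski_closed_def using assms by (intro exI[of _ "{F}"]) auto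

lemma generically_iff_near: "generically X P \<longleftrightarrow> (\<exists>p\<in>X. near X p P)"
proof
  assume "generically X P"
  then obtain Z where Z: "zariski_closed Z" "\<not> X \<subseteq> Z" "\<forall>q\<in>X - Z. P q"
    unfolding generically_def by blast
  then obtain p where p: "p \<in> X" "p \<notin> Z" by blast
  obtain S where S: "\<forall>F\<in>S. \<exists>d. homogeneous_poly d F" "Z = {p. \<forall>F\<in>S. F (hcoords p) = 0}"
    using Z unfolding zariski_closed_def by blast
  obtain F where "F \<in> S" "F (hcoords p) \<noteq> 0" using p S by blast
  moreover from this obtain d where "homogeneous_poly d F" using S by blast
  ultimately have "near X p P" using Z S by (intro nearI[of d F]) auto
  then show "\<exists>p\<in>X. near X p P" using p by blast
next
  assume "\<exists>p\<in>X. near X p P"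
  then obtain p d H where H: "p \<in> X" "homogeneous_poly d H" "H (hcoords p) \<noteq> 0"
     "\<forall>q\<in>X. H (hcoords q) \<noteq> 0 \<longrightarrow> P q" unfolding near_def by blast
  show "generically X P" unfolding generically_def
    using H closed_hp[OF H(2)] by (intro exI[of _ "{p. H (hcoords p) = 0}"]) auto
qed

text \<open>Irreducibility: the zero sets of the two forms cannot cover \<open>X\<close>, since each
  of them misses a point of it.\<close>

lemma near_nonempty:
  assumes "projective_variety X" "p \<in> X" "q \<in> X" "near X p P" "near X q Q"
  obtains r where "r \<in> X" "near X r (\<lambda>s. P s \<and> Q s)"
proof -
  obtain d H d' H' where H: "homogeneous_poly d H" "H (hcoords p) \<noteq> 0"
     "\<forall>q\<in>X. H (hcoords q) \<noteq> 0 \<longrightarrow> P q"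
     "homogeneous_poly d' H'" "H' (hcoords q) \<noteq> 0" "\<forall>q\<in>X. H' (hcoords q) \<noteq> 0 \<longrightarrow> Q q"
    using assms(4,5) unfolding near_def by blast
  have "\<not> X \<subseteq> {p. H (hcoords p) = 0} \<union> {p. H' (hcoords p) = 0}"
    using assms(1) closed_hp[OF H(1)] closed_hp[OF H(4)] assms(2,3) H(2,5)
    unfolding projective_variety_def by blast
  then obtain r where r: "r \<in> X" "H (hcoords r) \<noteq> 0" "H' (hcoords r) \<noteq> 0" by auto
  have "near X r P" "near X r Q" using r H nearI[of d H r X P] nearI[of d' H' r X Q] by auto
  then show ?thesis using that r(1) near_conj by blast
qed

lemma generically_conj:
  assumes "projective_variety X" "generically X P" "generically X Q"
  shows "generically X (\<lambda>s. P s \<and> Q s)"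
proof -
  obtain p q where "p \<in> X" "q \<in> X" "near X p P" "near X q Q"
    using assms(2,3) unfolding generically_iff_near by blast
  then show ?thesis unfolding generically_iff_near using near_nonempty[OF assms(1)] by blast
qed

lemma generically_mono: "generically X P \<Longrightarrow> (\<And>q. q \<in> X \<Longrightarrow> P q \<Longrightarrow> Q q) \<Longrightarrow> generically X Q"
  unfolding generically_def by blast

lemma generically_2:
  assumes "projective_variety X" "generically X P" "generically X Q"
    "\<And>q. q \<in> X \<Longrightarrow> P q \<Longrightarrow> Q q \<Longrightarrow> R q"
  shows "generically X R"
  using generically_mono[OF generically_conj[OF assms(1-3)]] assms(4) by blast

lemma generically_ex: "generically X P \<Longrightarrow> \<exists>q\<in>X. P q"
  unfolding generically_def by blast

text \<open>A local representation F/G becomes one that is valid wherever its denominator is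
  nonzero, as \<open>regular_at\<close> demands, by multiplying numerator and denominator with the
  form that cuts out the neighbourhood.\<close>

lemma regular_at_near:
  "regular_at X p f \<longleftrightarrow> (\<exists>d F G. homogeneous_poly d F \<and> homogeneous_poly d G \<and> G (hcoords p) \<noteq> 0 \<and>
     near X p (\<lambda>q. G (hcoords q) \<noteq> 0 \<and> f q = F (hcoords q) / G (hcoords q)))"
proof
  assume "regular_at X p f"
  then obtain d F G where *: "homogeneous_poly d F" "homogeneous_poly d G" "G (hcoords p) \<noteq> 0"
     "\<forall>q\<in>X. G (hcoords q) \<noteq> 0 \<longrightarrow> f q = F (hcoords q) / G (hcoords q)"
    unfolding regular_at_def by blast
  have "near X p (\<lambda>q. G (hcoords q) \<noteq> 0 \<and> f q = F (hcoords q) / G (hcoords q))"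
    using * by (intro nearI[of d G]) auto
  with * show "\<exists>d F G. homogeneous_poly d F \<and> homogeneous_poly d G \<and> G (hcoords p) \<noteq> 0 \<and>
     near X p (\<lambda>q. G (hcoords q) \<noteq> 0 \<and> f q = F (hcoords q) / G (hcoords q))"
    by blast
next
  assume "\<exists>d F G. homogeneous_poly d F \<and> homogeneous_poly d G \<and> G (hcoords p) \<noteq> 0 \<and>
     near X p (\<lambda>q. G (hcoords q) \<noteq> 0 \<and> f q = F (hcoords q) / G (hcoords q))"
  then obtain d F G e H where *: "homogeneous_poly d F" "homogeneous_poly d G" "G (hcoords p) \<noteq> 0"
     "homogeneous_poly e H" "H (hcoords p) \<noteq> 0"
     "\<forall>q\<in>X. H (hcoords q) \<noteq> 0 \<longrightarrow> G (hcoords q) \<noteq> 0 \<and> f q = F (hcoords q) / G (hcoords q)"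
    unfolding near_def by blast
  show "regular_at X p f" unfolding regular_at_def
    using * by (intro exI[of _ "d + e"] exI[of _ "\<lambda>x. F x * H x"] exI[of _ "\<lambda>x. G x * H x"]) auto
qed

section \<open>Algebra of regular functions\<close>

lemma regular_at_const [simp, intro]: "regular_at X p (\<lambda>_. c)"
  unfolding regular_at_def
  by (intro exI[of _ 0] exI[of _ "\<lambda>_. c"] exI[of _ "\<lambda>_. 1"]) auto

lemma regular_at_add [intro]:
  assumes "regular_at X p f" "regular_at X p g"
  shows "regular_at X p (\<lambda>q. f q + g q)"
proof -
  obtain d F G e F' G' where *: "homogeneous_poly d F" "homogeneous_poly d G" "G (hcoords p) \<noteq> 0"
     "near X p (\<lambda>q. G (hcoords q) \<noteq> 0 \<and> f q = F (hcoords q) / G (hcoords q))"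
     "homogeneous_poly e F'" "homogeneous_poly e G'" "G' (hcoords p) \<noteq> 0"
     "near X p (\<lambda>q. G' (hcoords q) \<noteq> 0 \<and> g q = F' (hcoords q) / G' (hcoords q))"
    using assms unfolding regular_at_near by blast
  have "near X p (\<lambda>q. G (hcoords q) * G' (hcoords q) \<noteq> 0 \<and>
      f q + g q = (F (hcoords q) * G' (hcoords q) + G (hcoords q) * F' (hcoords q)) / (G (hcoords q) * G' (hcoords q)))"
    by (rule near_mono[OF near_conj[OF *(4,8)]]) (auto simp: field_simps)
  moreover have "homogeneous_poly (d + e) (\<lambda>x. F x * G' x + G x * F' x)"
    "homogeneous_poly (d + e) (\<lambda>x. G x * G' x)" using * by auto
  ultimately show ?thesis unfolding regular_at_near using *(3,7)
    by (intro exI[of _ "d + e"] exI[of _ "\<lambda>x. F x * G' x + G x * F' x"] exI[of _ "\<lambda>x. G x * G' x"]) auto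
qed

lemma regular_at_mult [intro]:
  assumes "regular_at X p f" "regular_at X p g"
  shows "regular_at X p (\<lambda>q. f q * g q)"
proof -
  obtain d F G e F' G' where *: "homogeneous_poly d F" "homogeneous_poly d G" "G (hcoords p) \<noteq> 0"
     "near X p (\<lambda>q. G (hcoords q) \<noteq> 0 \<and> f q = F (hcoords q) / G (hcoords q))"
     "homogeneous_poly e F'" "homogeneous_poly e G'" "G' (hcoords p) \<noteq> 0"
     "near X p (\<lambda>q. G' (hcoords q) \<noteq> 0 \<and> g q = F' (hcoords q) / G' (hcoords q))"
    using assms unfolding regular_at_near by blast
  have "near X p (\<lambda>q. G (hcoords q) * G' (hcoords q) \<noteq> 0 \<and>
      f q * g q = (F (hcoords q) * F' (hcoords q)) / (G (hcoords q) * G' (hcoords q)))"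
    by (rule near_mono[OF near_conj[OF *(4,8)]]) (auto simp: field_simps)
  moreover have "homogeneous_poly (d + e) (\<lambda>x. F x * F' x)"
    "homogeneous_poly (d + e) (\<lambda>x. G x * G' x)" using * by auto
  ultimately show ?thesis unfolding regular_at_near using *(3,7)
    by (intro exI[of _ "d + e"] exI[of _ "\<lambda>x. F x * F' x"] exI[of _ "\<lambda>x. G x * G' x"]) auto
qed

lemma regular_at_nonzero_near:
  assumes "regular_at X p f" "f p \<noteq> 0" "p \<in> X"
  shows "near X p (\<lambda>q. f q \<noteq> 0)"
proof -
  obtain d F G where *: "homogeneous_poly d F" "homogeneous_poly d G" "G (hcoords p) \<noteq> 0"
     "near X p (\<lambda>q. G (hcoords q) \<noteq> 0 \<and> f q = F (hcoords q) / G (hcoords q))"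
    using assms unfolding regular_at_near by blast
  have "F (hcoords p) \<noteq> 0" using near_point[OF *(4) assms(3)] assms(2) by auto
  then have "near X p (\<lambda>q. F (hcoords q) \<noteq> 0)" using * by (intro nearI[of d F]) auto
  from near_conj[OF this *(4)] show ?thesis by (rule near_mono) auto
qed

lemma regular_at_inverse [intro]:
  assumes "regular_at X p f" "f p \<noteq> 0" "p \<in> X"
  shows "regular_at X p (\<lambda>q. inverse (f q))"
proof -
  obtain d F G where *: "homogeneous_poly d F" "homogeneous_poly d G" "G (hcoords p) \<noteq> 0"
     "near X p (\<lambda>q. G (hcoords q) \<noteq> 0 \<and> f q = F (hcoords q) / G (hcoords q))"
    using assms unfolding regular_at_near by blast
  have "F (hcoords p) \<noteq> 0" using near_point[OF *(4) assms(3)] assms(2) by auto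
  moreover have "near X p (\<lambda>q. F (hcoords q) \<noteq> 0 \<and> inverse (f q) = G (hcoords q) / F (hcoords q))"
    by (rule near_mono[OF near_conj[OF *(4) regular_at_nonzero_near[OF assms]]]) auto
  ultimately show ?thesis unfolding regular_at_near using * by blast
qed

lemma regular_at_near_regular:
  assumes "regular_at X p f" shows "near X p (\<lambda>q. regular_at X q f)"
  using assms unfolding regular_at_def near_def by blast

lemma regular_at_power [intro]: "regular_at X p f \<Longrightarrow> regular_at X p (\<lambda>q. f q ^ k)"
  by (induction k) auto

text \<open>Irreducibility enters here: a generic identity between regular functions holds on a
  neighbourhood.\<close>

lemma regular_eq_near:
  assumes X: "projective_variety X" "p \<in> X" and f: "regular_at X p f" and g: "regular_at X p g"
    and eq: "generically X (\<lambda>q. f q = g q)"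
  shows "near X p (\<lambda>q. f q = g q)"
proof -
  have r: "regular_at X p (\<lambda>q. f q + (-1) * g q)" by (intro regular_at_add regular_at_mult regular_at_const f g)
  obtain d F G where *: "homogeneous_poly d F" "homogeneous_poly d G" "G (hcoords p) \<noteq> 0"
     "near X p (\<lambda>q. G (hcoords q) \<noteq> 0 \<and> f q + (-1) * g q = F (hcoords q) / G (hcoords q))"
    using r unfolding regular_at_near by blast
  \<comment> \<open>The difference f - g is F/G near p. A nonzero value of F at one point of X would
    make F nonzero generically, hence also at a point where f = g and F/G = 0.\<close>
  have F0: "F (hcoords q) = 0" if "q \<in> X" for q
  proof (rule ccontr)
    assume "F (hcoords q) \<noteq> 0"
    then have "near X q (\<lambda>q. F (hcoords q) \<noteq> 0)" using * by (intro nearI[of d F]) auto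
    then have "generically X (\<lambda>q. F (hcoords q) \<noteq> 0)" using that unfolding generically_iff_near by blast
    moreover have "generically X (\<lambda>q. G (hcoords q) \<noteq> 0 \<and> f q + (-1) * g q = F (hcoords q) / G (hcoords q))"
      using *(4) X unfolding generically_iff_near by blast
    ultimately have gen: "generically X (\<lambda>q. ((G (hcoords q) \<noteq> 0 \<and> f q + (-1) * g q = F (hcoords q) / G (hcoords q)) \<and>
        F (hcoords q) \<noteq> 0) \<and> f q = g q)"
      by (intro generically_conj[OF X(1) generically_conj[OF X(1)] eq])
    from generically_ex[OF gen] show False by auto
  qed
  show ?thesis by (rule near_mono[OF *(4)]) (auto simp: F0)
qed

section \<open>Finiteness of proper closed subsets of a curve\<close>

lemma rational_funI: "regular_at X p f \<Longrightarrow> p \<in> X \<Longrightarrow> rational_fun X f"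
  unfolding rational_fun_def generically_iff_near using regular_at_near_regular by blast

lemma rational_generically_nonzero:
  assumes X: "projective_variety X" and f: "rational_fun X f" "\<not> rat_eq X f (\<lambda>_. 0)"
  shows "generically X (\<lambda>q. f q \<noteq> 0)"
proof -
  obtain p where p: "p \<in> X" "regular_at X p f"
    using generically_ex[OF f(1)[unfolded rational_fun_def]] by blast
  obtain d F G where *: "homogeneous_poly d F" "homogeneous_poly d G" "G (hcoords p) \<noteq> 0"
     "near X p (\<lambda>q. G (hcoords q) \<noteq> 0 \<and> f q = F (hcoords q) / G (hcoords q))"
    using p unfolding regular_at_near by blast
  have gen: "generically X (\<lambda>q. G (hcoords q) \<noteq> 0 \<and> f q = F (hcoords q) / G (hcoords q))"
    using *(4) p unfolding generically_iff_near by blast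
  have "\<exists>q\<in>X. F (hcoords q) \<noteq> 0"
  proof (rule ccontr)
    assume "\<not> ?thesis"
    then have "rat_eq X f (\<lambda>_. 0)" unfolding rat_eq_def
      by (intro generically_mono[OF gen]) auto
    then show False using f by blast
  qed
  then obtain q where q: "q \<in> X" "F (hcoords q) \<noteq> 0" by blast
  have "near X q (\<lambda>q. F (hcoords q) \<noteq> 0)" using nearI[of d F q X] * q by auto
  then have gen2: "generically X (\<lambda>q. F (hcoords q) \<noteq> 0)" using q generically_iff_near by blast
  show ?thesis by (rule generically_2[OF X gen gen2]) auto
qed

lemma rat_eq_sym: "rat_eq X f g \<Longrightarrow> rat_eq X g f"
  unfolding rat_eq_def by (simp add: eq_commute)

lemma rat_eq_trans: "projective_variety X \<Longrightarrow> rat_eq X f g \<Longrightarrow> rat_eq X g h \<Longrightarrow> rat_eq X f h"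
  unfolding rat_eq_def by (rule generically_2[of X "\<lambda>q. f q = g q" "\<lambda>q. g q = h q"]) simp_all

text \<open>A nonzero g in the maximal ideal is a positive power of the uniformizer times a unit. As
  an identity of regular functions this holds on a neighbourhood, where g and \<open>t'\<close>
  therefore have the same zeros.\<close>

lemma regular_expansion:
  assumes X: "projective_variety X" "p \<in> X"
    and t: "uniformizer X p t" "rat_eq X t t'" "regular_at X p t'" "t' p = 0"
    and g: "regular_at X p g" "g p = 0"
  shows "(near X p (\<lambda>q. t' q = 0 \<longrightarrow> g q = 0)) \<and>
         (\<not> rat_eq X g (\<lambda>_. 0) \<longrightarrow> near X p (\<lambda>q. g q = 0 \<longrightarrow> t' q = 0))"
proof (cases "rat_eq X g (\<lambda>_. 0)")
  case True
  then have "near X p (\<lambda>q. g q = 0)"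
    using regular_eq_near[OF X g(1) regular_at_const] unfolding rat_eq_def by blast
  then have "near X p (\<lambda>q. t' q = 0 \<longrightarrow> g q = 0)" by (rule near_mono) auto
  then show ?thesis using True by blast
next
  case False
  obtain k :: int and u where ku: "local_unit X p u" "rat_eq X g (\<lambda>q. t q powi k * u q)"
    using t(1) False rational_funI[OF g(1) X(2)] unfolding uniformizer_def by blast
  obtain u' where u': "regular_at X p u'" "u' p \<noteq> 0" "rat_eq X u u'"
    using ku unfolding local_unit_def by blast
  have tne: "\<not> rat_eq X t (\<lambda>_. 0)" using t(1) unfolding uniformizer_def by blast
  have t'ne: "\<not> rat_eq X t' (\<lambda>_. 0)" using tne rat_eq_trans[OF X(1) t(2)] by blast
  have gt': "generically X (\<lambda>q. t' q \<noteq> 0)"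
    by (rule rational_generically_nonzero[OF X(1) rational_funI[OF t(3) X(2)] t'ne])
  have eq0: "generically X (\<lambda>q. g q = t' q powi k * u' q)"
  proof -
    have "generically X (\<lambda>q. t q = t' q \<and> u q = u' q)"
      using t(2) u'(3) unfolding rat_eq_def by (rule generically_conj[OF X(1)])
    then show ?thesis by (rule generically_2[OF X(1) ku(2)[unfolded rat_eq_def]]) auto
  qed
  \<comment> \<open>For k \<le> 0 the identity reads g times a power of \<open>t'\<close> equals
    \<open>u'\<close>; at p the left side is 0 and the right side is not.\<close>
  have kpos: "k > 0"
  proof (rule ccontr)
    assume "\<not> k > 0"
    then have k: "k = - int (nat (- k))" by auto
    have "generically X (\<lambda>q. g q * t' q ^ nat (- k) = u' q)"
    proof (rule generically_2[OF X(1) gt' eq0])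
      fix q assume q: "t' q \<noteq> 0" "g q = t' q powi k * u' q"
      have "t' q powi k = inverse (t' q ^ nat (- k))"
        by (subst k, subst power_int_minus) (simp only: power_int_of_nat)
      then show "g q * t' q ^ nat (- k) = u' q" using q by simp
    qed
    then have "near X p (\<lambda>q. g q * t' q ^ nat (- k) = u' q)"
      by (intro regular_eq_near[OF X] regular_at_mult regular_at_power g t u')
    from near_point[OF this X(2)] show False using g(2) u'(2) by simp
  qed
  define n where "n = nat k"
  have n: "n > 0" "k = int n" using kpos by (auto simp: n_def)
  have "near X p (\<lambda>q. g q = t' q ^ n * u' q)"
    using eq0 n(2) by (intro regular_eq_near[OF X] regular_at_mult regular_at_power g t u') simp
  from near_conj[OF this regular_at_nonzero_near[OF u'(1,2) X(2)]]
  have nn: "near X p (\<lambda>q. g q = t' q ^ n * u' q \<and> u' q \<noteq> 0)" .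
  show ?thesis using n
    by (intro conjI impI; intro near_mono[OF nn]) auto
qed

text \<open>Near p the zeros of G are zeros of the uniformizer, and these are zeros of every regular
  function vanishing at p, in particular of the affine coordinates centred at p. Only p itself
  remains.\<close>

lemma proper_closed_isolated:
  fixes X :: "'n::finite proj_space set"
  assumes S: "smooth_projective_curve X" and p: "p \<in> X" and G: "homogeneous_poly d G"
    and r: "r \<in> X" "G (hcoords r) \<noteq> 0"
  shows "near X p (\<lambda>q. G (hcoords q) = 0 \<longrightarrow> q = p)"
proof (cases "G (hcoords p) = 0")
  case False
  then show ?thesis using G by (intro nearI[of d G]) auto
next
  case True
  have X: "projective_variety X" using S unfolding smooth_projective_curve_def by blast
  obtain t where t: "uniformizer X p t" using S p unfolding smooth_projective_curve_def by blast
  obtain t' where t': "rat_eq X t t'" "regular_at X p t'" "t' p = 0"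
    using t unfolding uniformizer_def local_max_ideal_def by blast
  obtain i0 where i0: "hcoords p $ i0 \<noteq> 0"
    using hcoords_nonzero[of p] by (auto simp: vec_eq_iff)
  have ni0: "near X p (\<lambda>q. hcoords q $ i0 \<noteq> 0)"
    using i0 by (intro nearI[of "Suc 0" "\<lambda>x. x $ i0"]) (use hp_coord in auto)
  define g where "g = (\<lambda>q. G (hcoords q) / (hcoords q $ i0) ^ d)"
  have "homogeneous_poly d (\<lambda>x :: complex ^ 'n. (x $ i0) ^ d)"
    using hp_power[OF hp_coord, of d i0] by simp
  then have g: "regular_at X p g" unfolding regular_at_def g_def
    using G i0 by (intro exI[of _ d] exI[of _ G] exI[of _ "\<lambda>x. (x $ i0) ^ d"]) auto
  have gp: "g p = 0" using True by (simp add: g_def)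
  have g0: "\<not> rat_eq X g (\<lambda>_. 0)"
  proof
    assume "rat_eq X g (\<lambda>_. 0)"
    then have 1: "generically X (\<lambda>q. g q = 0)" unfolding rat_eq_def .
    have 2: "generically X (\<lambda>q. hcoords q $ i0 \<noteq> 0)"
      using ni0 p generically_iff_near by blast
    have "near X r (\<lambda>q. G (hcoords q) \<noteq> 0)" using r G by (intro nearI[of d G]) auto
    then have 3: "generically X (\<lambda>q. G (hcoords q) \<noteq> 0)" using r generically_iff_near by blast
    have "generically X (\<lambda>q. False)"
      by (rule generically_2[OF X generically_conj[OF X 1 2] 3]) (auto simp: g_def)
    then show False using generically_ex by blast
  qed
  have n1: "near X p (\<lambda>q. g q = 0 \<longrightarrow> t' q = 0)"
    using regular_expansion[OF X p t t' g gp] g0 by blast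
  define l where "l = (\<lambda>i q. (hcoords q $ i * hcoords p $ i0 - hcoords q $ i0 * hcoords p $ i) / hcoords q $ i0)"
  have l: "regular_at X p (l i)" for i
  proof -
    have "homogeneous_poly (Suc 0) (\<lambda>x. hcoords p $ i0 * x $ i - hcoords p $ i * x $ i0)"
      "homogeneous_poly (Suc 0) (\<lambda>x :: complex ^ 'n. x $ i0)"
      by (intro hp_diff hp_cmult hp_coord)+
    then show ?thesis unfolding regular_at_def l_def using i0
      by (intro exI[of _ "Suc 0"] exI[of _ "\<lambda>x. hcoords p $ i0 * x $ i - hcoords p $ i * x $ i0"]
            exI[of _ "\<lambda>x. x $ i0"]) (auto simp: algebra_simps)
  qed
  have "near X p (\<lambda>q. t' q = 0 \<longrightarrow> l i q = 0)" for i
    using regular_expansion[OF X p t t' l[of i]] by (simp add: l_def)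
  then have n2: "near X p (\<lambda>q. \<forall>i\<in>UNIV. t' q = 0 \<longrightarrow> l i q = 0)"
    by (intro near_ball_finite) auto
  show ?thesis
  proof (rule near_mono[OF near_conj[OF near_conj[OF n1 n2] ni0]])
    fix q assume q: "((g q = 0 \<longrightarrow> t' q = 0) \<and> (\<forall>i\<in>UNIV. t' q = 0 \<longrightarrow> l i q = 0)) \<and> hcoords q $ i0 \<noteq> 0"
    show "G (hcoords q) = 0 \<longrightarrow> q = p"
    proof
      assume "G (hcoords q) = 0"
      then have "l i q = 0" for i using q by (simp add: g_def)
      then have "\<And>i. hcoords q $ i * hcoords p $ i0 = hcoords q $ i0 * hcoords p $ i"
        using q by (simp add: l_def)
      from proj_eqI[OF hcoords_nonzero i0 hcoords_nonzero this] show "q = p"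
        by (simp add: hpoint_hcoords)
    qed
  qed
qed

text \<open>Points of a proper closed subset are isolated, so it is finite because the unit sphere is
  compact in the Euclidean topology.\<close>

lemma proper_closed_finite:
  fixes X :: "'n::finite proj_space set"
  assumes S: "smooth_projective_curve X" and G: "homogeneous_poly d G"
    and r: "r \<in> X" "G (hcoords r) \<noteq> 0"
  shows "finite {q\<in>X. G (hcoords q) = 0}"
proof -
  have "zariski_closed X"
    using S unfolding smooth_projective_curve_def projective_variety_def by blast
  then obtain \<F> where \<F>: "\<forall>F\<in>\<F>. \<exists>d. homogeneous_poly d F" "X = {p. \<forall>F\<in>\<F>. F (hcoords p) = 0}"
    unfolding zariski_closed_def by blast
  define \<G> where "\<G> = insert G \<F>"
  have \<G>: "\<forall>F\<in>\<G>. \<exists>d. homogeneous_poly d F" using \<F> G by (auto simp: \<G>_def)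
  \<comment> \<open>The preimage of the zero set in the unit sphere. Each open set
    \<open>H p x \<noteq> 0\<close> meets it only in representatives of p, so a finite subcover
    bounds the number of points.\<close>
  define K where "K = sphere 0 1 \<inter> (\<Inter>F\<in>\<G>. {x. F x = 0})"
  have "closed {x. F x = 0}" if FG: "F \<in> \<G>" for F
  proof -
    obtain e where e: "homogeneous_poly e F" using \<G> FG by blast
    show ?thesis by (rule closed_Collect_eq[OF hp_continuous[OF e] continuous_on_const])
  qed
  then have K: "compact K" unfolding K_def by (intro compact_Int_closed compact_sphere closed_INT) auto
  have mem: "q \<in> X \<and> G (hcoords q) = 0 \<longleftrightarrow> (\<forall>F\<in>\<G>. F (hcoords q) = 0)" for q
    unfolding \<F>(2) \<G>_def by auto
  have "\<exists>H. (\<exists>e. homogeneous_poly e H) \<and> H (hcoords p) \<noteq> 0 \<and>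
      (\<forall>q\<in>X. H (hcoords q) \<noteq> 0 \<longrightarrow> G (hcoords q) = 0 \<longrightarrow> q = p)" if "p \<in> X" for p
    using proper_closed_isolated[OF S that G r] unfolding near_def by blast
  then obtain H where H: "\<And>p. p \<in> X \<Longrightarrow> \<exists>e. homogeneous_poly e (H p)"
     "\<And>p. p \<in> X \<Longrightarrow> H p (hcoords p) \<noteq> 0"
     "\<And>p q. p \<in> X \<Longrightarrow> q \<in> X \<Longrightarrow> H p (hcoords q) \<noteq> 0 \<Longrightarrow> G (hcoords q) = 0 \<Longrightarrow> q = p"
    by metis
  define Z where "Z = {q\<in>X. G (hcoords q) = 0}"
  have Zhp: "hpoint x \<in> Z" if "x \<in> K" for x
  proof -
    have x: "x \<noteq> 0" using that by (auto simp: K_def)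
    have "F (hcoords (hpoint x)) = 0" if FG: "F \<in> \<G>" for F
    proof -
      obtain e where "homogeneous_poly e F" using \<G> FG by blast
      moreover have "F x = 0" using \<open>x \<in> K\<close> FG unfolding K_def by simp
      ultimately show ?thesis using hp_hpoint[OF _ x] by simp
    qed
    then show ?thesis using mem unfolding Z_def by blast
  qed
  have cov: "K \<subseteq> \<Union> ((\<lambda>p. {x. H p x \<noteq> 0}) ` Z)"
  proof
    fix x assume x: "x \<in> K"
    have x0: "x \<noteq> 0" using x by (auto simp: K_def)
    have hx: "hpoint x \<in> X" using Zhp[OF x] by (simp add: Z_def)
    obtain e where "homogeneous_poly e (H (hpoint x))" using H(1)[OF hx] by blast
    then have "H (hpoint x) x \<noteq> 0" using H(2)[OF hx] hp_hpoint[OF _ x0] by simp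
    then show "x \<in> \<Union> ((\<lambda>p. {x. H p x \<noteq> 0}) ` Z)" using Zhp[OF x] by blast
  qed
  have op: "open {x. H p x \<noteq> 0}" if "p \<in> Z" for p
  proof -
    have "p \<in> X" using that by (simp add: Z_def)
    from H(1)[OF this] obtain e where e: "homogeneous_poly e (H p)" by blast
    show ?thesis by (rule open_Collect_neq[OF hp_continuous[OF e] continuous_on_const])
  qed
  obtain Z' where Z': "Z' \<subseteq> Z" "finite Z'" "K \<subseteq> \<Union> ((\<lambda>p. {x. H p x \<noteq> 0}) ` Z')"
    by (rule compactE_image[OF K op cov])
  have "Z \<subseteq> Z'"
  proof
    fix q assume q: "q \<in> Z"
    define x where "x = complex_of_real (inverse (norm (hcoords q))) *s hcoords q"
    have n0: "norm (hcoords q) \<noteq> 0" using hcoords_nonzero by simp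
    have "x $ i = (inverse (norm (hcoords q)) *\<^sub>R hcoords q) $ i" for i
      unfolding x_def vector_smult_component vector_scaleR_component by (rule scaleR_conv_of_real[symmetric])
    then have "x = inverse (norm (hcoords q)) *\<^sub>R hcoords q" unfolding vec_eq_iff by blast
    then have "norm x = 1" using n0 by simp
    moreover have "F x = 0" if FG: "F \<in> \<G>" for F
    proof -
      obtain e where e: "homogeneous_poly e F" using \<G> FG by blast
      have "F (hcoords q) = 0" using mem q FG unfolding Z_def by blast
      then show ?thesis unfolding x_def using homogeneous_poly_scale[OF e] by simp
    qed
    ultimately have "x \<in> K" by (auto simp: K_def)
    then obtain p where p: "p \<in> Z'" "H p x \<noteq> 0" using Z' by blast
    have pX: "p \<in> X" using p Z' by (auto simp: Z_def)
    obtain e where "homogeneous_poly e (H p)" using H(1)[OF pX] by blast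
    then have "H p (hcoords q) \<noteq> 0" using p(2) homogeneous_poly_scale[of e "H p"] by (auto simp: x_def)
    then have "q = p" using H(3)[OF pX] q by (auto simp: Z_def)
    then show "q \<in> Z'" using p by simp
  qed
  then show ?thesis using Z'(2) finite_subset unfolding Z_def by blast
qed

section \<open>Finite sets are closed, and generic means cofinite\<close>

lemma zariski_closed_singleton: "zariski_closed {p :: 'n::finite proj_space}"
  unfolding zariski_closed_def
proof (intro exI conjI)
  let ?S = "{F. homogeneous_poly (Suc 0) F \<and> F (hcoords p) = 0}"
  show "\<forall>F\<in>?S. \<exists>d. homogeneous_poly d F" by blast
  have "q = p" if "\<forall>F\<in>?S. F (hcoords q) = 0" for q
  proof (rule ccontr)
    assume "q \<noteq> p"
    then obtain F where "homogeneous_poly (Suc 0) F" "F (hcoords p) = 0" "F (hcoords q) \<noteq> 0"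
      using linear_form_sep[of p q] by metis
    then show False using that by blast
  qed
  then show "{p} = {q. \<forall>F\<in>?S. F (hcoords q) = 0}" by blast
qed

lemma zariski_closed_Un:
  assumes "zariski_closed A" "zariski_closed B"
  shows "zariski_closed (A \<union> B)"
proof -
  obtain S T where S: "\<forall>F\<in>S. \<exists>d. homogeneous_poly d F" "A = {p. \<forall>F\<in>S. F (hcoords p) = 0}"
    and T: "\<forall>F\<in>T. \<exists>d. homogeneous_poly d F" "B = {p. \<forall>F\<in>T. F (hcoords p) = 0}"
    using assms unfolding zariski_closed_def by blast
  show ?thesis unfolding zariski_closed_def
  proof (intro exI[of _ "(\<lambda>(F, G) x. F x * G x) ` (S \<times> T)"] conjI)
    show "\<forall>H\<in>(\<lambda>(F, G) x. F x * G x) ` (S \<times> T). \<exists>d. homogeneous_poly d H"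
      using S(1) T(1) hp_mult by fast
    show "A \<union> B = {p. \<forall>H\<in>(\<lambda>(F, G) x. F x * G x) ` (S \<times> T). H (hcoords p) = 0}"
      unfolding S(2) T(2) by auto
  qed
qed

lemma zariski_closed_finite: "finite A \<Longrightarrow> A \<noteq> {} \<Longrightarrow> zariski_closed (A :: 'n::finite proj_space set)"
proof (induction A rule: finite_ne_induct)
  case (insert p A)
  then show ?case using zariski_closed_Un[OF zariski_closed_singleton[of p]] by fastforce
qed (rule zariski_closed_singleton)

lemma variety_finite_singleton:
  assumes "projective_variety X" "finite A" "A \<noteq> {}" "X \<subseteq> A"
  shows "\<exists>p. X = {p}"
  using assms(2-)
proof (induction A rule: finite_ne_induct)
  case (singleton p)
  then show ?case using assms(1) unfolding projective_variety_def by blast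
next
  case (insert p A)
  have "X \<subseteq> {p} \<or> X \<subseteq> A"
    using assms(1) zariski_closed_singleton[of p] zariski_closed_finite[OF insert(1,2)] insert(5)
    unfolding projective_variety_def by (metis insert_is_Un)
  then show ?case using insert.IH assms(1) unfolding projective_variety_def by blast
qed

text \<open>By irreducibility a finite variety is a single point p. There a uniformizer, having
  value 0 at p, would be zero in the function field.\<close>

lemma smooth_curve_infinite:
  assumes S: "smooth_projective_curve X" shows "infinite X"
proof
  assume "finite X"
  have X: "projective_variety X" "X \<noteq> {}"
    using S unfolding smooth_projective_curve_def projective_variety_def by blast+
  obtain p where p: "X = {p}" using variety_finite_singleton[OF X(1) \<open>finite X\<close> X(2)] by blast
  obtain t where t: "uniformizer X p t" using S p unfolding smooth_projective_curve_def by blast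
  obtain t' where t': "rat_eq X t t'" "t' p = 0" "\<not> rat_eq X t (\<lambda>_. 0)"
    using t unfolding uniformizer_def local_max_ideal_def by blast
  have "rat_eq X t (\<lambda>_. 0)" using t'(1) unfolding rat_eq_def
    by (rule generically_mono) (use p t'(2) in auto)
  then show False using t' by blast
qed

text \<open>This replaces quantification over closed sets by a filter: proper closed subsets are
  finite, and conversely a finite set is closed and cannot contain the infinite set
  \<open>X\<close>.\<close>

theorem generically_iff_cofinite:
  assumes S: "smooth_projective_curve X"
  shows "generically X P \<longleftrightarrow> finite {q\<in>X. \<not> P q}"
proof
  assume "generically X P"
  then obtain p d H where H: "p \<in> X" "homogeneous_poly d H" "H (hcoords p) \<noteq> 0"
     "\<forall>q\<in>X. H (hcoords q) \<noteq> 0 \<longrightarrow> P q" unfolding generically_iff_near near_def by blast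
  have "{q\<in>X. \<not> P q} \<subseteq> {q\<in>X. H (hcoords q) = 0}" using H by blast
  then show "finite {q\<in>X. \<not> P q}" using proper_closed_finite[OF S H(2,1,3)] finite_subset by blast
next
  assume fin: "finite {q\<in>X. \<not> P q}"
  show "generically X P"
  proof (cases "{q\<in>X. \<not> P q} = {}")
    case True
    obtain p where "p \<in> X" using S unfolding smooth_projective_curve_def projective_variety_def by blast
    then show ?thesis using True near_always[of X P p] unfolding generically_iff_near by blast
  next
    case False
    have "\<not> X \<subseteq> {q\<in>X. \<not> P q}" using fin smooth_curve_infinite[OF S] finite_subset by blast
    then show ?thesis unfolding generically_def using zariski_closed_finite[OF fin False] by blast
  qed
qed

section \<open>The function field and its valuations\<close>

lemma near_cofinite:
  assumes "finite B" "p \<notin> B" shows "near X p (\<lambda>q. q \<notin> B)"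
proof -
  have "near X p (\<lambda>q. q \<noteq> b)" if "b \<in> B" for b
  proof -
    have "b \<noteq> p" using that assms(2) by blast
    obtain F where "homogeneous_poly (Suc 0) F" "F (hcoords b) = 0" "F (hcoords p) \<noteq> 0"
      by (rule linear_form_sep[OF \<open>b \<noteq> p\<close>])
    then show ?thesis by (intro nearI[of "Suc 0" F]) auto
  qed
  then have "near X p (\<lambda>q. \<forall>b\<in>B. q \<noteq> b)" using assms(1) by (intro near_ball_finite)
  then show ?thesis by (rule near_mono) auto
qed

section \<open>The function field modulo equality at almost all points\<close>

locale smooth_curve =
  fixes X :: "'n::finite proj_space set"
  assumes smooth: "smooth_projective_curve X"
begin

lemma variety: "projective_variety X"
  using smooth unfolding smooth_projective_curve_def by blast

lemma infinite_X: "infinite X"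
  by (rule smooth_curve_infinite[OF smooth])

text \<open>The filter of cofinite subsets of \<open>X\<close>: an identity in the function field is
  an eventual identity, so that \<open>eventually_elim\<close> carries out field arithmetic
  pointwise.\<close>

definition ae :: "'n proj_space filter" where
  "ae = inf cofinite (principal X)"

lemma eventually_ae: "eventually P ae \<longleftrightarrow> finite {q\<in>X. \<not> P q}"
proof -
  have "{x. \<not> (x \<in> X \<longrightarrow> P x)} = {q\<in>X. \<not> P q}" by blast
  then show ?thesis by (simp add: ae_def eventually_inf_principal eventually_cofinite)
qed

lemma ae_not_bot [simp]: "ae \<noteq> bot"
  using infinite_X eventually_ae[of "\<lambda>_. False"] by (auto simp: trivial_limit_def)

lemma generically_ae: "generically X P \<longleftrightarrow> eventually P ae"
  by (simp add: eventually_ae generically_iff_cofinite[OF smooth])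

lemma rat_eq_ae: "rat_eq X f g \<longleftrightarrow> (\<forall>\<^sub>F q in ae. f q = g q)"
  by (simp add: rat_eq_def generically_ae)

lemma eventually_ae_X: "\<forall>\<^sub>F q in ae. q \<in> X"
  by (simp add: eventually_ae)

lemma eventually_ae_finite: "finite B \<Longrightarrow> \<forall>\<^sub>F q in ae. q \<notin> B"
  by (simp add: eventually_ae)

abbreviation eqv (infix "\<doteq>" 50) where "f \<doteq> g \<equiv> rat_eq X f g"

lemma eqv_refl [simp]: "f \<doteq> f" by (simp add: rat_eq_ae)

lemma eqv_sym: "f \<doteq> g \<Longrightarrow> g \<doteq> f" by (rule rat_eq_sym)

lemma eqv_trans: "f \<doteq> g \<Longrightarrow> g \<doteq> h \<Longrightarrow> f \<doteq> h" by (rule rat_eq_trans[OF variety])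

lemma eqv_mult:
  assumes "f \<doteq> f'" "g \<doteq> g'" shows "(\<lambda>q. f q * g q) \<doteq> (\<lambda>q. f' q * g' q)"
  using assms unfolding rat_eq_ae by eventually_elim auto

lemma eqv_add:
  assumes "f \<doteq> f'" "g \<doteq> g'" shows "(\<lambda>q. f q + g q) \<doteq> (\<lambda>q. f' q + g' q)"
  using assms unfolding rat_eq_ae by eventually_elim auto

abbreviation rational :: "('n proj_space \<Rightarrow> complex) \<Rightarrow> bool" where
  "rational \<equiv> rational_fun X"

lemma rational_ae: "rational f \<longleftrightarrow> (\<forall>\<^sub>F q in ae. regular_at X q f)"
  by (simp add: rational_fun_def generically_ae)

lemma rational_const [simp, intro]: "rational (\<lambda>_. c)"
  by (simp add: rational_ae)

lemma rational_add [intro]: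
  assumes "rational f" "rational g" shows "rational (\<lambda>q. f q + g q)"
  using assms unfolding rational_ae by eventually_elim auto

lemma rational_mult [intro]:
  assumes "rational f" "rational g" shows "rational (\<lambda>q. f q * g q)"
  using assms unfolding rational_ae by eventually_elim auto

lemma rational_minus [intro]: "rational f \<Longrightarrow> rational (\<lambda>q. - f q)"
  using rational_mult[of "\<lambda>_. -1" f] by simp

lemma rational_diff [intro]: "rational f \<Longrightarrow> rational g \<Longrightarrow> rational (\<lambda>q. f q - g q)"
  using rational_add[of f "\<lambda>q. - g q"] rational_minus by simp

lemma rational_power [intro]: "rational f \<Longrightarrow> rational (\<lambda>q. f q ^ k)"
  by (induction k) auto

lemma regular_at_cong_near:
  assumes "regular_at X p f" "near X p (\<lambda>q. f q = g q)"
  shows "regular_at X p g"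
proof -
  obtain d F G where *: "homogeneous_poly d F" "homogeneous_poly d G" "G (hcoords p) \<noteq> 0"
     "near X p (\<lambda>q. G (hcoords q) \<noteq> 0 \<and> f q = F (hcoords q) / G (hcoords q))"
    using assms(1) unfolding regular_at_near by blast
  have "near X p (\<lambda>q. G (hcoords q) \<noteq> 0 \<and> g q = F (hcoords q) / G (hcoords q))"
    by (rule near_mono[OF near_conj[OF *(4) assms(2)]]) auto
  then show ?thesis using * unfolding regular_at_near by blast
qed

lemma rational_cong:
  assumes "rational f" "f \<doteq> g" shows "rational g"
proof -
  let ?B = "{q\<in>X. f q \<noteq> g q}"
  have fin: "finite ?B" using assms(2) by (simp add: rat_eq_ae eventually_ae)
  show ?thesis using assms(1) eventually_ae_finite[OF fin] unfolding rational_ae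
  proof eventually_elim
    case (elim q)
    have "near X q (\<lambda>r. f r = g r)"
      by (rule near_mono[OF near_cofinite[OF fin elim(2)]]) auto
    then show ?case using regular_at_cong_near elim(1) by blast
  qed
qed

lemma rational_nonzero_ae: "rational f \<Longrightarrow> \<not> f \<doteq> (\<lambda>_. 0) \<Longrightarrow> \<forall>\<^sub>F q in ae. f q \<noteq> 0"
  using rational_generically_nonzero[OF variety] by (simp add: generically_ae)

lemma rational_inverse [intro]:
  assumes "rational f" shows "rational (\<lambda>q. inverse (f q))"
proof (cases "f \<doteq> (\<lambda>_. 0)")
  case True
  then have "(\<lambda>_. 0) \<doteq> (\<lambda>q. inverse (f q))"
    unfolding rat_eq_ae by eventually_elim auto
  then show ?thesis using rational_cong rational_const by blast
next
  case False
  show ?thesis using rational_nonzero_ae[OF assms False] assms eventually_ae_X unfolding rational_ae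
    by eventually_elim auto
qed

lemma rational_divide [intro]: "rational f \<Longrightarrow> rational g \<Longrightarrow> rational (\<lambda>q. f q / g q)"
  using rational_mult[of f "\<lambda>q. inverse (g q)"] rational_inverse[of g] by (simp add: divide_inverse)

lemma rational_powi [intro]: "rational f \<Longrightarrow> rational (\<lambda>q. f q powi k)"
  by (cases "k \<ge> 0") (auto simp: power_int_def)

text \<open>Representatives of the nonzero elements of the function field; such a function may still
  be 0 at finitely many points.\<close>

definition nz :: "('n proj_space \<Rightarrow> complex) \<Rightarrow> bool" where
  "nz f \<longleftrightarrow> rational f \<and> \<not> f \<doteq> (\<lambda>_. 0)"

lemma nz_ae: "nz f \<longleftrightarrow> rational f \<and> (\<forall>\<^sub>F q in ae. f q \<noteq> 0)"
proof -
  have False if "f \<doteq> (\<lambda>_. 0)" "\<forall>\<^sub>F q in ae. f q \<noteq> 0"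
  proof -
    have "\<forall>\<^sub>F q in ae. False" using that unfolding rat_eq_ae by eventually_elim auto
    then show False by simp
  qed
  then show ?thesis using rational_nonzero_ae unfolding nz_def by blast
qed

lemma nz_nonzero: "nz f \<Longrightarrow> \<forall>\<^sub>F q in ae. f q \<noteq> 0" by (simp add: nz_ae)

lemma nz_rational [intro]: "nz f \<Longrightarrow> rational f" by (simp add: nz_def)

lemma nz_const [simp]: "nz (\<lambda>_. c) \<longleftrightarrow> c \<noteq> 0"
  by (simp add: nz_ae)

lemma nz_mult [intro]: "nz f \<Longrightarrow> nz g \<Longrightarrow> nz (\<lambda>q. f q * g q)"
proof -
  assume fg: "nz f" "nz g"
  have "\<forall>\<^sub>F q in ae. f q * g q \<noteq> 0" using nz_nonzero[OF fg(1)] nz_nonzero[OF fg(2)] by eventually_elim simp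
  then show ?thesis using fg rational_mult unfolding nz_ae by blast
qed

lemma nz_inverse [intro]: "nz f \<Longrightarrow> nz (\<lambda>q. inverse (f q))"
  unfolding nz_ae using rational_inverse by simp

lemma nz_powi [intro]: "nz f \<Longrightarrow> nz (\<lambda>q. f q powi k)"
proof -
  assume f: "nz f"
  have "\<forall>\<^sub>F q in ae. f q powi k \<noteq> 0" using nz_nonzero[OF f] by eventually_elim simp
  then show ?thesis using f rational_powi unfolding nz_ae by blast
qed

lemma nz_power [intro]: "nz f \<Longrightarrow> nz (\<lambda>q. f q ^ k)"
  using nz_powi[of f "int k"] by simp

lemma nz_cong: "nz f \<Longrightarrow> f \<doteq> g \<Longrightarrow> nz g"
  using rational_cong eqv_trans unfolding nz_def by blast

lemma nz_cases: "rational f \<Longrightarrow> f \<doteq> (\<lambda>_. 0) \<or> nz f" unfolding nz_def by blast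

text \<open>The value at p of the class of f in the residue field. It may differ from
  \<open>f p\<close>, since f is determined only up to finitely many points.\<close>

definition hasval :: "'n proj_space \<Rightarrow> ('n proj_space \<Rightarrow> complex) \<Rightarrow> complex \<Rightarrow> bool" where
  "hasval p f c \<longleftrightarrow> (\<exists>g. regular_at X p g \<and> g p = c \<and> f \<doteq> g)"

lemma local_unit_hasval: "local_unit X p f \<longleftrightarrow> (\<exists>c. c \<noteq> 0 \<and> hasval p f c)"
  unfolding local_unit_def hasval_def by blast

lemma local_max_ideal_hasval: "local_max_ideal X p f \<longleftrightarrow> hasval p f 0"
  unfolding local_max_ideal_def hasval_def by blast

lemma hasval_const [simp, intro]: "hasval p (\<lambda>_. c) c"
  unfolding hasval_def using eqv_refl regular_at_const by blast

lemma hasval_cong: "hasval p f c \<Longrightarrow> f \<doteq> g \<Longrightarrow> hasval p g c"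
  unfolding hasval_def using eqv_sym eqv_trans by blast

lemma hasval_add: "hasval p f c \<Longrightarrow> hasval p g d \<Longrightarrow> hasval p (\<lambda>q. f q + g q) (c + d)"
  unfolding hasval_def using eqv_add regular_at_add by fast

lemma hasval_mult: "hasval p f c \<Longrightarrow> hasval p g d \<Longrightarrow> hasval p (\<lambda>q. f q * g q) (c * d)"
  unfolding hasval_def using eqv_mult regular_at_mult by fast

lemma hasval_minus: "hasval p f c \<Longrightarrow> hasval p (\<lambda>q. - f q) (- c)"
  using hasval_mult[of p "\<lambda>_. -1" "-1" f c] by simp

lemma hasval_diff: "hasval p f c \<Longrightarrow> hasval p g d \<Longrightarrow> hasval p (\<lambda>q. f q - g q) (c - d)"
  using hasval_add[of p f c "\<lambda>q. - g q" "- d"] hasval_minus by simp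

lemma hasval_power: "hasval p f c \<Longrightarrow> hasval p (\<lambda>q. f q ^ k) (c ^ k)"
proof (induction k)
  case (Suc k)
  then show ?case using hasval_mult[of p f c] by simp
qed auto

lemma hasval_inverse:
  assumes "hasval p f c" "c \<noteq> 0" "p \<in> X"
  shows "hasval p (\<lambda>q. inverse (f q)) (inverse c)"
proof -
  obtain g where g: "regular_at X p g" "g p = c" "f \<doteq> g" using assms unfolding hasval_def by blast
  have "(\<lambda>q. inverse (f q)) \<doteq> (\<lambda>q. inverse (g q))"
    using g(3) unfolding rat_eq_ae by eventually_elim auto
  then show ?thesis using g assms unfolding hasval_def by blast
qed

lemma hasval_unique: "hasval p f c \<Longrightarrow> hasval p f d \<Longrightarrow> p \<in> X \<Longrightarrow> c = d"
proof -
  assume *: "hasval p f c" "hasval p f d" "p \<in> X"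
  then obtain g h where "regular_at X p g" "g p = c" "f \<doteq> g"
     "regular_at X p h" "h p = d" "f \<doteq> h" unfolding hasval_def by blast
  moreover from this have "g \<doteq> h" using eqv_sym eqv_trans by blast
  ultimately show "c = d"
    using regular_eq_near[OF variety *(3)] near_point[OF _ *(3)] unfolding rat_eq_def by blast
qed

lemma hasval_rational: "hasval p f c \<Longrightarrow> p \<in> X \<Longrightarrow> rational f"
  unfolding hasval_def using rational_funI rational_cong eqv_sym by blast

lemma rational_hasval: "rational f \<Longrightarrow> \<forall>\<^sub>F p in ae. hasval p f (f p)"
  unfolding rational_ae by (erule eventually_mono) (use eqv_refl in \<open>unfold hasval_def, blast\<close>)

lemma hasval_nonzero_nz: "hasval p f c \<Longrightarrow> c \<noteq> 0 \<Longrightarrow> p \<in> X \<Longrightarrow> nz f"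
  unfolding nz_def using hasval_rational hasval_unique hasval_cong hasval_const by metis

text \<open>The order is first a relation with respect to a fixed uniformizer; independence of the
  uniformizer is shown before \<open>ord_at\<close> is used.\<close>

definition expansion :: "'n proj_space \<Rightarrow> ('n proj_space \<Rightarrow> complex) \<Rightarrow> ('n proj_space \<Rightarrow> complex) \<Rightarrow> int \<Rightarrow> bool" where
  "expansion p t f k \<longleftrightarrow> (\<exists>u. local_unit X p u \<and> f \<doteq> (\<lambda>q. t q powi k * u q))"

lemma uniformizer_nz: "uniformizer X p t \<Longrightarrow> p \<in> X \<Longrightarrow> nz t"
  unfolding uniformizer_def nz_def local_max_ideal_hasval using hasval_rational by blast

lemma uniformizer_hasval: "uniformizer X p t \<Longrightarrow> hasval p t 0"
  unfolding uniformizer_def local_max_ideal_hasval by blast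

lemma expansion_exists: "uniformizer X p t \<Longrightarrow> nz f \<Longrightarrow> \<exists>k. expansion p t f k"
  unfolding uniformizer_def expansion_def nz_def by blast

lemma expansion_cong: "expansion p t f k \<Longrightarrow> f \<doteq> g \<Longrightarrow> expansion p t g k"
  unfolding expansion_def using eqv_sym eqv_trans by blast

lemma expansion_mult:
  assumes "nz t" "expansion p t f k" "expansion p t g l"
  shows "expansion p t (\<lambda>q. f q * g q) (k + l)"
proof -
  obtain u v where uv: "local_unit X p u" "f \<doteq> (\<lambda>q. t q powi k * u q)"
     "local_unit X p v" "g \<doteq> (\<lambda>q. t q powi l * v q)"
    using assms unfolding expansion_def by blast
  have "(\<lambda>q. f q * g q) \<doteq> (\<lambda>q. t q powi (k + l) * (u q * v q))"
    using uv(2,4) nz_nonzero[OF assms(1)] unfolding rat_eq_ae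
    by eventually_elim (simp add: power_int_add)
  moreover have "local_unit X p (\<lambda>q. u q * v q)"
    using uv(1,3) hasval_mult unfolding local_unit_hasval by (metis no_zero_divisors)
  ultimately show ?thesis unfolding expansion_def by blast
qed

lemma expansion_hasval:
  assumes p: "p \<in> X" and t: "nz t" "hasval p t 0" and f: "expansion p t f k"
  shows "k \<ge> 0 \<longleftrightarrow> (\<exists>c. hasval p f c)" "k > 0 \<longleftrightarrow> hasval p f 0"
proof -
  obtain u d where u: "hasval p u d" "d \<noteq> 0" "f \<doteq> (\<lambda>q. t q powi k * u q)"
    using f unfolding expansion_def local_unit_hasval by blast
  have pos: "hasval p f (0 ^ nat k * d)" if "k \<ge> 0"
  proof -
    have "hasval p (\<lambda>q. t q ^ nat k * u q) (0 ^ nat k * d)"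
      by (intro hasval_mult hasval_power t u)
    moreover have "(\<lambda>q. t q powi k) = (\<lambda>q. t q ^ nat k)" using that by (simp add: power_int_def)
    ultimately show ?thesis using u(3) hasval_cong eqv_sym by metis
  qed
  \<comment> \<open>For k < 0 the unit u equals f times a positive power of t, which has value 0 at
    p.\<close>
  have neg: False if "k < 0" "hasval p f c" for c
  proof -
    have "hasval p (\<lambda>q. f q * t q ^ nat (- k)) (c * 0 ^ nat (- k))"
      by (intro hasval_mult hasval_power t that)
    moreover have "(\<lambda>q. f q * t q ^ nat (- k)) \<doteq> u"
      using u(3) nz_nonzero[OF t(1)] unfolding rat_eq_ae
      by eventually_elim (use that(1) in \<open>simp add: power_int_def power_inverse\<close>)
    ultimately have "hasval p u (c * 0 ^ nat (- k))" using hasval_cong by blast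
    then have "d = c * 0 ^ nat (- k)" using hasval_unique[OF _ _ p] u(1) by blast
    then show False using u(2) that(1) by simp
  qed
  show "k \<ge> 0 \<longleftrightarrow> (\<exists>c. hasval p f c)" using pos neg by (meson not_le)
  show "k > 0 \<longleftrightarrow> hasval p f 0"
  proof
    assume k: "k > 0"
    then have "(0::complex) ^ nat k * d = 0" by (simp add: zero_power)
    moreover have "hasval p f (0 ^ nat k * d)" using pos k by simp
    ultimately show "hasval p f 0" by metis
  next
    assume h: "hasval p f 0"
    then have "k \<ge> 0" using neg by (meson not_le)
    moreover have "k \<noteq> 0" using pos h hasval_unique[OF _ _ p] u(2) by fastforce
    ultimately show "k > 0" by simp
  qed
qed

lemma expansion_self: "nz t \<Longrightarrow> expansion p t (\<lambda>q. t q powi k) k"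
  unfolding expansion_def local_unit_hasval
  by (intro exI[of _ "\<lambda>_. 1"] conjI exI[of _ 1]) auto

lemma expansion_unique:
  assumes p: "p \<in> X" and t: "nz t" "hasval p t 0" and f: "expansion p t f k" "expansion p t f l"
  shows "k = l"
proof -
  have le: "k \<le> l" if kl: "expansion p t f k" "expansion p t f l" for k l
  proof -
    obtain u d where u: "hasval p u d" "d \<noteq> 0" "f \<doteq> (\<lambda>q. t q powi k * u q)"
      using kl unfolding expansion_def local_unit_hasval by blast
    have "expansion p t (\<lambda>q. f q * t q powi (- k)) (l + - k)"
      by (intro expansion_mult t kl expansion_self)
    moreover have "(\<lambda>q. f q * t q powi (- k)) \<doteq> u"
      using u(3) nz_nonzero[OF t(1)] unfolding rat_eq_ae
      by eventually_elim (simp add: power_int_minus)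
    ultimately have "expansion p t u (l + - k)" using expansion_cong by blast
    from expansion_hasval(1)[OF p t this] u(1) show ?thesis by auto
  qed
  show ?thesis using le[OF f] le[OF f(2,1)] by simp
qed

text \<open>Two uniformizers are expanded in each other with positive exponents i and j.
  Substituting one expansion into the other gives i j = 1, so i = 1 and the exponent k of f is
  preserved.\<close>

lemma expansion_change:
  assumes p: "p \<in> X" and t: "uniformizer X p t" and s: "uniformizer X p s" and f: "expansion p s f k"
  shows "expansion p t f k"
proof -
  note tn = uniformizer_nz[OF t p] and sn = uniformizer_nz[OF s p]
  note tv = uniformizer_hasval[OF t] and sv = uniformizer_hasval[OF s]
  have powi: "expansion p a (\<lambda>q. g q powi k) (j * k)"
    if aj: "expansion p a g j" "nz a" for a g j k
  proof -
    obtain u d where u: "hasval p u d" "d \<noteq> 0" "g \<doteq> (\<lambda>q. a q powi j * u q)"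
      using aj unfolding expansion_def local_unit_hasval by blast
    have "\<exists>e. e \<noteq> 0 \<and> hasval p (\<lambda>q. u q powi k) e"
    proof (cases "k \<ge> 0")
      case True
      then show ?thesis using hasval_power[OF u(1), of "nat k"] u(2)
        by (intro exI[of _ "d ^ nat k"]) (auto simp: power_int_def)
    next
      case False
      then show ?thesis using hasval_power[OF hasval_inverse[OF u(1,2) p], of "nat (- k)"] u(2)
        by (intro exI[of _ "inverse d ^ nat (- k)"]) (auto simp: power_int_def)
    qed
    moreover have "(\<lambda>q. g q powi k) \<doteq> (\<lambda>q. a q powi (j * k) * u q powi k)"
      using u(3) unfolding rat_eq_ae
      by eventually_elim (simp add: power_int_mult_distrib power_int_mult)
    ultimately show ?thesis unfolding expansion_def local_unit_hasval by blast
  qed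
  obtain i j where ij: "expansion p t s i" "expansion p s t j"
    using expansion_exists[OF t sn] expansion_exists[OF s tn] by blast
  have pos: "i > 0" "j > 0"
    using expansion_hasval(2)[OF p tn tv ij(1)] expansion_hasval(2)[OF p sn sv ij(2)] sv tv by auto
  obtain u where u: "local_unit X p u" "t \<doteq> (\<lambda>q. s q powi j * u q)"
    using ij(2) unfolding expansion_def by blast
  have unit: "expansion p a v 0" if "local_unit X p v" for a v
    using that unfolding expansion_def by (intro exI[of _ v]) auto
  have "expansion p t (\<lambda>q. s q powi j * u q) (i * j + 0)"
    by (intro expansion_mult tn powi ij unit u)
  then have "expansion p t t (i * j)" using expansion_cong eqv_sym[OF u(2)] by force
  moreover have "expansion p t t 1" using expansion_self[OF tn, of p 1] by simp
  ultimately have "i * j = 1" using expansion_unique[OF p tn tv] by blast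
  then have i: "i = 1" using pos pos_zmult_eq_1_iff by auto
  obtain v where v: "local_unit X p v" "f \<doteq> (\<lambda>q. s q powi k * v q)"
    using f unfolding expansion_def by blast
  have "expansion p t (\<lambda>q. s q powi k * v q) (i * k + 0)"
    by (intro expansion_mult tn powi ij unit v)
  then show ?thesis using expansion_cong eqv_sym[OF v(2)] i by force
qed

section \<open>The order of vanishing as a valuation\<close>

lemma uniformizer_exists: "p \<in> X \<Longrightarrow> \<exists>t. uniformizer X p t"
  using smooth unfolding smooth_projective_curve_def by blast

abbreviation ord :: "'n proj_space \<Rightarrow> ('n proj_space \<Rightarrow> complex) \<Rightarrow> int" where
  "ord \<equiv> ord_at X"

lemma expansion_ord:
  assumes p: "p \<in> X" and t: "uniformizer X p t" and f: "expansion p t f k"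
  shows "ord p f = k"
  unfolding ord_at_def
proof (rule the_equality)
  show "\<exists>t u. uniformizer X p t \<and> local_unit X p u \<and> f \<doteq> (\<lambda>q. t q powi k * u q)"
    using t f unfolding expansion_def by blast
next
  fix l assume "\<exists>t u. uniformizer X p t \<and> local_unit X p u \<and> f \<doteq> (\<lambda>q. t q powi l * u q)"
  then obtain s where "uniformizer X p s" "expansion p s f l" unfolding expansion_def by blast
  then have "expansion p t f l" using expansion_change[OF p t] by blast
  then show "l = k" using expansion_unique[OF p uniformizer_nz[OF t p] uniformizer_hasval[OF t] _ f] by blast
qed

lemma ord_expansion: "p \<in> X \<Longrightarrow> uniformizer X p t \<Longrightarrow> nz f \<Longrightarrow> expansion p t f (ord p f)"
  using expansion_exists expansion_ord by metis

lemma ord_cong: "f \<doteq> g \<Longrightarrow> ord p f = ord p g"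
proof -
  assume "f \<doteq> g"
  then have "f \<doteq> h \<longleftrightarrow> g \<doteq> h" for h using eqv_sym eqv_trans by blast
  then show ?thesis unfolding ord_at_def by simp
qed

lemma ord_mult:
  assumes p: "p \<in> X" and "nz f" "nz g"
  shows "ord p (\<lambda>q. f q * g q) = ord p f + ord p g"
proof -
  obtain t where t: "uniformizer X p t" using uniformizer_exists[OF p] by blast
  show ?thesis by (intro expansion_ord[OF p t] expansion_mult uniformizer_nz[OF t p] ord_expansion[OF p t] assms)
qed

lemma ord_hasval:
  assumes p: "p \<in> X" and f: "nz f"
  shows "ord p f \<ge> 0 \<longleftrightarrow> (\<exists>c. hasval p f c)" "ord p f > 0 \<longleftrightarrow> hasval p f 0"
proof -
  obtain t where t: "uniformizer X p t" using uniformizer_exists[OF p] by blast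
  note * = expansion_hasval[OF p uniformizer_nz[OF t p] uniformizer_hasval[OF t] ord_expansion[OF p t f]]
  show "ord p f \<ge> 0 \<longleftrightarrow> (\<exists>c. hasval p f c)" "ord p f > 0 \<longleftrightarrow> hasval p f 0" using * by auto
qed

lemma ord_eq_0:
  assumes p: "p \<in> X" and c: "hasval p f c" "c \<noteq> 0"
  shows "ord p f = 0"
proof -
  have f: "nz f" using hasval_nonzero_nz c p by blast
  have "ord p f \<ge> 0" using ord_hasval(1)[OF p f] c by blast
  moreover have "\<not> ord p f > 0" using ord_hasval(2)[OF p f] c hasval_unique[OF _ _ p] by blast
  ultimately show ?thesis by simp
qed

lemma ord_const [simp]: "p \<in> X \<Longrightarrow> c \<noteq> 0 \<Longrightarrow> ord p (\<lambda>_. c) = 0"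
  by (rule ord_eq_0[of p _ c]) auto

lemma ord_0_hasval: "p \<in> X \<Longrightarrow> nz f \<Longrightarrow> ord p f = 0 \<Longrightarrow> \<exists>c. c \<noteq> 0 \<and> hasval p f c"
proof -
  assume *: "p \<in> X" "nz f" "ord p f = 0"
  obtain c where c: "hasval p f c" using ord_hasval(1)[OF *(1,2)] *(3) by auto
  moreover have "c \<noteq> 0" using ord_hasval(2)[OF *(1,2)] *(3) c by auto
  ultimately show ?thesis by blast
qed

lemma ord_inverse:
  assumes p: "p \<in> X" and f: "nz f"
  shows "ord p (\<lambda>q. inverse (f q)) = - ord p f"
proof -
  have "(\<lambda>q. f q * inverse (f q)) \<doteq> (\<lambda>_. 1)"
    using nz_nonzero[OF f] unfolding rat_eq_ae by eventually_elim simp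
  from ord_cong[OF this, of p] have "ord p (\<lambda>q. f q * inverse (f q)) = 0" using ord_const[OF p, of 1] by simp
  then show ?thesis using ord_mult[OF p f nz_inverse[OF f]] by simp
qed

lemma ord_power: "p \<in> X \<Longrightarrow> nz f \<Longrightarrow> ord p (\<lambda>q. f q ^ k) = int k * ord p f"
proof (induction k)
  case (Suc k)
  then show ?case using ord_mult[of p f "\<lambda>q. f q ^ k"] by (auto simp: algebra_simps)
qed auto

lemma ord_powi: "p \<in> X \<Longrightarrow> nz f \<Longrightarrow> ord p (\<lambda>q. f q powi k) = k * ord p f"
proof -
  assume *: "p \<in> X" "nz f"
  show ?thesis
  proof (cases "k \<ge> 0")
    case True
    then show ?thesis using ord_power[OF *, of "nat k"] by (simp add: power_int_def)
  next
    case False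
    then show ?thesis using ord_power[OF *(1) nz_inverse[OF *(2)], of "nat (- k)"] ord_inverse[OF *]
      by (simp add: power_int_def)
  qed
qed

lemma ord_minus: "p \<in> X \<Longrightarrow> nz f \<Longrightarrow> ord p (\<lambda>q. - f q) = ord p f"
  using ord_mult[of p "\<lambda>_. -1" f] by simp

lemma ord_uniformizer: "p \<in> X \<Longrightarrow> uniformizer X p t \<Longrightarrow> ord p t = 1"
  using expansion_ord[of p t t 1] expansion_self[OF uniformizer_nz, of p t p 1] by simp

text \<open>After multiplication by the power -m of a uniformizer both summands have a value at p,
  hence so does their sum.\<close>

lemma ord_add_ge:
  assumes p: "p \<in> X" and fg: "nz f" "nz g" "nz (\<lambda>q. f q + g q)" and m: "m \<le> ord p f" "m \<le> ord p g"
  shows "m \<le> ord p (\<lambda>q. f q + g q)"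
proof -
  obtain t where t: "uniformizer X p t" using uniformizer_exists[OF p] by blast
  note tn = uniformizer_nz[OF t p]
  let ?s = "\<lambda>q. t q powi (- m)"
  have s: "nz ?s" "ord p ?s = - m" using tn ord_powi[OF p tn] ord_uniformizer[OF p t] by auto
  have "ord p (\<lambda>q. f q * ?s q) \<ge> 0" "ord p (\<lambda>q. g q * ?s q) \<ge> 0"
    using ord_mult[OF p fg(1) s(1)] ord_mult[OF p fg(2) s(1)] s(2) m by auto
  then obtain c d where "hasval p (\<lambda>q. f q * ?s q) c" "hasval p (\<lambda>q. g q * ?s q) d"
    using ord_hasval(1)[OF p nz_mult[OF fg(1) s(1)]] ord_hasval(1)[OF p nz_mult[OF fg(2) s(1)]] by blast
  then have "hasval p (\<lambda>q. (f q + g q) * ?s q) (c + d)"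
    using hasval_add by (simp add: distrib_right)
  then have "ord p (\<lambda>q. (f q + g q) * ?s q) \<ge> 0"
    using ord_hasval(1)[OF p nz_mult[OF fg(3) s(1)]] by blast
  then show ?thesis using ord_mult[OF p fg(3) s(1)] s(2) by simp
qed

lemma ord_add_less:
  assumes p: "p \<in> X" and fg: "nz f" "nz g" and lt: "ord p f < ord p g"
  shows "nz (\<lambda>q. f q + g q)" "ord p (\<lambda>q. f q + g q) = ord p f"
proof -
  show nz: "nz (\<lambda>q. f q + g q)"
  proof (rule ccontr)
    assume "\<not> ?thesis"
    moreover have "rational (\<lambda>q. f q + g q)" using fg by blast
    ultimately have "(\<lambda>q. f q + g q) \<doteq> (\<lambda>_. 0)" unfolding nz_def by blast
    then have "f \<doteq> (\<lambda>q. - g q)" unfolding rat_eq_ae by eventually_elim (simp add: eq_neg_iff_add_eq_0)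
    from ord_cong[OF this, of p] have "ord p f = ord p g" using ord_minus[OF p fg(2)] by simp
    then show False using lt by simp
  qed
  have ge: "ord p f \<le> ord p (\<lambda>q. f q + g q)" using ord_add_ge[OF p fg nz] lt by auto
  have ng: "nz (\<lambda>q. - g q)" using nz_mult[of "\<lambda>_. -1" g] fg by simp
  \<comment> \<open>The reverse inequality follows by writing f as (f + g) - g: since g has the
    larger order, the order of f + g cannot exceed that of f.\<close>
  have "min (ord p (\<lambda>q. f q + g q)) (ord p g) \<le> ord p (\<lambda>q. (f q + g q) + - g q)"
    using fg(1) by (intro ord_add_ge[OF p nz ng]) (auto simp: ord_minus[OF p fg(2)])
  then show "ord p (\<lambda>q. f q + g q) = ord p f" using ge lt by auto
qed

lemma ord_finite_support: "nz f \<Longrightarrow> finite {p\<in>X. ord p f \<noteq> 0}"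
proof -
  assume f: "nz f"
  have "\<forall>\<^sub>F p in ae. ord p f = 0"
    using rational_hasval[OF nz_rational[OF f]] nz_nonzero[OF f] eventually_ae_X
  proof eventually_elim
    case (elim p)
    then show ?case using ord_eq_0[of p f "f p"] by blast
  qed
  then show ?thesis by (simp add: eventually_ae)
qed

end

section \<open>Pullback along coverings\<close>

text \<open>The forms of the quotient are composed with the forms of the morphism. The coordinates
  of \<open>f q\<close> chosen by \<open>hcoords\<close> differ from the composed vector by a scalar
  c, and \<open>c ^ e\<close> cancels in the quotient.\<close>

lemma regular_at_pullback:
  assumes mor: "morphism X Y f" and p: "p \<in> X" and g: "regular_at Y (f p) g"
  shows "regular_at X p (\<lambda>q. g (f q))"
proof -
  have "\<exists>d F. (\<forall>j. homogeneous_poly d (F j)) \<and> (\<exists>j. F j (hcoords p) \<noteq> 0) \<and>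
      (\<forall>q\<in>X. (\<exists>j. F j (hcoords q) \<noteq> 0) \<longrightarrow> f q = hpoint (\<chi> j. F j (hcoords q)))"
    using mor p unfolding morphism_def by blast
  then obtain d F j0 where F: "\<And>j. homogeneous_poly d (F j)" "F j0 (hcoords p) \<noteq> 0"
     "\<forall>q\<in>X. (\<exists>j. F j (hcoords q) \<noteq> 0) \<longrightarrow> f q = hpoint (\<chi> j. F j (hcoords q))"
    by blast
  have fY: "q \<in> X \<Longrightarrow> f q \<in> Y" for q using mor unfolding morphism_def by blast
  obtain e A B where AB: "homogeneous_poly e A" "homogeneous_poly e B" "B (hcoords (f p)) \<noteq> 0"
     "\<forall>q\<in>Y. B (hcoords q) \<noteq> 0 \<longrightarrow> g q = A (hcoords q) / B (hcoords q)"
    using g unfolding regular_at_def by blast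
  define v where "v = (\<lambda>x. \<chi> j. F j x)"
  have hp: "homogeneous_poly (e * d) (\<lambda>x. A (v x))" "homogeneous_poly (e * d) (\<lambda>x. B (v x))"
    unfolding v_def by (intro hp_compose AB F)+
  have fv: "\<exists>c. c \<noteq> 0 \<and> hcoords (f q) = c *s v (hcoords q)" if q: "q \<in> X" "F j0 (hcoords q) \<noteq> 0" for q
  proof -
    have "v (hcoords q) $ j0 \<noteq> 0" using q by (simp add: v_def)
    then have v0: "v (hcoords q) \<noteq> 0" by auto
    have "f q = hpoint (v (hcoords q))" unfolding v_def using F(3) q by blast
    moreover obtain c where "c \<noteq> 0" "hcoords (hpoint (v (hcoords q))) = c *s v (hcoords q)"
      by (rule hcoords_hpoint[OF v0])
    ultimately show ?thesis by metis
  qed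
  have Bp: "B (v (hcoords p)) \<noteq> 0"
  proof -
    obtain c where c: "c \<noteq> 0" "hcoords (f p) = c *s v (hcoords p)" using fv[OF p F(2)] by blast
    then show ?thesis using AB(3) homogeneous_poly_scale[OF AB(2), of c] by auto
  qed
  have "near X p (\<lambda>q. F j0 (hcoords q) \<noteq> 0)" using F by (intro nearI[of d "F j0"]) auto
  moreover have "near X p (\<lambda>q. B (v (hcoords q)) \<noteq> 0)"
    using hp(2) Bp by (intro nearI[of "e * d" "\<lambda>x. B (v x)"]) auto
  ultimately have n: "near X p (\<lambda>q. F j0 (hcoords q) \<noteq> 0 \<and> B (v (hcoords q)) \<noteq> 0)"
    by (rule near_conj)
  have "near X p (\<lambda>q. B (v (hcoords q)) \<noteq> 0 \<and> g (f q) = A (v (hcoords q)) / B (v (hcoords q)))"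
  proof (rule near_mono[OF n])
    fix q assume q: "q \<in> X" "F j0 (hcoords q) \<noteq> 0 \<and> B (v (hcoords q)) \<noteq> 0"
    obtain c where c: "c \<noteq> 0" "hcoords (f q) = c *s v (hcoords q)" using fv q by blast
    have "A (hcoords (f q)) = c ^ e * A (v (hcoords q))" "B (hcoords (f q)) = c ^ e * B (v (hcoords q))"
      unfolding c(2) using homogeneous_poly_scale AB by blast+
    then show "B (v (hcoords q)) \<noteq> 0 \<and> g (f q) = A (v (hcoords q)) / B (v (hcoords q))"
      using AB(4) fY[OF q(1)] q(2) c(1) by simp
  qed
  then show ?thesis unfolding regular_at_near
    by (intro exI[of _ "e * d"] exI[of _ "\<lambda>x. A (v x)"] exI[of _ "\<lambda>x. B (v x)"] conjI hp Bp)
qed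

locale curve_covering = X: smooth_curve X + Y: smooth_curve Y
  for X :: "'n::finite proj_space set" and Y :: "'m::finite proj_space set" +
  fixes f :: "'n proj_space \<Rightarrow> 'm proj_space" and n :: nat
  assumes cov: "covering X Y f n" and npos: "n > 0"
begin

abbreviation ram :: "'n proj_space \<Rightarrow> nat" where "ram \<equiv> ram_index X Y f"

lemma mor: "morphism X Y f" using cov unfolding covering_def by blast

lemma in_Y: "p \<in> X \<Longrightarrow> f p \<in> Y" using mor unfolding morphism_def by blast

lemma finite_fiber: "q \<in> Y \<Longrightarrow> finite (fiber X f q)"
  using cov unfolding covering_def by blast

lemma sum_fiber: "q \<in> Y \<Longrightarrow> (\<Sum>p\<in>fiber X f q. ram p) = n"
  using cov unfolding covering_def by blast

text \<open>An empty fiber would have multiplicity sum 0 instead of n.\<close>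

lemma surj: assumes "q \<in> Y" obtains p where "p \<in> X" "f p = q"
proof -
  have "fiber X f q \<noteq> {}" using sum_fiber[OF assms] npos by (metis sum.empty less_irrefl)
  then show ?thesis using that unfolding fiber_def by blast
qed

lemma finite_preimage: assumes "finite B" shows "finite {p\<in>X. f p \<in> B}"
proof -
  have "{p\<in>X. f p \<in> B} \<subseteq> (\<Union>q\<in>B \<inter> Y. fiber X f q)" using in_Y unfolding fiber_def by blast
  then show ?thesis using assms finite_fiber finite_subset by blast
qed

lemma ae_pullback: assumes "eventually P Y.ae" shows "eventually (\<lambda>p. P (f p)) X.ae"
proof -
  have "finite {q\<in>Y. \<not> P q}" using assms unfolding Y.eventually_ae .
  from finite_preimage[OF this] show ?thesis unfolding X.eventually_ae
    using in_Y by (auto elim: finite_subset[rotated])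
qed

lemma eqv_pullback: "rat_eq Y g h \<Longrightarrow> rat_eq X (\<lambda>p. g (f p)) (\<lambda>p. h (f p))"
  unfolding X.rat_eq_ae Y.rat_eq_ae by (rule ae_pullback)

lemma hasval_pullback:
  assumes "p \<in> X" "Y.hasval (f p) g c" shows "X.hasval p (\<lambda>q. g (f q)) c"
proof -
  obtain h where "regular_at Y (f p) h" "h (f p) = c" "rat_eq Y g h"
    using assms(2) unfolding Y.hasval_def by blast
  then show ?thesis unfolding X.hasval_def
    using regular_at_pullback[OF mor assms(1)] eqv_pullback by (intro exI[of _ "\<lambda>q. h (f q)"]) auto
qed

lemma rational_pullback: assumes "Y.rational g" shows "X.rational (\<lambda>q. g (f q))"
  using ae_pullback[OF assms[unfolded Y.rational_ae]] X.eventually_ae_X unfolding X.rational_ae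
  by eventually_elim (rule regular_at_pullback[OF mor])

lemma nz_pullback: assumes "Y.nz g" shows "X.nz (\<lambda>q. g (f q))"
  using ae_pullback[OF Y.nz_nonzero[OF assms]] rational_pullback assms unfolding X.nz_ae Y.nz_ae by blast

text \<open>Pulling back g = t^k u turns the unit u into a unit, so only the order of the pulled
  back uniformizer enters.\<close>

lemma ord_pullback_aux:
  assumes p: "p \<in> X" and t: "uniformizer Y (f p) t" and g: "Y.nz g"
  shows "X.ord p (\<lambda>q. g (f q)) = Y.ord (f p) g * X.ord p (\<lambda>q. t (f q))"
    "X.ord p (\<lambda>q. t (f q)) > 0"
proof -
  note fp = in_Y[OF p]
  have tn: "Y.nz t" by (rule Y.uniformizer_nz[OF t fp])
  obtain u c where u: "c \<noteq> 0" "Y.hasval (f p) u c" "rat_eq Y g (\<lambda>q. t q powi Y.ord (f p) g * u q)"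
    using Y.ord_expansion[OF fp t g] unfolding Y.expansion_def Y.local_unit_hasval by blast
  have un: "Y.nz u" using Y.hasval_nonzero_nz u fp by blast
  have "X.ord p (\<lambda>q. u (f q)) = 0" using X.ord_eq_0[OF p hasval_pullback[OF p u(2)] u(1)] .
  moreover have "X.ord p (\<lambda>q. g (f q)) = X.ord p (\<lambda>q. t (f q) powi Y.ord (f p) g * u (f q))"
    by (rule X.ord_cong[OF eqv_pullback[OF u(3)]])
  ultimately show "X.ord p (\<lambda>q. g (f q)) = Y.ord (f p) g * X.ord p (\<lambda>q. t (f q))"
    using X.ord_mult[OF p X.nz_powi[OF nz_pullback[OF tn]] nz_pullback[OF un]] X.ord_powi[OF p nz_pullback[OF tn]]
    by simp
  show "X.ord p (\<lambda>q. t (f q)) > 0"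
    using X.ord_hasval(2)[OF p nz_pullback[OF tn]] hasval_pullback[OF p Y.uniformizer_hasval[OF t]] by blast
qed

lemma some_uniformizer: "q \<in> Y \<Longrightarrow> uniformizer Y q (SOME t. uniformizer Y q t)"
  by (rule someI_ex[OF Y.uniformizer_exists])

text \<open>Frees \<open>ram_index\<close> from the uniformizer picked by \<open>SOME\<close>: any
  other one has order 1, so its pullback has the same order.\<close>

lemma ram_eq:
  assumes p: "p \<in> X" and t: "uniformizer Y (f p) t"
  shows "int (ram p) = X.ord p (\<lambda>q. t (f q))"
proof -
  let ?T = "SOME t. uniformizer Y (f p) t"
  have T: "uniformizer Y (f p) ?T" by (rule some_uniformizer[OF in_Y[OF p]])
  have "X.ord p (\<lambda>q. t (f q)) = Y.ord (f p) t * X.ord p (\<lambda>q. ?T (f q))"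
    by (rule ord_pullback_aux(1)[OF p T Y.uniformizer_nz[OF t in_Y[OF p]]])
  moreover have "Y.ord (f p) t = 1" by (rule Y.ord_uniformizer[OF in_Y[OF p] t])
  ultimately show ?thesis using ord_pullback_aux(2)[OF p T Y.uniformizer_nz[OF t in_Y[OF p]]] unfolding ram_index_def comp_def by simp
qed

lemma ram_pos: "p \<in> X \<Longrightarrow> ram p > 0"
proof -
  assume p: "p \<in> X"
  note T = some_uniformizer[OF in_Y[OF p]]
  show ?thesis using ram_eq[OF p T] ord_pullback_aux(2)[OF p T Y.uniformizer_nz[OF T in_Y[OF p]]] by simp
qed

lemma ord_pullback:
  assumes p: "p \<in> X" and g: "Y.nz g"
  shows "X.ord p (\<lambda>q. g (f q)) = int (ram p) * Y.ord (f p) g"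
  using ord_pullback_aux(1)[OF p some_uniformizer[OF in_Y[OF p]] g]
    ram_eq[OF p some_uniformizer[OF in_Y[OF p]]] by simp

end

section \<open>The projective line as a curve\<close>

lemma binary_form:
  assumes "homogeneous_poly d (F :: complex ^ 2 \<Rightarrow> complex)"
  shows "\<exists>c. \<forall>x. F x = (\<Sum>i\<le>d. c i * (x $ 1) ^ (d - i) * (x $ 2) ^ i)"
proof -
  obtain a where F: "F = (\<lambda>x. \<Sum>m | (\<Sum>i\<in>UNIV. m i) = d. a m * (\<Prod>i\<in>UNIV. (x $ i) ^ m i))"
    using assms by (auto simp: homogeneous_poly_def)
  \<comment> \<open>The exponent function of the monomial of degree d whose second variable has
    exponent i; these are all the monomials of that degree.\<close>
  define M :: "nat \<Rightarrow> 2 \<Rightarrow> nat" where "M = (\<lambda>i j. if j = 1 then d - i else i)"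
  have "{m :: 2 \<Rightarrow> nat. (\<Sum>i\<in>UNIV. m i) = d} = M ` {..d}"
  proof (intro set_eqI iffI)
    fix m :: "2 \<Rightarrow> nat" assume "m \<in> {m. (\<Sum>i\<in>UNIV. m i) = d}"
    then have s: "m 1 + m 2 = d" by (simp add: sum_2)
    have "m = M (m 2)"
    proof
      fix j :: 2 show "m j = M (m 2) j" using exhaust_2[of j] s by (auto simp: M_def)
    qed
    then show "m \<in> M ` {..d}" using s by auto
  qed (auto simp: M_def sum_2)
  moreover have "inj_on M {..d}"
  proof (rule inj_onI)
    fix i j assume "M i = M j"
    then have "M i 2 = M j 2" by simp
    then show "i = j" by (simp add: M_def)
  qed
  ultimately have "F x = (\<Sum>i\<le>d. a (M i) * (x $ 1) ^ (d - i) * (x $ 2) ^ i)" for x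
    unfolding F by (simp add: sum.reindex UNIV_2 M_def mult.assoc)
  then show ?thesis by (intro exI[of _ "\<lambda>i. a (M i)"]) auto
qed

text \<open>If two proper closed sets covered the line, a product of two forms would vanish
  identically, although neither factor does. Restricted to an affine parametrisation this
  contradicts that C[z] has no zero divisors.\<close>

lemma P1_variety: "projective_variety P1"
proof -
  have "Z1 = UNIV \<or> Z2 = UNIV" if Z: "zariski_closed Z1" "zariski_closed Z2" "UNIV \<subseteq> Z1 \<union> Z2" for Z1 Z2 :: "2 proj_space set"
  proof (rule ccontr)
    assume "\<not> ?thesis"
    then obtain p q where pq: "p \<notin> Z1" "q \<notin> Z2" by blast
    then have ne: "p \<noteq> q" using Z(3) by blast
    obtain S T where S: "\<forall>F\<in>S. \<exists>d. homogeneous_poly d F" "Z1 = {p. \<forall>F\<in>S. F (hcoords p) = 0}"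
      and T: "\<forall>F\<in>T. \<exists>d. homogeneous_poly d F" "Z2 = {p. \<forall>F\<in>T. F (hcoords p) = 0}"
      using Z unfolding zariski_closed_def by blast
    obtain F where F: "F \<in> S" "F (hcoords p) \<noteq> 0" using pq S by blast
    obtain G where G: "G \<in> T" "G (hcoords q) \<noteq> 0" using pq T by blast
    obtain d where d: "homogeneous_poly d F" using F S by blast
    obtain e where e: "homogeneous_poly e G" using G T by blast
    have FG0: "F x * G x = 0" if "x \<noteq> 0" for x
    proof -
      have "hpoint x \<in> Z1 \<or> hpoint x \<in> Z2" using Z(3) by blast
      then show ?thesis using F(1) G(1) S(2) T(2) hp_hpoint[OF d that] hp_hpoint[OF e that] by auto
    qed
    \<comment> \<open>The affine line of vectors from p at z = 0 to q at z = 1. It avoids the origin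
      because p and q are not proportional.\<close>
    define L where "L = (\<lambda>z. (1 - z) *s hcoords p + z *s hcoords q)"
    have L0: "L z \<noteq> 0" for z
    proof
      assume L: "L z = 0"
      have "z \<noteq> 0" using L hcoords_nonzero[of p] by (auto simp: L_def)
      have eq: "hcoords q = (- (1 - z) / z) *s hcoords p"
      proof (rule vec_eq_iff[THEN iffD2], rule allI)
        fix i
        have "L z $ i = 0" using L by simp
        then have "(1 - z) * hcoords p $ i + z * hcoords q $ i = 0" by (simp add: L_def algebra_simps)
        then show "hcoords q $ i = ((- (1 - z) / z) *s hcoords p) $ i"
          using \<open>z \<noteq> 0\<close> by (simp add: field_simps add_eq_0_iff)
      qed
      moreover from this have "- (1 - z) / z \<noteq> 0" using hcoords_nonzero[of q] by (metis vector_smult_lzero)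
      ultimately have "hpoint (hcoords q) = hpoint (hcoords p)"
        using hpoint_scale[of _ "hcoords p"] hcoords_nonzero by metis
      then show False using ne by (simp add: hpoint_hcoords)
    qed
    have pol: "\<exists>A. \<forall>z. H (L z) = poly A z" if H: "homogeneous_poly k H" for k and H :: "complex ^ 2 \<Rightarrow> complex"
    proof -
      obtain c where c: "\<forall>x. H x = (\<Sum>i\<le>k. c i * (x $ 1) ^ (k - i) * (x $ 2) ^ i)"
        using binary_form[OF H] by blast
      have Lj: "L z $ j = poly [:hcoords p $ j, hcoords q $ j - hcoords p $ j:] z" for j z
        by (simp add: L_def algebra_simps)
      show ?thesis
        by (rule exI[of _ "\<Sum>i\<le>k. smult (c i) ([:hcoords p $ 1, hcoords q $ 1 - hcoords p $ 1:] ^ (k - i) *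
              [:hcoords p $ 2, hcoords q $ 2 - hcoords p $ 2:] ^ i)"])
          (simp add: c Lj poly_sum mult.assoc)
    qed
    obtain A B where AB: "\<And>z. F (L z) = poly A z" "\<And>z. G (L z) = poly B z"
      using pol[OF d] pol[OF e] by blast
    have "poly (A * B) z = 0" for z using FG0[OF L0, of z] AB by simp
    then have "A * B = 0" using poly_all_0_iff_0 by blast
    moreover have "poly A 0 \<noteq> 0" using AB(1)[of 0] F(2) by (simp add: L_def)
    moreover have "poly B 1 \<noteq> 0" using AB(2)[of 1] G(2) by (simp add: L_def)
    ultimately show False by auto
  qed
  moreover have "zariski_closed P1" unfolding zariski_closed_def by (intro exI[of _ "{}"]) auto
  ultimately show ?thesis unfolding projective_variety_def by blast
qed

definition P1_inf :: "2 proj_space" where "P1_inf = hpoint (vector [1, 0])"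

lemma P1_rat_eq_refl: "rat_eq P1 f f"
  unfolding rat_eq_def generically_iff_near by (rule bexI[of _ P1_inf]) (auto intro: near_always)

text \<open>A point \<open>p\<close> of the line is described by coordinates \<open>\<alpha>, \<beta>\<close> with respect to a basis
  whose first vector represents \<open>p\<close>.\<close>

lemma P1_uniformizer:
  fixes p :: "2 proj_space"
  assumes \<alpha>: "homogeneous_poly (Suc 0) \<alpha>" "\<alpha> (hcoords p) = 1"
    and \<beta>: "homogeneous_poly (Suc 0) \<beta>" "\<beta> (hcoords p) = 0"
    and Q: "\<And>x. x = \<alpha> x *s hcoords p + \<beta> x *s Q" "\<alpha> Q = 0" "\<beta> Q = 1"
    and add: "\<And>x y. \<alpha> (x + y) = \<alpha> x + \<alpha> y" "\<And>x y. \<beta> (x + y) = \<beta> x + \<beta> y"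
  shows "uniformizer P1 p (\<lambda>q. \<beta> (hcoords q) / \<alpha> (hcoords q))"
proof -
  let ?P = "hcoords p" and ?t = "\<lambda>q. \<beta> (hcoords q) / \<alpha> (hcoords q)"
  have "regular_at P1 p ?t" unfolding regular_at_def
    using \<alpha> \<beta> by (intro exI[of _ "Suc 0"] exI[of _ \<beta>] exI[of _ \<alpha>]) auto
  moreover have "?t p = 0" using \<beta> by simp
  ultimately have max: "local_max_ideal P1 p ?t"
    unfolding local_max_ideal_def using P1_rat_eq_refl by blast
  have Fgen: "generically P1 (\<lambda>q. F (hcoords q) \<noteq> 0)" if "homogeneous_poly d F" "F x \<noteq> 0" "x \<noteq> 0" for d F and x :: "complex ^ 2"
  proof -
    have "F (hcoords (hpoint x)) \<noteq> 0" using hp_hpoint that by blast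
    then have "near P1 (hpoint x) (\<lambda>q. F (hcoords q) \<noteq> 0)" using that(1) by (intro nearI[of d F]) auto
    then show ?thesis using generically_iff_near by blast
  qed
  have P0: "?P \<noteq> 0" by (rule hcoords_nonzero)
  have Q0: "Q \<noteq> 0" using Q(2,3) add(2)[of 0 0] by auto
  have \<alpha>gen: "generically P1 (\<lambda>q. \<alpha> (hcoords q) \<noteq> 0)" using Fgen[OF \<alpha>(1), of ?P] \<alpha>(2) P0 by simp
  have \<beta>gen: "generically P1 (\<lambda>q. \<beta> (hcoords q) \<noteq> 0)" using Fgen[OF \<beta>(1), of Q] Q(3) Q0 by simp
  have tne: "\<not> rat_eq P1 ?t (\<lambda>_. 0)"
  proof
    assume "rat_eq P1 ?t (\<lambda>_. 0)"
    then have "generically P1 (\<lambda>q. ?t q = 0)" unfolding rat_eq_def .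
    from generically_2[OF P1_variety generically_conj[OF P1_variety \<alpha>gen \<beta>gen] this, of "\<lambda>_. False"]
    have "generically P1 (\<lambda>_. False)" by simp
    then show False using generically_ex by blast
  qed
  \<comment> \<open>In the coordinates \<alpha>, \<beta> a form is a sum of terms
    \<open>c i * \<alpha> ^ (d - i) * \<beta> ^ i\<close>. The least i with nonzero coefficient is
    the order of vanishing at p, because \<beta> vanishes there and \<alpha> is 1.\<close>
  have factor: "\<exists>k F1. k \<le> d \<and> homogeneous_poly (d - k) F1 \<and> F1 ?P \<noteq> 0 \<and> (\<forall>x. F x = \<beta> x ^ k * F1 x)"
    if F: "homogeneous_poly d F" "\<exists>x. F x \<noteq> 0" for d and F :: "complex ^ 2 \<Rightarrow> complex"
  proof -
    define G where "G = (\<lambda>y :: complex ^ 2. F (\<chi> j. y $ 1 * ?P $ j + y $ 2 * Q $ j))"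
    have "homogeneous_poly (d * Suc 0) G" unfolding G_def
    proof (rule hp_compose[OF F(1)])
      fix j
      have "homogeneous_poly (Suc 0) (\<lambda>y :: complex ^ 2. ?P $ j * y $ 1 + Q $ j * y $ 2)"
        by (intro hp_add hp_cmult hp_coord)
      then show "homogeneous_poly (Suc 0) (\<lambda>y :: complex ^ 2. y $ 1 * ?P $ j + y $ 2 * Q $ j)"
        by (simp add: mult.commute)
    qed
    then obtain c where c: "\<And>y. G y = (\<Sum>i\<le>d. c i * (y $ 1) ^ (d - i) * (y $ 2) ^ i)"
      using binary_form by fastforce
    have Fc: "F x = (\<Sum>i\<le>d. c i * \<alpha> x ^ (d - i) * \<beta> x ^ i)" for x
    proof -
      have "F x = G (vector [\<alpha> x, \<beta> x])"
        unfolding G_def using Q(1)[of x] by (intro arg_cong[of _ _ F]) (simp add: vec_eq_iff)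
      then show ?thesis by (simp add: c)
    qed
    have "\<exists>i. i \<le> d \<and> c i \<noteq> 0"
    proof (rule ccontr)
      assume "\<not> ?thesis" then have "F x = 0" for x unfolding Fc by (intro sum.neutral) auto
      then show False using F(2) by blast
    qed
    define k where "k = (LEAST i. i \<le> d \<and> c i \<noteq> 0)"
    have k: "k \<le> d" "c k \<noteq> 0"
      using LeastI_ex[OF \<open>\<exists>i. i \<le> d \<and> c i \<noteq> 0\<close>] unfolding k_def by blast+
    have kmin: "c i = 0" if "i < k" for i
      using not_less_Least[of i "\<lambda>i. i \<le> d \<and> c i \<noteq> 0"] that k(1) unfolding k_def by simp
    define F1 where "F1 = (\<lambda>x. \<Sum>i\<in>{k..d}. c i * (\<alpha> x ^ (d - i) * \<beta> x ^ (i - k)))"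
    have "homogeneous_poly (d - k) F1" unfolding F1_def
    proof (intro hp_sum hp_cmult)
      fix i assume i: "i \<in> {k..d}"
      have "homogeneous_poly ((d - i) * Suc 0 + (i - k) * Suc 0) (\<lambda>x. \<alpha> x ^ (d - i) * \<beta> x ^ (i - k))"
        by (intro hp_mult hp_power \<alpha> \<beta>)
      moreover have "(d - i) * Suc 0 + (i - k) * Suc 0 = d - k" using i by auto
      ultimately show "homogeneous_poly (d - k) (\<lambda>x. \<alpha> x ^ (d - i) * \<beta> x ^ (i - k))" by simp
    qed
    moreover have "F1 ?P \<noteq> 0"
    proof -
      have "F1 ?P = (\<Sum>i\<in>{k..d}. if i = k then c k else 0)"
        unfolding F1_def using \<alpha>(2) \<beta>(2) by (intro sum.cong) (auto simp: power_0_left)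
      then show ?thesis using k by simp
    qed
    moreover have "F x = \<beta> x ^ k * F1 x" for x
    proof -
      have "F x = (\<Sum>i\<in>{k..d}. c i * \<alpha> x ^ (d - i) * \<beta> x ^ i)"
        unfolding Fc by (rule sum.mono_neutral_right) (auto simp: kmin)
      also have "\<dots> = \<beta> x ^ k * F1 x" unfolding F1_def sum_distrib_left
        by (intro sum.cong) (auto simp: power_add[symmetric])
      finally show ?thesis .
    qed
    ultimately show ?thesis using k(1) by blast
  qed
  have "\<exists>(k::int) u. local_unit P1 p u \<and> rat_eq P1 f (\<lambda>q. ?t q powi k * u q)"
    if f: "rational_fun P1 f" "\<not> rat_eq P1 f (\<lambda>_. 0)" for f
  proof -
    obtain r where r: "regular_at P1 r f" using generically_ex f(1) unfolding rational_fun_def by blast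
    obtain d F G where FG: "homogeneous_poly d F" "homogeneous_poly d G" "G (hcoords r) \<noteq> 0"
      "\<forall>q. G (hcoords q) \<noteq> 0 \<longrightarrow> f q = F (hcoords q) / G (hcoords q)"
      using r unfolding regular_at_def by blast
    have Ggen: "generically P1 (\<lambda>q. G (hcoords q) \<noteq> 0)" using Fgen[OF FG(2,3) hcoords_nonzero] .
    have F0: "\<exists>x. F x \<noteq> 0"
    proof (rule ccontr)
      assume "\<not> ?thesis"
      then have "rat_eq P1 f (\<lambda>_. 0)" unfolding rat_eq_def
        using generically_mono[OF Ggen] FG(4) by simp
      then show False using f by blast
    qed
    obtain k F1 where F1: "k \<le> d" "homogeneous_poly (d - k) F1" "F1 ?P \<noteq> 0" "\<And>x. F x = \<beta> x ^ k * F1 x"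
      using factor[OF FG(1) F0] by blast
    obtain l G1 where G1: "l \<le> d" "homogeneous_poly (d - l) G1" "G1 ?P \<noteq> 0" "\<And>x. G x = \<beta> x ^ l * G1 x"
      using factor[OF FG(2)] FG(3) by blast
    \<comment> \<open>Replacing \<beta> by \<beta>/\<alpha> in F/G leaves powers of \<alpha>, and
      these also restore the common degree d of numerator and denominator.\<close>
    define u where "u = (\<lambda>q. (F1 (hcoords q) * \<alpha> (hcoords q) ^ k) / (G1 (hcoords q) * \<alpha> (hcoords q) ^ l))"
    have h1: "homogeneous_poly d (\<lambda>x. F1 x * \<alpha> x ^ k)"
      using hp_mult[OF F1(2) hp_power[OF \<alpha>(1), of k]] F1(1) by simp
    have h2: "homogeneous_poly d (\<lambda>x. G1 x * \<alpha> x ^ l)"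
      using hp_mult[OF G1(2) hp_power[OF \<alpha>(1), of l]] G1(1) by simp
    have "regular_at P1 p u" unfolding regular_at_def u_def
      by (rule exI[of _ d], rule exI[of _ "\<lambda>x. F1 x * \<alpha> x ^ k"], rule exI[of _ "\<lambda>x. G1 x * \<alpha> x ^ l"])
        (use h1 h2 G1(3) \<alpha>(2) in simp)
    moreover have "u p \<noteq> 0" using F1(3) G1(3) \<alpha>(2) by (simp add: u_def)
    ultimately have "local_unit P1 p u" unfolding local_unit_def using P1_rat_eq_refl by blast
    moreover have "rat_eq P1 f (\<lambda>q. ?t q powi (int k - int l) * u q)" unfolding rat_eq_def
    proof (rule generically_2[OF P1_variety generically_conj[OF P1_variety \<alpha>gen \<beta>gen] Ggen])
      fix q assume q: "\<alpha> (hcoords q) \<noteq> 0 \<and> \<beta> (hcoords q) \<noteq> 0" "G (hcoords q) \<noteq> 0"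
      have g1: "G1 (hcoords q) \<noteq> 0" using q(2) G1(4) by auto
      have "f q = F (hcoords q) / G (hcoords q)" using FG(4) q(2) by blast
      also have "\<dots> = ?t q powi (int k - int l) * u q"
        using q(1) g1 unfolding F1(4) G1(4) u_def
        by (simp add: power_int_diff power_divide field_simps)
      finally show "f q = ?t q powi (int k - int l) * u q" .
    qed
    ultimately show ?thesis by blast
  qed
  then show ?thesis unfolding uniformizer_def using max tne by blast
qed

text \<open>The affine coordinate. At \<open>P1_inf\<close> division by zero makes it 0, so it
  separates points only away from \<open>P1_inf\<close>.\<close>

definition P1_coord :: "2 proj_space \<Rightarrow> complex" where
  "P1_coord q = hcoords q $ 1 / hcoords q $ 2"

definition P1_point :: "complex \<Rightarrow> 2 proj_space" where "P1_point c = hpoint (vector [c, 1])"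

lemma hcoords2_zero_iff: "hcoords q $ 2 = 0 \<longleftrightarrow> q = P1_inf"
proof
  assume "hcoords q $ 2 = 0"
  then have "hcoords q = hcoords q $ 1 *s vector [1, 0]" by (simp add: vec_eq_iff forall_2)
  moreover have "hcoords q $ 1 \<noteq> 0"
    using \<open>hcoords q $ 2 = 0\<close> hcoords_nonzero[of q] by (auto simp: vec_eq_iff forall_2)
  moreover have "(vector [1, 0] :: complex ^ 2) \<noteq> 0" by (auto simp: vec_eq_iff forall_2)
  ultimately show "q = P1_inf" unfolding P1_inf_def using hpoint_scale hpoint_hcoords by metis
next
  assume q: "q = P1_inf"
  have "(vector [1, 0] :: complex ^ 2) \<noteq> 0" by (auto simp: vec_eq_iff forall_2)
  then obtain c where "hcoords q = c *s vector [1, 0]" unfolding q P1_inf_def by (rule hcoords_hpoint)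
  then show "hcoords q $ 2 = 0" by simp
qed

lemma P1_point: "P1_point c \<noteq> P1_inf" "P1_coord (P1_point c) = c"
proof -
  have v: "(vector [c, 1] :: complex ^ 2) \<noteq> 0" by (auto simp: vec_eq_iff forall_2)
  obtain a where a: "a \<noteq> 0" "hcoords (P1_point c) = a *s vector [c, 1]"
    unfolding P1_point_def by (rule hcoords_hpoint[OF v])
  then show "P1_point c \<noteq> P1_inf" "P1_coord (P1_point c) = c"
    by (auto simp: hcoords2_zero_iff[symmetric] P1_coord_def)
qed

lemma P1_coord_inj: "p \<noteq> P1_inf \<Longrightarrow> q \<noteq> P1_inf \<Longrightarrow> P1_coord p = P1_coord q \<Longrightarrow> p = q"
proof -
  assume *: "p \<noteq> P1_inf" "q \<noteq> P1_inf" "P1_coord p = P1_coord q"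
  then have 2: "hcoords p $ 2 \<noteq> 0" "hcoords q $ 2 \<noteq> 0" by (auto simp: hcoords2_zero_iff)
  have "hpoint (hcoords p) = hpoint (hcoords q)"
  proof (rule proj_eqI[OF hcoords_nonzero 2(1) hcoords_nonzero])
    fix i :: 2
    show "hcoords q $ i * hcoords p $ 2 = hcoords q $ 2 * hcoords p $ i"
      using exhaust_2[of i] *(3) 2 by (auto simp: P1_coord_def field_simps)
  qed
  then show "p = q" by (simp add: hpoint_hcoords)
qed

text \<open>Up to a constant this is the affine coordinate minus its value at p; the factor
  \<open>inverse (hcoords p $ 2)\<close> normalises the denominator form to 1 at p.\<close>

lemma P1_uniformizer_finite:
  assumes "p \<noteq> P1_inf"
  shows "uniformizer P1 p (\<lambda>q. (hcoords q $ 1 - hcoords p $ 1 / hcoords p $ 2 * hcoords q $ 2) /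
    (inverse (hcoords p $ 2) * hcoords q $ 2))"
proof -
  have P2: "hcoords p $ 2 \<noteq> 0" using assms hcoords2_zero_iff by blast
  have h: "homogeneous_poly (Suc 0) (\<lambda>x :: complex ^ 2. inverse (hcoords p $ 2) * x $ 2)"
    "homogeneous_poly (Suc 0) (\<lambda>x :: complex ^ 2. x $ 1 - (hcoords p $ 1 / hcoords p $ 2) * x $ 2)"
    by (intro hp_diff hp_cmult hp_coord)+
  show ?thesis
    by (rule P1_uniformizer[where Q = "vector [1, 0]", OF h(1) _ h(2)])
      (use P2 in \<open>auto simp: vec_eq_iff forall_2 field_simps\<close>)
qed

lemma P1_uniformizer_inf:
  "uniformizer P1 P1_inf (\<lambda>q. hcoords q $ 2 / (inverse (hcoords P1_inf $ 1) * hcoords q $ 1))"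
proof -
  have P2: "hcoords P1_inf $ 2 = 0" using hcoords2_zero_iff by blast
  then have P1: "hcoords P1_inf $ 1 \<noteq> 0" using hcoords_nonzero[of P1_inf] by (auto simp: vec_eq_iff forall_2)
  have h: "homogeneous_poly (Suc 0) (\<lambda>x :: complex ^ 2. inverse (hcoords P1_inf $ 1) * x $ 1)"
    "homogeneous_poly (Suc 0) (\<lambda>x :: complex ^ 2. x $ 2)"
    by (intro hp_cmult hp_coord)+
  show ?thesis
    by (rule P1_uniformizer[where Q = "vector [0, 1]", OF h(1) _ h(2)])
      (use P1 P2 in \<open>auto simp: vec_eq_iff forall_2 field_simps\<close>)
qed

theorem P1_smooth: "smooth_projective_curve P1"
  unfolding smooth_projective_curve_def
proof (intro conjI ballI P1_variety)
  fix p :: "2 proj_space"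
  show "\<exists>t. uniformizer P1 p t"
    using P1_uniformizer_finite[of p] P1_uniformizer_inf by (cases "p = P1_inf") blast+
qed

interpretation P1: smooth_curve P1
  by unfold_locales (rule P1_smooth)

lemma P1_not_inf_ae: "\<forall>\<^sub>F q in P1.ae. q \<noteq> P1_inf"
  using P1.eventually_ae_finite[of "{P1_inf}"] by simp

lemma P1_coord_regular: "p \<noteq> P1_inf \<Longrightarrow> regular_at P1 p P1_coord"
  unfolding regular_at_def P1_coord_def
  by (intro exI[of _ "Suc 0"] exI[of _ "\<lambda>x. x $ 1"] exI[of _ "\<lambda>x. x $ 2"])
    (simp add: hcoords2_zero_iff hp_coord)

lemma P1_coord_hasval: "p \<noteq> P1_inf \<Longrightarrow> P1.hasval p P1_coord (P1_coord p)"
  unfolding P1.hasval_def using P1_coord_regular P1.eqv_refl by blast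

lemma P1_coord_rational: "P1.rational P1_coord"
  using P1.hasval_rational[OF P1_coord_hasval[OF P1_point(1)]] by blast

lemma P1_coord_diff_nz: "P1.nz (\<lambda>q. P1_coord q - c)"
proof -
  have "\<forall>\<^sub>F q in P1.ae. P1_coord q - c \<noteq> 0"
    using P1_not_inf_ae P1.eventually_ae_finite[of "{P1_point c}", simplified]
  proof eventually_elim
    case (elim q)
    then show ?case using P1_coord_inj[OF _ P1_point(1)[of c], of q] P1_point(2)[of c] by auto
  qed
  then show ?thesis unfolding P1.nz_ae using P1_coord_rational by auto
qed

lemma P1_ord_finite:
  assumes "p \<noteq> P1_inf"
  shows "P1.ord p (\<lambda>q. P1_coord q - c) = (if P1_coord p = c then 1 else 0)"
proof (cases "P1_coord p = c")
  case True
  have P2: "hcoords p $ 2 \<noteq> 0" using assms hcoords2_zero_iff by blast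
  let ?t = "\<lambda>q. (hcoords q $ 1 - hcoords p $ 1 / hcoords p $ 2 * hcoords q $ 2) /
    (inverse (hcoords p $ 2) * hcoords q $ 2)"
  have "rat_eq P1 ?t (\<lambda>q. hcoords p $ 2 * (P1_coord q - c))"
    unfolding P1.rat_eq_ae using P1_not_inf_ae
  proof eventually_elim
    case (elim q)
    then have "hcoords q $ 2 \<noteq> 0" using hcoords2_zero_iff by blast
    then show ?case using P2 unfolding True[symmetric] P1_coord_def by (simp add: field_simps)
  qed
  from P1.ord_cong[OF this, of p] have "P1.ord p (\<lambda>q. hcoords p $ 2 * (P1_coord q - c)) = 1"
    using P1.ord_uniformizer[OF _ P1_uniformizer_finite[OF assms]] by simp
  then show ?thesis using P1.ord_mult[of p "\<lambda>_. hcoords p $ 2" "\<lambda>q. P1_coord q - c"] P2 P1_coord_diff_nz True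
    by simp
next
  case False
  have "P1.hasval p (\<lambda>q. P1_coord q - c) (P1_coord p - c)"
    by (intro P1.hasval_diff P1_coord_hasval assms P1.hasval_const)
  from P1.ord_eq_0[OF _ this] show ?thesis using False by simp
qed

text \<open>The inverse of the coordinate is a uniformizer at infinity up to a constant; subtracting
  c, of order 0 when nonzero, does not affect the simple pole.\<close>

lemma P1_ord_inf: "P1.ord P1_inf (\<lambda>q. P1_coord q - c) = -1"
proof -
  have P2: "hcoords P1_inf $ 2 = 0" using hcoords2_zero_iff by blast
  then have P1: "hcoords P1_inf $ 1 \<noteq> 0" using hcoords_nonzero[of P1_inf] by (auto simp: vec_eq_iff forall_2)
  let ?t = "\<lambda>q. hcoords q $ 2 / (inverse (hcoords P1_inf $ 1) * hcoords q $ 1)"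
  have nz: "P1.nz P1_coord" using P1_coord_diff_nz[of 0] by simp
  have "rat_eq P1 ?t (\<lambda>q. hcoords P1_inf $ 1 * inverse (P1_coord q))"
    unfolding P1.rat_eq_ae by (simp add: P1_coord_def field_simps)
  from P1.ord_cong[OF this, of P1_inf]
  have "P1.ord P1_inf (\<lambda>q. hcoords P1_inf $ 1 * inverse (P1_coord q)) = 1"
    using P1.ord_uniformizer[OF _ P1_uniformizer_inf] by simp
  then have o: "P1.ord P1_inf P1_coord = -1"
    using P1.ord_mult[of P1_inf "\<lambda>_. hcoords P1_inf $ 1", OF _ _ P1.nz_inverse[OF nz]] P1.ord_inverse[OF _ nz] P1
    by simp
  show ?thesis
  proof (cases "c = 0")
    case False
    then show ?thesis using P1.ord_add_less(2)[of P1_inf P1_coord "\<lambda>_. - c"] nz o by simp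
  qed (use o in simp)
qed

section \<open>Riemann-Roch spaces\<close>

text \<open>Gaussian elimination: a pivot \<open>j0\<close> in equation \<open>i0\<close> removes
  one equation and one unknown, so the excess of unknowns persists.\<close>

lemma underdetermined_system:
  fixes a :: "'j \<Rightarrow> 'i \<Rightarrow> complex"
  assumes "finite I" "finite J" "card I < card J"
  shows "\<exists>c. (\<exists>j\<in>J. c j \<noteq> 0) \<and> (\<forall>i\<in>I. (\<Sum>j\<in>J. c j * a j i) = 0)"
  using assms
proof (induction I arbitrary: J a rule: finite_induct)
  case empty
  then obtain j where "j \<in> J" by fastforce
  then show ?case by (intro exI[of _ "\<lambda>_. 1"]) auto
next
  case (insert i0 I)
  show ?case
  proof (cases "\<forall>j\<in>J. a j i0 = 0")
    case True
    have "card I < card J" using insert by simp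
    then obtain c where c: "\<exists>j\<in>J. c j \<noteq> 0" "\<forall>i\<in>I. (\<Sum>j\<in>J. c j * a j i) = 0"
      using insert.IH[OF insert.prems(1), of a] by blast
    then show ?thesis using True by (intro exI[of _ c]) auto
  next
    case False
    then obtain j0 where j0: "j0 \<in> J" "a j0 i0 \<noteq> 0" by blast
    define J' where "J' = J - {j0}"
    have J': "finite J'" "card I < card J'" "J = insert j0 J'" "j0 \<notin> J'"
      using insert j0 by (auto simp: J'_def)
    obtain c where c: "\<exists>j\<in>J'. c j \<noteq> 0"
      "\<forall>i\<in>I. (\<Sum>j\<in>J'. c j * (a j i - a j i0 / a j0 i0 * a j0 i)) = 0"
      using insert.IH[OF J'(1,2), of "\<lambda>j i. a j i - a j i0 / a j0 i0 * a j0 i"] by blast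
    define s where "s = (\<Sum>j\<in>J'. c j * a j i0)"
    \<comment> \<open>Back substitution: the coefficient at the pivot is forced by equation
      \<open>i0\<close>, where s is the contribution of the other unknowns.\<close>
    define c' where "c' = (\<lambda>j. if j = j0 then - s / a j0 i0 else c j)"
    have sum: "(\<Sum>j\<in>J. c' j * a j i) = - s / a j0 i0 * a j0 i + (\<Sum>j\<in>J'. c j * a j i)" for i
    proof -
      have "(\<Sum>j\<in>J'. c' j * a j i) = (\<Sum>j\<in>J'. c j * a j i)"
        using J'(4) by (intro sum.cong) (auto simp: c'_def)
      then show ?thesis using J' by (simp add: c'_def)
    qed
    have "(\<Sum>j\<in>J. c' j * a j i) = 0" if "i \<in> I" for i
    proof -
      have "0 = (\<Sum>j\<in>J'. c j * a j i - (c j * a j i0) * (a j0 i / a j0 i0))"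
        using c(2) that by (simp add: algebra_simps)
      also have "\<dots> = (\<Sum>j\<in>J'. c j * a j i) - s * (a j0 i / a j0 i0)"
        by (simp add: sum_subtractf s_def sum_distrib_right sum_divide_distrib)
      finally show ?thesis unfolding sum by simp
    qed
    moreover have "(\<Sum>j\<in>J. c' j * a j i0) = 0" unfolding sum using j0 by (simp add: s_def)
    moreover have "\<exists>j\<in>J. c' j \<noteq> 0" using c(1) J'(3,4) by (auto simp: c'_def)
    ultimately show ?thesis by (intro exI[of _ c']) auto
  qed
qed

lemma divisor_degree_eq:
  assumes "finite A" "{p. D p \<noteq> 0} \<subseteq> A"
  shows "divisor_degree D = (\<Sum>p\<in>A. D p)"
  unfolding divisor_degree_def using assms by (intro sum.mono_neutral_left) auto

lemma divisor_degree_add: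
  assumes "D \<in> divisors X" "D' \<in> divisors X"
  shows "divisor_degree (\<lambda>p. D p + D' p) = divisor_degree D + divisor_degree D'"
proof -
  let ?A = "{p. D p \<noteq> 0} \<union> {p. D' p \<noteq> 0}"
  have fin: "finite ?A" using assms by (auto simp: divisors_def)
  have "divisor_degree (\<lambda>p. D p + D' p) = (\<Sum>p\<in>?A. D p + D' p)"
    by (rule divisor_degree_eq[OF fin]) auto
  moreover have "divisor_degree D = (\<Sum>p\<in>?A. D p)" "divisor_degree D' = (\<Sum>p\<in>?A. D' p)"
    by (rule divisor_degree_eq[OF fin], blast)+
  ultimately show ?thesis by (simp add: sum.distrib)
qed

lemma divisors_add: "D \<in> divisors X \<Longrightarrow> D' \<in> divisors X \<Longrightarrow> (\<lambda>p. D p + D' p) \<in> divisors X"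
proof -
  assume *: "D \<in> divisors X" "D' \<in> divisors X"
  have "{p. D p + D' p \<noteq> 0} \<subseteq> {p. D p \<noteq> 0} \<union> {p. D' p \<noteq> 0}" by auto
  then show ?thesis using * unfolding divisors_def by (auto intro: finite_subset)
qed

section \<open>Linear algebra over C in the function field\<close>

context smooth_curve
begin

definition indep :: "'i set \<Rightarrow> ('i \<Rightarrow> 'n proj_space \<Rightarrow> complex) \<Rightarrow> bool" where
  "indep I b \<longleftrightarrow> (\<forall>c. (\<lambda>p. \<Sum>i\<in>I. c i * b i p) \<doteq> (\<lambda>_. 0) \<longrightarrow> (\<forall>i\<in>I. c i = 0))"

text \<open>An upper bound for the dimension that requires no basis. Index sets are fixed to natural
  numbers because a definition cannot quantify over types; \<open>dimleD\<close> transfers the bound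
  to families indexed by any type.\<close>

definition dimle :: "('n proj_space \<Rightarrow> complex) set \<Rightarrow> nat \<Rightarrow> bool" where
  "dimle V m \<longleftrightarrow> (\<forall>(I :: nat set) b. finite I \<longrightarrow> indep I b \<longrightarrow> (\<forall>i\<in>I. b i \<in> V) \<longrightarrow> card I \<le> m)"

lemma indepD: "indep I b \<Longrightarrow> (\<lambda>p. \<Sum>i\<in>I. c i * b i p) \<doteq> (\<lambda>_. 0) \<Longrightarrow> i \<in> I \<Longrightarrow> c i = 0"
  unfolding indep_def by blast

lemma eqv_sum:
  "finite I \<Longrightarrow> (\<And>i. i \<in> I \<Longrightarrow> f i \<doteq> g i) \<Longrightarrow> (\<lambda>p. \<Sum>i\<in>I. f i p) \<doteq> (\<lambda>p. \<Sum>i\<in>I. g i p)"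
proof (induction I rule: finite_induct)
  case (insert i I)
  have "(\<lambda>p. f i p + (\<Sum>i\<in>I. f i p)) \<doteq> (\<lambda>p. g i p + (\<Sum>i\<in>I. g i p))"
    using insert by (intro eqv_add) auto
  then show ?case using insert by simp
qed simp

lemma eqv_cmult: "f \<doteq> g \<Longrightarrow> (\<lambda>q. c * f q) \<doteq> (\<lambda>q. c * g q)"
  by (rule eqv_mult[OF eqv_refl[of "\<lambda>_. c"]])

text \<open>With more independent vectors than spanning ones, the coordinate matrix has a nontrivial
  kernel, which is a linear relation.\<close>

lemma card_indep_le_span:
  assumes I: "finite I" and J: "finite J" and ind: "indep J b'"
    and span: "\<And>j. j \<in> J \<Longrightarrow> b' j \<doteq> (\<lambda>p. \<Sum>i\<in>I. a j i * b i p)"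
  shows "card J \<le> card I"
proof (rule ccontr)
  assume "\<not> ?thesis"
  then obtain c where c: "\<exists>j\<in>J. c j \<noteq> 0" "\<forall>i\<in>I. (\<Sum>j\<in>J. c j * a j i) = 0"
    using underdetermined_system[OF I J, of a] by auto
  have "(\<lambda>p. \<Sum>j\<in>J. c j * b' j p) \<doteq> (\<lambda>p. \<Sum>j\<in>J. c j * (\<Sum>i\<in>I. a j i * b i p))"
    by (intro eqv_sum[OF J] eqv_cmult span)
  also have "(\<lambda>p. \<Sum>j\<in>J. c j * (\<Sum>i\<in>I. a j i * b i p)) = (\<lambda>p. \<Sum>i\<in>I. (\<Sum>j\<in>J. c j * a j i) * b i p)"
  proof
    fix p
    have "(\<Sum>j\<in>J. c j * (\<Sum>i\<in>I. a j i * b i p)) = (\<Sum>j\<in>J. \<Sum>i\<in>I. c j * a j i * b i p)"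
      by (simp add: sum_distrib_left mult.assoc)
    also have "\<dots> = (\<Sum>i\<in>I. \<Sum>j\<in>J. c j * a j i * b i p)" by (rule sum.swap)
    finally show "(\<Sum>j\<in>J. c j * (\<Sum>i\<in>I. a j i * b i p)) = (\<Sum>i\<in>I. (\<Sum>j\<in>J. c j * a j i) * b i p)"
      by (simp add: sum_distrib_right)
  qed
  also have "\<dots> = (\<lambda>_. 0)" using c(2) by simp
  finally show False using indepD[OF ind] c(1) by blast
qed

lemma dimleD:
  assumes "dimle V m" "finite J" "indep J b" "\<And>j. j \<in> J \<Longrightarrow> b j \<in> V"
  shows "card J \<le> m"
proof -
  obtain h where h: "bij_betw h {..<card J} J"
    using ex_bij_betw_nat_finite[OF assms(2)] by (auto simp: atLeast0LessThan)
  have "indep {..<card J} (\<lambda>i. b (h i))" unfolding indep_def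
  proof (intro allI impI ballI)
    fix c i assume c: "(\<lambda>p. \<Sum>i<card J. c i * b (h i) p) \<doteq> (\<lambda>_. 0)" and i: "i \<in> {..<card J}"
    let ?g = "inv_into {..<card J} h"
    have g: "?g (h i) = i" if "i < card J" for i
      using h that by (intro inv_into_f_f) (auto simp: bij_betw_def)
    have "(\<Sum>j\<in>J. c (?g j) * b j p) = (\<Sum>i<card J. c i * b (h i) p)" for p
      using sum.reindex_bij_betw[OF h, of "\<lambda>j. c (?g j) * b j p"] g by simp
    then have "(\<lambda>p. \<Sum>j\<in>J. c (?g j) * b j p) \<doteq> (\<lambda>_. 0)" using c by simp
    from indepD[OF assms(3) this, of "h i"] show "c i = 0"
      using h i g by (auto simp: bij_betw_def)
  qed
  moreover have "\<forall>i\<in>{..<card J}. b (h i) \<in> V" using assms(4) h by (auto simp: bij_betw_def)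
  ultimately show ?thesis using assms(1) unfolding dimle_def by (metis (no_types, lifting) card_lessThan finite_lessThan)
qed

lemma dimle_dependent:
  assumes "dimle V m" "finite J" "\<And>j. j \<in> J \<Longrightarrow> b j \<in> V" "m < card J"
  shows "\<exists>c. (\<exists>j\<in>J. c j \<noteq> 0) \<and> (\<lambda>p. \<Sum>j\<in>J. c j * b j p) \<doteq> (\<lambda>_. 0)"
  using dimleD[OF assms(1,2) _ assms(3)] assms(4) unfolding indep_def by fastforce

section \<open>The spaces L(D), their dimensions and the genus\<close>

abbreviation L :: "('n proj_space \<Rightarrow> int) \<Rightarrow> ('n proj_space \<Rightarrow> complex) set" where
  "L D \<equiv> rr_space X D"

lemma L_iff: "f \<in> L D \<longleftrightarrow> rational f \<and> (nz f \<longrightarrow> (\<forall>p\<in>X. ord p f + D p \<ge> 0))"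
  unfolding rr_space_def nz_def by blast

lemma L_I: "rational f \<Longrightarrow> (\<And>p. nz f \<Longrightarrow> p \<in> X \<Longrightarrow> - D p \<le> ord p f) \<Longrightarrow> f \<in> L D"
  unfolding L_iff by (metis add.commute diff_ge_0_iff_ge diff_minus_eq_add)

lemma L_rational: "f \<in> L D \<Longrightarrow> rational f"
  unfolding L_iff by (elim conjE)

lemma L_ord: assumes "f \<in> L D" "nz f" "p \<in> X" shows "- D p \<le> ord p f"
proof -
  have "0 \<le> ord p f + D p" using assms unfolding L_iff by simp
  then show ?thesis by simp
qed

lemma L_zero [simp]: "(\<lambda>_. 0) \<in> L D" by (simp add: L_iff)

lemma L_cmult: assumes "f \<in> L D" shows "(\<lambda>q. c * f q) \<in> L D"
proof (cases "c = 0")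
  case False
  show ?thesis
  proof (rule L_I)
    show "rational (\<lambda>q. c * f q)" by (rule rational_mult[OF rational_const L_rational[OF assms]])
    fix p assume h: "nz (\<lambda>q. c * f q)" and p: "p \<in> X"
    have "nz (\<lambda>q. inverse c * (c * f q))" by (rule nz_mult[OF _ h]) (use False in simp)
    then have "nz f" using False by (simp add: mult.assoc[symmetric])
    moreover have "ord p (\<lambda>q. c * f q) = ord p f"
      using ord_mult[OF p _ calculation, of "\<lambda>_. c"] False p by simp
    ultimately show "- D p \<le> ord p (\<lambda>q. c * f q)" using L_ord[OF assms _ p] by simp
  qed
qed simp

lemma L_add: assumes "f \<in> L D" "g \<in> L D" shows "(\<lambda>q. f q + g q) \<in> L D"
proof (rule L_I)
  note r = L_rational[OF assms(1)] L_rational[OF assms(2)]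
  show "rational (\<lambda>q. f q + g q)" by (rule rational_add[OF r])
  fix p assume n: "nz (\<lambda>q. f q + g q)" and p: "p \<in> X"
  consider "f \<doteq> (\<lambda>_. 0)" | "g \<doteq> (\<lambda>_. 0)" | "nz f" "nz g" using nz_cases r by blast
  then show "- D p \<le> ord p (\<lambda>q. f q + g q)"
  proof cases
    case 1
    then have e: "(\<lambda>q. f q + g q) \<doteq> g" unfolding rat_eq_ae by eventually_elim simp
    show ?thesis using L_ord[OF assms(2) nz_cong[OF n e] p] ord_cong[OF e, of p] by simp
  next
    case 2
    then have e: "(\<lambda>q. f q + g q) \<doteq> f" unfolding rat_eq_ae by eventually_elim simp
    show ?thesis using L_ord[OF assms(1) nz_cong[OF n e] p] ord_cong[OF e, of p] by simp
  next
    case 3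
    show ?thesis by (rule ord_add_ge[OF p 3 n L_ord[OF assms(1) 3(1) p] L_ord[OF assms(2) 3(2) p]])
  qed
qed

text \<open>The value at p of \<open>f * t powi (D p + 1)\<close> is a linear functional on the
  larger space, and its kernel lies in \<open>L D\<close>. Hence the dimension grows by at most
  one.\<close>

lemma dimle_add_point:
  assumes D: "dimle (L D) m" and p: "p \<in> X"
  shows "dimle (L (D(p := D p + 1))) (m + 1)"
  unfolding dimle_def
proof (intro allI impI)
  let ?D' = "D(p := D p + 1)"
  fix I :: "nat set" and b
  assume I: "finite I" and b: "indep I b" "\<forall>i\<in>I. b i \<in> L ?D'"
  obtain t where t: "uniformizer X p t" using uniformizer_exists[OF p] by blast
  let ?s = "\<lambda>q. t q powi (D p + 1)"
  have s: "nz ?s" "ord p ?s = D p + 1"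
    using uniformizer_nz[OF t p] ord_powi[OF p uniformizer_nz[OF t p]] ord_uniformizer[OF p t] by auto
  have val: "\<exists>v. hasval p (\<lambda>q. f q * ?s q) v" if f: "f \<in> L ?D'" for f
  proof (cases "nz f")
    case True
    have "ord p f + (D p + 1) \<ge> 0" using L_ord[OF f True p] by simp
    then have "ord p (\<lambda>q. f q * ?s q) \<ge> 0" using ord_mult[OF p True s(1)] s(2) by simp
    then show ?thesis using ord_hasval(1)[OF p nz_mult[OF True s(1)]] by blast
  next
    case False
    then have "f \<doteq> (\<lambda>_. 0)" using nz_cases[OF L_rational[OF f]] by blast
    then have "(\<lambda>_. 0) \<doteq> (\<lambda>q. f q * ?s q)" unfolding rat_eq_ae by eventually_elim simp
    then show ?thesis using hasval_cong[OF hasval_const] by blast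
  qed
  have smaller: "f \<in> L D" if f: "f \<in> L ?D'" and v: "hasval p (\<lambda>q. f q * ?s q) 0" for f
  proof (rule L_I[OF L_rational[OF f]])
    fix r assume n: "nz f" and r: "r \<in> X"
    show "- D r \<le> ord r f"
    proof (cases "r = p")
      case True
      have "ord p (\<lambda>q. f q * ?s q) > 0" using ord_hasval(2)[OF p nz_mult[OF n s(1)]] v by blast
      then show ?thesis using True ord_mult[OF p n s(1)] s(2) by simp
    next
      case False
      then show ?thesis using L_ord[OF f n r] by simp
    qed
  qed
  have "\<forall>i\<in>I. \<exists>v. hasval p (\<lambda>q. b i q * ?s q) v" using val b(2) by blast
  from bchoice[OF this] obtain v where v: "\<And>i. i \<in> I \<Longrightarrow> hasval p (\<lambda>q. b i q * ?s q) (v i)"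
    by blast
  show "card I \<le> m + 1"
  proof (cases "\<forall>i\<in>I. v i = 0")
    case True
    have "b i \<in> L D" if "i \<in> I" for i using smaller[of "b i"] b(2) that v[OF that] True by simp
    then show ?thesis using dimleD[OF D I b(1)] by fastforce
  next
    case False
    then obtain j where j: "j \<in> I" "v j \<noteq> 0" by blast
    \<comment> \<open>A multiple of \<open>b j\<close>, on which the functional is nonzero, is
      subtracted to move the other vectors into the kernel.\<close>
    define b' where "b' = (\<lambda>i q. b i q + (- (v i / v j)) * b j q)"
    have mem: "b' i \<in> L D" if "i \<in> I - {j}" for i
    proof (rule smaller)
      show "b' i \<in> L ?D'" unfolding b'_def using b(2) that j by (intro L_add L_cmult) auto
      have "hasval p (\<lambda>q. b i q * ?s q + (- (v i / v j)) * (b j q * ?s q)) (v i + (- (v i / v j)) * v j)"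
        using that j by (intro hasval_add hasval_mult hasval_const v) auto
      then show "hasval p (\<lambda>q. b' i q * ?s q) 0" using j(2) by (simp add: b'_def algebra_simps)
    qed
    have "indep (I - {j}) b'" unfolding indep_def
    proof (intro allI impI ballI)
      fix c i assume c: "(\<lambda>q. \<Sum>i\<in>I - {j}. c i * b' i q) \<doteq> (\<lambda>_. 0)" and i: "i \<in> I - {j}"
      \<comment> \<open>A relation among the modified vectors is one among the original vectors; the
        coefficient of \<open>b j\<close> collects everything that was subtracted.\<close>
      define c' where "c' = (\<lambda>i. if i = j then \<Sum>i\<in>I - {j}. c i * (- (v i / v j)) else c i)"
      have "(\<Sum>i\<in>I. c' i * b i q) = (\<Sum>i\<in>I - {j}. c i * b' i q)" for q
      proof -
        have "(\<Sum>i\<in>I. c' i * b i q) = c' j * b j q + (\<Sum>i\<in>I - {j}. c' i * b i q)"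
          by (rule sum.remove[OF I j(1)])
        also have "(\<Sum>i\<in>I - {j}. c' i * b i q) = (\<Sum>i\<in>I - {j}. c i * b i q)"
          by (intro sum.cong) (auto simp: c'_def)
        also have "c' j * b j q = (\<Sum>i\<in>I - {j}. c i * (- (v i / v j)) * b j q)"
          by (simp add: c'_def sum_distrib_right)
        finally show ?thesis by (simp add: b'_def algebra_simps sum.distrib sum_subtractf sum_negf)
      qed
      then have "(\<lambda>q. \<Sum>i\<in>I. c' i * b i q) \<doteq> (\<lambda>_. 0)" using c by simp
      from indepD[OF b(1) this, of i] show "c i = 0" using i by (auto simp: c'_def)
    qed
    from dimleD[OF D _ this] have "card (I - {j}) \<le> m" using I mem by blast
    then show ?thesis using j(1) I by simp
  qed
qed

text \<open>Points are added one at a time; k counts them with multiplicity.\<close>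

lemma dimle_mono:
  assumes D: "dimle (L D) m" and A: "finite A" "A \<subseteq> X"
  shows "(\<And>p. D p \<le> D' p) \<Longrightarrow> (\<And>p. p \<notin> A \<Longrightarrow> D' p = D p) \<Longrightarrow> (\<Sum>p\<in>A. D' p - D p) = int k \<Longrightarrow>
    dimle (L D') (m + k)"
proof (induction k arbitrary: D')
  case 0
  have "D' p = D p" for p
  proof (cases "p \<in> A")
    case True
    have "\<forall>p\<in>A. D' p - D p = 0" using 0 A(1) by (subst sum_nonneg_eq_0_iff[symmetric]) auto
    then show ?thesis using True by simp
  qed (use 0 in simp)
  then have "D' = D" by blast
  then show ?case using D by simp
next
  case (Suc k)
  have "\<exists>p\<in>A. D' p - D p \<noteq> 0"
  proof (rule ccontr)
    assume "\<not> ?thesis"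
    then have "(\<Sum>p\<in>A. D' p - D p) = 0" by (intro sum.neutral) auto
    then show False using Suc.prems(3) by simp
  qed
  then obtain p where p: "p \<in> A" "D p < D' p" using Suc.prems(1) by (metis eq_iff_diff_eq_0 order_le_less)
  define D'' where "D'' = D'(p := D' p - 1)"
  have "dimle (L D'') (m + k)"
  proof (rule Suc.IH)
    show "D q \<le> D'' q" for q using Suc.prems(1)[of q] p by (simp add: D''_def)
    show "q \<notin> A \<Longrightarrow> D'' q = D q" for q using Suc.prems(2) p by (auto simp: D''_def)
    have "(\<Sum>q\<in>A. D'' q - D q) = (\<Sum>q\<in>A. (D' q - D q) - (if q = p then 1 else 0))"
      by (intro sum.cong) (auto simp: D''_def)
    then show "(\<Sum>q\<in>A. D'' q - D q) = int k"
      using Suc.prems(3) p(1) A(1) by (simp add: sum_subtractf)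
  qed
  from dimle_add_point[OF this, of p] have "dimle (L (D''(p := D'' p + 1))) (m + k + 1)"
    using p(1) A(2) by blast
  moreover have "D''(p := D'' p + 1) = D'" by (auto simp: D''_def)
  ultimately show ?case by simp
qed

text \<open>Independence is uniqueness of the coordinates of the zero function. Restriction to
  \<open>{..<l}\<close> makes the coefficient families extensional, as that uniqueness
  requires.\<close>

lemma rr_dim_indep:
  assumes "rr_dim X D l"
  shows "\<exists>b. indep {..<l} b \<and> (\<forall>i<l. b i \<in> L D)"
proof -
  obtain b where b: "\<forall>i<l. b i \<in> L D"
     "\<forall>f\<in>L D. \<exists>!c :: nat \<Rightarrow> complex. c \<in> {..<l} \<rightarrow>\<^sub>E UNIV \<and> f \<doteq> (\<lambda>p. \<Sum>i<l. c i * b i p)"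
    using assms unfolding rr_dim_def by blast
  have "indep {..<l} b" unfolding indep_def
  proof (intro allI impI ballI)
    fix c i assume c: "(\<lambda>p. \<Sum>i<l. c i * b i p) \<doteq> (\<lambda>_. 0)" and i: "i \<in> {..<l}"
    define P where "P = (\<lambda>c :: nat \<Rightarrow> complex. c \<in> {..<l} \<rightarrow>\<^sub>E UNIV \<and> (\<lambda>_. 0) \<doteq> (\<lambda>p. \<Sum>i<l. c i * b i p))"
    have u: "\<exists>!c. P c" unfolding P_def by (rule bspec[OF b(2) L_zero])
    have "(\<lambda>p. \<Sum>i<l. restrict c {..<l} i * b i p) = (\<lambda>p. \<Sum>i<l. c i * b i p)"
      by (intro ext sum.cong) auto
    then have "P (restrict c {..<l})" unfolding P_def using eqv_sym[OF c] by simp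
    moreover have "(\<lambda>p. \<Sum>i<l. restrict (\<lambda>_. 0) {..<l} i * b i p) = (\<lambda>_. 0)"
      by (intro ext sum.neutral) auto
    then have "P (restrict (\<lambda>_. 0) {..<l})" unfolding P_def by simp
    ultimately have "restrict c {..<l} = restrict (\<lambda>_. 0) {..<l}" using u by blast
    then have "restrict c {..<l} i = restrict (\<lambda>_. 0) {..<l} i" by simp
    then show "c i = 0" using i by simp
  qed
  then show ?thesis using b(1) by blast
qed

lemma rr_dim_dimle:
  assumes "rr_dim X D l" shows "dimle (L D) l"
  unfolding dimle_def
proof (intro allI impI)
  fix J :: "nat set" and b' assume J: "finite J" "indep J b'" "\<forall>j\<in>J. b' j \<in> L D"
  obtain b where b: "\<forall>f\<in>L D. \<exists>!c :: nat \<Rightarrow> complex. c \<in> {..<l} \<rightarrow>\<^sub>E UNIV \<and> f \<doteq> (\<lambda>p. \<Sum>i<l. c i * b i p)"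
    using assms unfolding rr_dim_def by blast
  have "\<exists>c :: nat \<Rightarrow> complex. b' j \<doteq> (\<lambda>p. \<Sum>i<l. c i * b i p)" if "j \<in> J" for j
    using bspec[OF b bspec[OF J(3) that]] by blast
  then have "\<forall>j\<in>J. \<exists>c :: nat \<Rightarrow> complex. b' j \<doteq> (\<lambda>p. \<Sum>i<l. c i * b i p)" by blast
  from bchoice[OF this] obtain a :: "nat \<Rightarrow> nat \<Rightarrow> complex" where a: "\<And>j. j \<in> J \<Longrightarrow> b' j \<doteq> (\<lambda>p. \<Sum>i<l. a j i * b i p)"
    by blast
  from card_indep_le_span[OF finite_lessThan J(1,2) a] show "card J \<le> l" by simp
qed

text \<open>Riemann's inequality, in the form of an explicit independent family in
  \<open>L D\<close>.\<close>

lemma genus_lower: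
  assumes "has_genus X g" "D \<in> divisors X"
  obtains l b where "indep {..<l} b" "\<And>i. i < l \<Longrightarrow> b i \<in> L D" "divisor_degree D + 1 - int g \<le> int l"
proof -
  obtain l where l: "rr_dim X D l" "divisor_degree D - int l + 1 \<le> int g"
    using assms unfolding has_genus_def by blast
  obtain b where "indep {..<l} b" "\<forall>i<l. b i \<in> L D" using rr_dim_indep[OF l(1)] by blast
  then show ?thesis using that l(2) by fastforce
qed

text \<open>\<open>D0\<close> attains the maximum that defines the genus. From \<open>D0\<close> to
  a larger D the dimension grows at most as fast as the degree, which bounds it by the value in
  Riemann's inequality.\<close>

lemma genus_upper:
  assumes "has_genus X g"
  obtains D0 where "D0 \<in> divisors X"
    "\<And>D. D \<in> divisors X \<Longrightarrow> (\<And>p. D0 p \<le> D p) \<Longrightarrow> \<exists>m. dimle (L D) m \<and> int m = divisor_degree D + 1 - int g"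
proof -
  obtain D0 l where D0: "D0 \<in> divisors X" "rr_dim X D0 l" "divisor_degree D0 - int l + 1 = int g"
    using assms unfolding has_genus_def by blast
  have "\<exists>m. dimle (L D) m \<and> int m = divisor_degree D + 1 - int g"
    if D: "D \<in> divisors X" "\<And>p. D0 p \<le> D p" for D
  proof -
    define A where "A = {p. D0 p \<noteq> 0} \<union> {p. D p \<noteq> 0}"
    have A: "finite A" "A \<subseteq> X" using D0(1) D(1) unfolding A_def divisors_def by auto
    have "divisor_degree D0 = (\<Sum>p\<in>A. D0 p)"
      by (rule divisor_degree_eq[OF A(1)]) (simp add: A_def)
    moreover have "divisor_degree D = (\<Sum>p\<in>A. D p)"
      by (rule divisor_degree_eq[OF A(1)]) (simp add: A_def)
    ultimately have s: "(\<Sum>p\<in>A. D p - D0 p) = divisor_degree D - divisor_degree D0" by (simp add: sum_subtractf)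
    have "0 \<le> (\<Sum>p\<in>A. D p - D0 p)" using D(2) by (intro sum_nonneg) auto
    then obtain k where k: "(\<Sum>p\<in>A. D p - D0 p) = int k" using nonneg_int_cases by blast
    have "dimle (L D) (l + k)"
      by (rule dimle_mono[OF rr_dim_dimle[OF D0(2)] A D(2) _ k]) (auto simp: A_def)
    then show ?thesis using s k D0(3) by (intro exI[of _ "l + k"]) auto
  qed
  then show ?thesis by (rule that[OF D0(1)])
qed

lemma genus_finite_dim:
  assumes "has_genus X g" "D \<in> divisors X"
  obtains m where "dimle (L D) m"
proof -
  obtain l where "rr_dim X D l" using assms unfolding has_genus_def by blast
  then show ?thesis using rr_dim_dimle that by blast
qed

end

section \<open>Complex polynomials\<close>

text \<open>By the fundamental theorem of algebra, a nonconstant polynomial has a linear factor to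
  split off.\<close>

lemma complex_poly_linear_induct [consumes 1, case_names const linear]:
  fixes A :: "complex poly"
  assumes "A \<noteq> 0" and const: "\<And>c. c \<noteq> 0 \<Longrightarrow> P [:c:]"
    and linear: "\<And>a A. A \<noteq> 0 \<Longrightarrow> P A \<Longrightarrow> P ([:-a, 1:] * A)"
  shows "P A"
  using assms(1)
proof (induction "degree A" arbitrary: A rule: less_induct)
  case less
  show ?case
  proof (cases "degree A = 0")
    case True
    then obtain c where "A = [:c:]" by (rule degree_eq_zeroE)
    then show ?thesis using const less.prems by simp
  next
    case False
    then obtain a where "poly A a = 0"
      using fundamental_theorem_of_algebra constant_degree by metis
    then obtain B where B: "A = [:-a, 1:] * B" using poly_eq_0_iff_dvd by blast
    then have B0: "B \<noteq> 0" using less.prems by auto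
    have "degree A = Suc (degree B)" unfolding B using B0 by (subst degree_mult_eq) auto
    then show ?thesis using linear[OF B0 less.hyps] B B0 by simp
  qed
qed

lemma order_linear: "order c [:-a, 1 :: complex:] = (if c = a then 1 else 0)"
  using order_power_n_n[of a 1] by (auto intro: order_0I)

lemma complex_poly_dvdI:
  fixes A C :: "complex poly"
  assumes "C \<noteq> 0" "A \<noteq> 0" "\<And>c. order c C \<le> order c A"
  shows "C dvd A"
  using assms
proof (induction C arbitrary: A rule: complex_poly_linear_induct)
  case (const c)
  then show ?case by (simp add: is_unit_pCons_iff unit_imp_dvd)
next
  case (linear a C)
  have CC: "[:-a, 1:] * C \<noteq> 0" using linear.hyps by (metis mult_eq_0_iff pCons_eq_0_iff zero_neq_one)
  have o: "order c ([:-a, 1:] * C) = order c [:-a, 1:] + order c C" for c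
    by (rule order_mult[OF CC])
  have "1 \<le> order a A" using linear.prems(2)[of a] o[of a] by (simp add: order_linear)
  then have "[:-a, 1:] ^ 1 dvd A" unfolding order_divides by blast
  then obtain B where B: "A = [:-a, 1:] * B" by (auto elim: dvdE)
  have B0: "B \<noteq> 0" using B linear.prems(1) by auto
  have "order c C \<le> order c B" for c
    using linear.prems(2)[of c] o[of c] order_mult[of "[:-a, 1:]" B c] linear.prems(1) unfolding B by simp
  then show ?case unfolding B using linear.IH[OF B0] by (intro mult_dvd_mono) auto
qed

text \<open>As long as some root has order at least 2, the square of its linear factor is moved into
  q.\<close>

lemma complex_poly_squarefree_part:
  fixes A :: "complex poly"
  assumes "A \<noteq> 0"
  shows "\<exists>q f. q \<noteq> 0 \<and> A = q ^ 2 * f \<and> rsquarefree f"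
  using assms
proof (induction "degree A" arbitrary: A rule: less_induct)
  case less
  show ?case
  proof (cases "rsquarefree A")
    case True
    then show ?thesis by (intro exI[of _ 1] exI[of _ A]) auto
  next
    case False
    then obtain a where "order a A \<noteq> 0" "order a A \<noteq> 1"
      unfolding rsquarefree_def using less.prems by blast
    then have "2 \<le> order a A" by simp
    then have "[:-a, 1:] ^ 2 dvd A" unfolding order_divides by blast
    then obtain B where B: "A = [:-a, 1:] ^ 2 * B" by (auto elim: dvdE)
    have B0: "B \<noteq> 0" using B less.prems by auto
    have "degree A = 2 + degree B" unfolding B using B0
      by (subst degree_mult_eq) (auto simp: degree_power_eq)
    then obtain q f where qf: "q \<noteq> 0" "B = q ^ 2 * f" "rsquarefree f" using less.hyps[of B] B0 by auto
    have "[:-a, 1:] * q \<noteq> 0" using qf(1) by (metis mult_eq_0_iff pCons_eq_0_iff zero_neq_one)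
    moreover have "A = ([:-a, 1:] * q) ^ 2 * f" unfolding B qf(2) by (simp only: power_mult_distrib mult.assoc)
    ultimately show ?thesis using qf(3) by blast
  qed
qed

lemma card_roots_rsquarefree:
  fixes f :: "complex poly"
  assumes "rsquarefree f"
  shows "card {z. poly f z = 0} = degree f"
proof -
  have f0: "f \<noteq> 0" using assms unfolding rsquarefree_def by blast
  have "degree f = degree (smult (lead_coeff f) (\<Prod>z|poly f z = 0. [:-z, 1:]))"
    using complex_poly_decompose_rsquarefree[OF assms] by simp
  also have "\<dots> = degree (\<Prod>z|poly f z = 0. [:-z, 1:])" using f0 by simp
  also have "\<dots> = (\<Sum>z|poly f z = 0. degree [:-z, 1:])" by (rule degree_prod_sum_eq) auto
  finally show ?thesis by simp
qed

section \<open>Double covers of the projective line\<close>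

locale double_cover = curve_covering X P1 \<pi> 2
  for X :: "'n::finite proj_space set" and \<pi> :: "'n proj_space \<Rightarrow> 2 proj_space" +
  fixes g :: nat and s :: "'n proj_space \<Rightarrow> 'n proj_space"
  assumes genus: "has_genus X g"
    and s_in: "p \<in> X \<Longrightarrow> s p \<in> X"
    and quot: "p \<in> X \<Longrightarrow> q \<in> X \<Longrightarrow> \<pi> p = \<pi> q \<longleftrightarrow> q = p \<or> q = s p"
begin

lemma pi_s: "p \<in> X \<Longrightarrow> \<pi> (s p) = \<pi> p"
  using quot[of p "s p"] s_in by simp

lemma s_s: "p \<in> X \<Longrightarrow> s (s p) = p"
  using quot[of "s p" p] s_in pi_s by fastforce

lemma fiber_eq: "p \<in> X \<Longrightarrow> fiber X \<pi> (\<pi> p) = {p, s p}"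
proof (intro set_eqI iffI)
  fix q assume p: "p \<in> X" and "q \<in> fiber X \<pi> (\<pi> p)"
  then have "q \<in> X" "\<pi> p = \<pi> q" by (auto simp: fiber_def)
  then show "q \<in> {p, s p}" using quot[OF p, of q] by blast
next
  fix q assume "p \<in> X" "q \<in> {p, s p}"
  then show "q \<in> fiber X \<pi> (\<pi> p)" using s_in[of p] pi_s[of p] by (auto simp: fiber_def)
qed

text \<open>The indices in a fiber are positive and add up to 2, so they are 1 + 1 or a single
  2.\<close>

lemma ram_eq_fixed: assumes p: "p \<in> X" shows "ram p = (if s p = p then 2 else 1)"
proof -
  have sum: "(\<Sum>q\<in>{p, s p}. ram q) = 2" using sum_fiber[of "\<pi> p"] fiber_eq[OF p] by simp
  show ?thesis
  proof (cases "s p = p")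
    case False
    then have "ram p + ram (s p) = 2" using sum by simp
    then show ?thesis using False ram_pos[OF p] ram_pos[OF s_in[OF p]] by simp
  qed (use sum in simp)
qed

section \<open>The base coordinate and the subfield C(x)\<close>

definition x :: "'n proj_space \<Rightarrow> complex" where "x p = P1_coord (\<pi> p)"

definition fin :: "'n proj_space \<Rightarrow> bool" where "fin p \<longleftrightarrow> \<pi> p \<noteq> P1_inf"

lemma x_s: "p \<in> X \<Longrightarrow> x (s p) = x p" by (simp add: x_def pi_s)

lemma x_eq_pi: "fin p \<Longrightarrow> fin q \<Longrightarrow> x p = x q \<Longrightarrow> \<pi> p = \<pi> q"
  unfolding x_def fin_def by (rule P1_coord_inj)

lemma ex_x: obtains p where "p \<in> X" "fin p" "x p = c"
proof -
  obtain p where "p \<in> X" "\<pi> p = P1_point c" using surj[of "P1_point c"] by blast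
  then show ?thesis using that[of p] P1_point[of c] by (simp add: x_def fin_def)
qed

lemma ex_inf: obtains p where "p \<in> X" "\<not> fin p"
proof -
  obtain p where "p \<in> X" "\<pi> p = P1_inf" using surj[of P1_inf] by blast
  then show ?thesis using that[of p] by (simp add: fin_def)
qed

lemma x_diff_nz: "X.nz (\<lambda>p. x p - c)"
  using nz_pullback[OF P1_coord_diff_nz[of c]] unfolding x_def .

lemma x_nz: "X.nz x" using x_diff_nz[of 0] by simp

lemma ord_x_diff:
  assumes p: "p \<in> X"
  shows "X.ord p (\<lambda>q. x q - c) = (if fin p then (if x p = c then int (ram p) else 0) else - int (ram p))"
  using ord_pullback[OF p P1_coord_diff_nz[of c]] P1_ord_finite[of "\<pi> p" c] P1_ord_inf[of c]
  unfolding x_def fin_def by simp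

lemma fin_ae: "\<forall>\<^sub>F p in X.ae. fin p"
  unfolding fin_def by (rule ae_pullback[OF P1_not_inf_ae])

lemma poly_rational: "X.rational (\<lambda>p. poly A (x p))"
proof (induction A)
  case (pCons a A)
  show ?case unfolding poly_pCons by (rule X.rational_add[OF X.rational_const X.rational_mult[OF X.nz_rational[OF x_nz] pCons(2)]])
qed simp

text \<open>Each linear factor contributes a zero of order \<open>ram\<close> over its root and a
  pole of order \<open>ram\<close> over infinity; \<open>linear\<close> adds these contributions
  up.\<close>

lemma poly_nz_ord:
  assumes "A \<noteq> 0"
  shows "X.nz (\<lambda>p. poly A (x p)) \<and> (\<forall>p\<in>X. X.ord p (\<lambda>p. poly A (x p)) =
     (if fin p then int (ram p) * int (order (x p) A) else - int (ram p) * int (degree A)))"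
  using assms
proof (induction A rule: complex_poly_linear_induct)
  case (const c)
  then show ?case by (auto simp: order_0I)
next
  case (linear a A)
  have CC: "[:-a, 1:] * A \<noteq> 0" using linear.hyps by (metis mult_eq_0_iff pCons_eq_0_iff zero_neq_one)
  have eq: "(\<lambda>p. poly ([:-a, 1:] * A) (x p)) = (\<lambda>p. (x p - a) * poly A (x p))"
    by (simp add: algebra_simps)
  have n: "X.nz (\<lambda>p. poly A (x p))" using linear.IH by blast
  have "X.ord p (\<lambda>p. (x p - a) * poly A (x p)) = (if fin p then int (ram p) * int (order (x p) ([:-a, 1:] * A))
      else - int (ram p) * int (degree ([:-a, 1:] * A)))" if p: "p \<in> X" for p
  proof -
    have "degree ([:-a, 1:] * A) = 1 + degree A" using linear.hyps by (subst degree_mult_eq) auto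
    moreover have "order (x p) ([:-a, 1:] * A) = (if x p = a then 1 else 0) + order (x p) A"
      using order_mult[OF CC] by (simp add: order_linear)
    moreover have "X.ord p (\<lambda>p. (x p - a) * poly A (x p)) = X.ord p (\<lambda>p. x p - a) + X.ord p (\<lambda>p. poly A (x p))"
      by (rule X.ord_mult[OF p x_diff_nz n])
    moreover have "X.ord p (\<lambda>p. poly A (x p)) =
       (if fin p then int (ram p) * int (order (x p) A) else - int (ram p) * int (degree A))"
      using linear.IH p by blast
    ultimately show ?thesis unfolding ord_x_diff[OF p] by (auto simp: algebra_simps)
  qed
  then show ?case unfolding eq using X.nz_mult[OF x_diff_nz n] by blast
qed

lemma poly_nz: "A \<noteq> 0 \<Longrightarrow> X.nz (\<lambda>p. poly A (x p))"
  using poly_nz_ord by blast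

lemma ord_poly: "A \<noteq> 0 \<Longrightarrow> p \<in> X \<Longrightarrow> X.ord p (\<lambda>p. poly A (x p)) =
     (if fin p then int (ram p) * int (order (x p) A) else - int (ram p) * int (degree A))"
  using poly_nz_ord by blast

lemma poly_zero: "rat_eq X (\<lambda>p. poly A (x p)) (\<lambda>_. 0) \<Longrightarrow> A = 0"
  using poly_nz[of A] unfolding X.nz_def by blast

text \<open>The subfield C(x) of the function field, as a predicate on representatives.\<close>

definition R :: "('n proj_space \<Rightarrow> complex) \<Rightarrow> bool" where
  "R h \<longleftrightarrow> (\<exists>A C. C \<noteq> 0 \<and> rat_eq X h (\<lambda>p. poly A (x p) / poly C (x p)))"

lemma R_I: "C \<noteq> 0 \<Longrightarrow> rat_eq X h (\<lambda>p. poly A (x p) / poly C (x p)) \<Longrightarrow> R h"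
  unfolding R_def by blast

lemma R_E:
  assumes "R h" obtains A C where "C \<noteq> 0" "rat_eq X h (\<lambda>p. poly A (x p) / poly C (x p))"
  using assms unfolding R_def by blast

lemma R_rational: "R h \<Longrightarrow> X.rational h"
proof -
  assume "R h"
  then obtain A C where AC: "C \<noteq> 0" "rat_eq X h (\<lambda>p. poly A (x p) / poly C (x p))" by (rule R_E)
  show ?thesis
    by (rule X.rational_cong[OF X.rational_divide[OF poly_rational poly_rational] X.eqv_sym[OF AC(2)]])
qed

lemma R_cong: "R h \<Longrightarrow> rat_eq X h h' \<Longrightarrow> R h'"
  unfolding R_def using X.eqv_sym X.eqv_trans by blast

lemma R_poly: "R (\<lambda>p. poly A (x p))"
  by (rule R_I[of 1 _ A]) simp_all

lemma R_const: "R (\<lambda>_. c)"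
  using R_poly[of "[:c:]"] by simp

lemma R_x: "R x"
  using R_poly[of "[:0, 1:]"] by simp

lemma R_add: assumes "R h" "R k" shows "R (\<lambda>p. h p + k p)"
proof -
  obtain A C where 1: "C \<noteq> 0" "rat_eq X h (\<lambda>p. poly A (x p) / poly C (x p))" using assms(1) by (rule R_E)
  obtain B D where 2: "D \<noteq> 0" "rat_eq X k (\<lambda>p. poly B (x p) / poly D (x p))" using assms(2) by (rule R_E)
  show ?thesis
  proof (rule R_I[of "C * D" _ "A * D + B * C"])
    show "rat_eq X (\<lambda>p. h p + k p) (\<lambda>p. poly (A * D + B * C) (x p) / poly (C * D) (x p))"
      using 1(2) 2(2) X.nz_nonzero[OF poly_nz[OF 1(1)]] X.nz_nonzero[OF poly_nz[OF 2(1)]]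
      unfolding X.rat_eq_ae by eventually_elim (simp add: add_frac_eq)
  qed (use 1 2 in simp)
qed

lemma R_mult: assumes "R h" "R k" shows "R (\<lambda>p. h p * k p)"
proof -
  obtain A C where 1: "C \<noteq> 0" "rat_eq X h (\<lambda>p. poly A (x p) / poly C (x p))" using assms(1) by (rule R_E)
  obtain B D where 2: "D \<noteq> 0" "rat_eq X k (\<lambda>p. poly B (x p) / poly D (x p))" using assms(2) by (rule R_E)
  show ?thesis
  proof (rule R_I[of "C * D" _ "A * B"])
    show "rat_eq X (\<lambda>p. h p * k p) (\<lambda>p. poly (A * B) (x p) / poly (C * D) (x p))"
      using 1(2) 2(2) unfolding X.rat_eq_ae by eventually_elim simp
  qed (use 1 2 in simp)
qed

lemma R_inverse: assumes "R h" shows "R (\<lambda>p. inverse (h p))"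
proof -
  obtain A C where 1: "C \<noteq> 0" "rat_eq X h (\<lambda>p. poly A (x p) / poly C (x p))" using assms(1) by (rule R_E)
  show ?thesis
  proof (cases "A = 0")
    case True
    have "rat_eq X (\<lambda>_. 0) (\<lambda>p. inverse (h p))"
      using 1(2) True unfolding X.rat_eq_ae by (auto elim: eventually_mono)
    then show ?thesis by (rule R_cong[OF R_const])
  next
    case False
    have "rat_eq X (\<lambda>p. inverse (h p)) (\<lambda>p. poly C (x p) / poly A (x p))"
      using 1(2) unfolding X.rat_eq_ae by eventually_elim simp
    then show ?thesis by (rule R_I[OF False])
  qed
qed

lemma R_minus: "R h \<Longrightarrow> R (\<lambda>p. - h p)"
  using R_mult[OF R_const[of "-1"], of h] by simp

lemma R_diff: "R h \<Longrightarrow> R k \<Longrightarrow> R (\<lambda>p. h p - k p)"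
  using R_add[OF _ R_minus, of h k] by simp

lemma R_divide: "R h \<Longrightarrow> R k \<Longrightarrow> R (\<lambda>p. h p / k p)"
  using R_mult[OF _ R_inverse, of h k] by (simp add: divide_inverse)

lemma R_power: "R h \<Longrightarrow> R (\<lambda>p. h p ^ k)"
proof (induction k)
  case 0
  then show ?case using R_const[of 1] by simp
next
  case (Suc k)
  then show ?case using R_mult[of h "\<lambda>p. h p ^ k"] by simp
qed

lemma R_powi: "R h \<Longrightarrow> R (\<lambda>p. h p powi k)"
  using R_power[of h "nat k"] R_power[OF R_inverse, of h "nat (- k)"]
  by (cases "k \<ge> 0") (auto simp: power_int_def)

text \<open>Functions of the base coordinate have the same order, up to ramification, and the same value
  at all points of a fiber.\<close>

lemma R_ord:
  assumes "R h" "X.nz h"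
  shows "\<exists>k. \<forall>q\<in>X. \<pi> q = \<pi> p \<longrightarrow> X.ord q h = int (ram q) * k"
proof -
  obtain A C where 1: "C \<noteq> 0" "rat_eq X h (\<lambda>p. poly A (x p) / poly C (x p))" using assms(1) by (rule R_E)
  have A: "A \<noteq> 0"
  proof
    assume "A = 0"
    then have "rat_eq X h (\<lambda>_. 0)" using 1(2) by simp
    then show False using assms(2) unfolding X.nz_def by blast
  qed
  have ord: "X.ord q h = X.ord q (\<lambda>p. poly A (x p)) - X.ord q (\<lambda>p. poly C (x p))" if q: "q \<in> X" for q
    unfolding X.ord_cong[OF 1(2)] divide_inverse
    using X.ord_mult[OF q poly_nz[OF A] X.nz_inverse[OF poly_nz[OF 1(1)]]] X.ord_inverse[OF q poly_nz[OF 1(1)]] by simp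
  show ?thesis
  proof (intro exI ballI impI)
    fix q assume q: "q \<in> X" "\<pi> q = \<pi> p"
    then have "fin q \<longleftrightarrow> fin p" "x q = x p" by (simp_all add: fin_def x_def)
    then show "X.ord q h = int (ram q) * (if fin p then int (order (x p) A) - int (order (x p) C)
         else int (degree C) - int (degree A))"
      unfolding ord[OF q(1)] ord_poly[OF A q(1)] ord_poly[OF 1(1) q(1)] by (simp add: algebra_simps)
  qed
qed

text \<open>Having value c means that h - c has positive order or is zero, and the sign of the order
  is constant along a fiber.\<close>

lemma R_hasval:
  assumes "R h" "p \<in> X" "q \<in> X" "\<pi> q = \<pi> p" "X.hasval p h c"
  shows "X.hasval q h c"
proof -
  have d: "R (\<lambda>r. h r - c)" by (rule R_diff[OF assms(1) R_const])
  have v: "X.hasval p (\<lambda>r. h r - c) (c - c)" by (rule X.hasval_diff[OF assms(5) X.hasval_const])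
  have "X.hasval q (\<lambda>r. h r - c) 0"
  proof (cases "X.nz (\<lambda>r. h r - c)")
    case True
    obtain k where k: "\<forall>q\<in>X. \<pi> q = \<pi> p \<longrightarrow> X.ord q (\<lambda>r. h r - c) = int (ram q) * k"
      using R_ord[OF d True, of p] by blast
    have "X.ord p (\<lambda>r. h r - c) > 0" using X.ord_hasval(2)[OF assms(2) True] v by simp
    then have "k > 0" using k assms(2) by (simp add: zero_less_mult_iff)
    then have "X.ord q (\<lambda>r. h r - c) > 0" using k assms(3,4) ram_pos[OF assms(3)] by simp
    then show ?thesis using X.ord_hasval(2)[OF assms(3) True] by blast
  next
    case False
    then have "rat_eq X (\<lambda>r. h r - c) (\<lambda>_. 0)" using X.nz_cases[OF R_rational[OF d]] by blast
    then show ?thesis using X.hasval_cong[OF X.hasval_const X.eqv_sym] by blast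
  qed
  from X.hasval_add[OF this X.hasval_const[of q c]] show ?thesis by simp
qed

text \<open>Every complex number is a value of x at a finite point, and the absence of a pole there
  bounds the order of the denominator by that of the numerator. So the denominator divides the
  numerator.\<close>

lemma R_regular_poly:
  assumes h: "R h" and ord: "\<And>p. X.nz h \<Longrightarrow> p \<in> X \<Longrightarrow> fin p \<Longrightarrow> 0 \<le> X.ord p h"
  shows "\<exists>Q. rat_eq X h (\<lambda>p. poly Q (x p))"
proof -
  obtain A C where 1: "C \<noteq> 0" "rat_eq X h (\<lambda>p. poly A (x p) / poly C (x p))" using h by (rule R_E)
  show ?thesis
  proof (cases "A = 0")
    case True
    then show ?thesis using 1(2) by (intro exI[of _ 0]) simp
  next
    case False
    have n: "X.nz (\<lambda>p. poly A (x p) / poly C (x p))"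
      unfolding divide_inverse by (rule X.nz_mult[OF poly_nz[OF False] X.nz_inverse[OF poly_nz[OF 1(1)]]])
    then have hn: "X.nz h" by (rule X.nz_cong[OF _ X.eqv_sym[OF 1(2)]])
    have "order c C \<le> order c A" for c
    proof -
      obtain p where p: "p \<in> X" "fin p" "x p = c" by (rule ex_x)
      have "X.ord p h = X.ord p (\<lambda>p. poly A (x p)) - X.ord p (\<lambda>p. poly C (x p))"
        unfolding X.ord_cong[OF 1(2)] divide_inverse
        using X.ord_mult[OF p(1) poly_nz[OF False] X.nz_inverse[OF poly_nz[OF 1(1)]]]
          X.ord_inverse[OF p(1) poly_nz[OF 1(1)]] by simp
      then have "0 \<le> int (ram p) * (int (order c A) - int (order c C))"
        using ord[OF hn p(1,2)] unfolding ord_poly[OF False p(1)] ord_poly[OF 1(1) p(1)]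
        using p by (simp add: algebra_simps)
      then show ?thesis using ram_pos[OF p(1)] by (simp add: zero_le_mult_iff)
    qed
    then obtain Q where Q: "A = C * Q" using complex_poly_dvdI[OF 1(1) False] by (auto elim: dvdE)
    have "rat_eq X h (\<lambda>p. poly Q (x p))"
      using 1(2) X.nz_nonzero[OF poly_nz[OF 1(1)]] unfolding X.rat_eq_ae Q by eventually_elim simp
    then show ?thesis by blast
  qed
qed

text \<open>The pullback of the point z as a divisor, of degree 2. Over infinity it is the polar
  divisor F of x.\<close>

definition fib :: "2 proj_space \<Rightarrow> 'n proj_space \<Rightarrow> int" where
  "fib z p = (if p \<in> X \<and> \<pi> p = z then int (ram p) else 0)"

lemma fib_support: "{p. fib z p \<noteq> 0} \<subseteq> fiber X \<pi> z"
  unfolding fib_def fiber_def by auto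

lemma fib_divisor: "(\<lambda>p. k * fib z p) \<in> divisors X"
proof -
  have "{p. k * fib z p \<noteq> 0} \<subseteq> fiber X \<pi> z" using fib_support by auto
  then show ?thesis unfolding divisors_def
    using finite_fiber[of z] finite_subset by (auto simp: fiber_def)
qed

lemma fib_degree: "divisor_degree (\<lambda>p. k * fib z p) = 2 * k"
proof -
  have "divisor_degree (\<lambda>p. k * fib z p) = (\<Sum>p\<in>fiber X \<pi> z. k * fib z p)"
    by (rule divisor_degree_eq) (use finite_fiber[of z] fib_support[of z] in auto)
  also have "\<dots> = (\<Sum>p\<in>fiber X \<pi> z. k * int (ram p))"
    by (intro sum.cong) (auto simp: fib_def fiber_def)
  also have "\<dots> = k * int (\<Sum>p\<in>fiber X \<pi> z. ram p)" by (simp add: sum_distrib_left)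
  finally show ?thesis using sum_fiber[of z] by simp
qed

abbreviation kF :: "nat \<Rightarrow> 'n proj_space \<Rightarrow> int" where "kF k \<equiv> (\<lambda>p. int k * fib P1_inf p)"

lemma kF_eq: "p \<in> X \<Longrightarrow> kF k p = (if fin p then 0 else int k * int (ram p))"
  by (simp add: fib_def fin_def)

lemma kF_I:
  assumes "X.rational h"
    and "\<And>p. X.nz h \<Longrightarrow> p \<in> X \<Longrightarrow> fin p \<Longrightarrow> 0 \<le> X.ord p h"
    and "\<And>p. X.nz h \<Longrightarrow> p \<in> X \<Longrightarrow> \<not> fin p \<Longrightarrow> - (int k * int (ram p)) \<le> X.ord p h"
  shows "h \<in> X.L (kF k)"
  by (rule X.L_I[OF assms(1)]) (use assms(2,3) kF_eq in auto)

lemma kF_D: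
  assumes "h \<in> X.L (kF k)" "X.nz h" "p \<in> X"
  shows "fin p \<Longrightarrow> 0 \<le> X.ord p h" "\<not> fin p \<Longrightarrow> - (int k * int (ram p)) \<le> X.ord p h"
  using X.L_ord[OF assms] kF_eq[OF assms(3), of k] by auto

lemma kF_poly_mult:
  assumes "h \<in> X.L (kF k)" "degree A + k \<le> m"
  shows "(\<lambda>p. poly A (x p) * h p) \<in> X.L (kF m)"
proof (cases "A = 0 \<or> \<not> X.nz h")
  case True
  have "rat_eq X h (\<lambda>_. 0) \<or> A = 0" using True X.nz_cases[OF X.L_rational[OF assms(1)]] by blast
  then have z: "rat_eq X (\<lambda>p. poly A (x p) * h p) (\<lambda>_. 0)"
    unfolding X.rat_eq_ae by (auto elim: eventually_mono)
  then have "\<not> X.nz (\<lambda>p. poly A (x p) * h p)" unfolding X.nz_def by blast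
  then show ?thesis
    using X.rational_mult[OF poly_rational X.L_rational[OF assms(1)]] by (intro kF_I) auto
next
  case False
  then have A: "A \<noteq> 0" and h: "X.nz h" by auto
  show ?thesis
  proof (rule kF_I[OF X.rational_mult[OF poly_rational X.L_rational[OF assms(1)]]])
    fix p assume p: "p \<in> X" "fin p"
    show "0 \<le> X.ord p (\<lambda>p. poly A (x p) * h p)"
      using X.ord_mult[OF p(1) poly_nz[OF A] h] ord_poly[OF A p(1)] kF_D(1)[OF assms(1) h p] p(2) by simp
  next
    fix p assume p: "p \<in> X" "\<not> fin p"
    have "int (ram p) * (int (degree A) + int k) \<le> int (ram p) * int m"
      using assms(2) by (intro mult_left_mono) auto
    then show "- (int m * int (ram p)) \<le> X.ord p (\<lambda>p. poly A (x p) * h p)"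
      using X.ord_mult[OF p(1) poly_nz[OF A] h] ord_poly[OF A p(1)] kF_D(2)[OF assms(1) h p] p(2)
      by (simp add: algebra_simps)
  qed
qed

lemma one_kF: "(\<lambda>_. 1) \<in> X.L (kF k)"
  by (rule kF_I) auto

lemma poly_kF: "degree A \<le> k \<Longrightarrow> (\<lambda>p. poly A (x p)) \<in> X.L (kF k)"
  using kF_poly_mult[OF one_kF[of 0], of A k] by simp

text \<open>Regularity at the finite points makes the function a polynomial; its pole at any one
  point over infinity bounds the degree.\<close>

lemma R_kF_poly:
  assumes h: "R h" "h \<in> X.L (kF k)"
  shows "\<exists>Q. degree Q \<le> k \<and> rat_eq X h (\<lambda>p. poly Q (x p))"
proof -
  obtain Q where Q: "rat_eq X h (\<lambda>p. poly Q (x p))"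
    using R_regular_poly[OF h(1)] kF_D(1)[OF h(2)] by blast
  have "degree Q \<le> k"
  proof (cases "Q = 0")
    case False
    then have n: "X.nz h" using X.nz_cong[OF poly_nz X.eqv_sym[OF Q]] by blast
    obtain p where p: "p \<in> X" "\<not> fin p" by (rule ex_inf)
    have "- (int k * int (ram p)) \<le> - int (ram p) * int (degree Q)"
      using kF_D(2)[OF h(2) n p] X.ord_cong[OF Q, of p] ord_poly[OF False p(1)] p(2) by simp
    then have "int (ram p) * int (degree Q) \<le> int (ram p) * int k" by (simp add: mult.commute)
    then show ?thesis using ram_pos[OF p(1)] by (simp add: mult_le_cancel_left)
  qed simp
  then show ?thesis using Q by blast
qed

lemma poly_sum_coeff: "degree Q \<le> k \<Longrightarrow> poly Q (z :: complex) = (\<Sum>i\<le>k. coeff Q i * z ^ i)"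
proof -
  assume "degree Q \<le> k"
  then have "(\<Sum>i\<le>degree Q. coeff Q i * z ^ i) = (\<Sum>i\<le>k. coeff Q i * z ^ i)"
    by (intro sum.mono_neutral_left) (auto simp: coeff_eq_0)
  then show ?thesis by (simp add: poly_altdef)
qed

text \<open>If x generated all of these spaces, \<open>L(kF)\<close> would consist of the
  polynomials of degree at most k, of dimension k + 1, but Riemann's inequality gives 2k + 1 - g.
  For k = g + 1 this is g + 3 against g + 2.\<close>

lemma ex_non_R: "\<exists>y k. y \<in> X.L (kF k) \<and> \<not> R y"
proof (rule ccontr)
  assume "\<not> ?thesis"
  then have all: "R y" if "y \<in> X.L (kF k)" for y k using that by blast
  obtain l b where lb: "X.indep {..<l} b" "\<And>i. i < l \<Longrightarrow> b i \<in> X.L (kF (g + 1))"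
      "divisor_degree (kF (g + 1)) + 1 - int g \<le> int l"
    using X.genus_lower[OF genus fib_divisor] by blast
  have "\<forall>i\<in>{..<l}. \<exists>Q. rat_eq X (b i) (\<lambda>p. \<Sum>j\<le>g + 1. coeff Q j * x p ^ j)"
  proof
    fix i assume "i \<in> {..<l}"
    then have "b i \<in> X.L (kF (g + 1))" using lb(2) by simp
    from R_kF_poly[OF all[OF this] this] obtain Q where "degree Q \<le> g + 1" "rat_eq X (b i) (\<lambda>p. poly Q (x p))"
      by blast
    then show "\<exists>Q. rat_eq X (b i) (\<lambda>p. \<Sum>j\<le>g + 1. coeff Q j * x p ^ j)"
      using poly_sum_coeff[of Q "g + 1"] by (intro exI[of _ Q]) simp
  qed
  from bchoice[OF this] obtain Q where Q: "\<And>i. i \<in> {..<l} \<Longrightarrow>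
      rat_eq X (b i) (\<lambda>p. \<Sum>j\<in>{..g + 1}. coeff (Q i) j * x p ^ j)" by blast
  have "card {..<l} \<le> card {..g + 1}"
    by (rule X.card_indep_le_span[OF _ _ lb(1) Q]) auto
  then show False using lb(3) fib_degree[of "int (g + 1)" P1_inf] by simp
qed

end

lemma prod_linear_power_order:
  fixes Z :: "complex set"
  assumes "finite Z"
  shows "(\<Prod>z\<in>Z. [:-z, 1:] ^ m) \<noteq> 0" "z \<in> Z \<Longrightarrow> m \<le> order z (\<Prod>z\<in>Z. [:-z, 1:] ^ m)"
proof -
  show nz: "(\<Prod>z\<in>Z. [:-z, 1:] ^ m) \<noteq> 0" using assms by (simp add: prod_zero_iff)
  assume "z \<in> Z"
  then have "[:-z, 1:] ^ m dvd (\<Prod>z\<in>Z. [:-z, 1:] ^ m)" by (rule dvd_prodI[OF assms])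
  then show "m \<le> order z (\<Prod>z\<in>Z. [:-z, 1:] ^ m)" using nz unfolding order_divides by blast
qed

section \<open>The function field has degree 2 over C(x)\<close>

context double_cover
begin

text \<open>A polynomial in x can cancel all finite poles, at the price of a pole at infinity that
  is absorbed into M.\<close>

lemma clear_poles:
  assumes h: "X.nz h"
  shows "\<exists>G M. G \<noteq> 0 \<and> (\<lambda>p. poly G (x p) * h p) \<in> X.L (kF M)"
proof -
  define Z where "Z = {p\<in>X. X.ord p h \<noteq> 0}"
  define m where "m = nat (\<Sum>p\<in>Z. \<bar>X.ord p h\<bar>)"
  have Z: "finite Z" unfolding Z_def by (rule X.ord_finite_support[OF h])
  have m: "- int m \<le> X.ord p h" if "p \<in> X" for p
  proof (cases "p \<in> Z")
    case True
    have "\<bar>X.ord p h\<bar> \<le> (\<Sum>p\<in>Z. \<bar>X.ord p h\<bar>)" by (rule member_le_sum[OF True _ Z]) simp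
    then show ?thesis unfolding m_def by simp
  qed (use that in \<open>simp add: Z_def\<close>)
  \<comment> \<open>The number m bounds every pole order of h, and G vanishes to order at least m
    over each finite zero or pole. Values of x at points over infinity may contribute harmless extra
    factors.\<close>
  define G where "G = (\<Prod>z\<in>x ` Z. [:-z, 1:] ^ m)"
  have G: "G \<noteq> 0" "\<And>z. z \<in> x ` Z \<Longrightarrow> m \<le> order z G"
    unfolding G_def using prod_linear_power_order[of "x ` Z"] Z by auto
  have ord: "X.ord p (\<lambda>p. poly G (x p) * h p) = X.ord p (\<lambda>p. poly G (x p)) + X.ord p h" if "p \<in> X" for p
    by (rule X.ord_mult[OF that poly_nz[OF G(1)] h])
  have "(\<lambda>p. poly G (x p) * h p) \<in> X.L (kF (degree G + m))"
  proof (rule kF_I[OF X.rational_mult[OF poly_rational X.nz_rational[OF h]]])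
    fix p assume p: "p \<in> X" "fin p"
    show "0 \<le> X.ord p (\<lambda>p. poly G (x p) * h p)"
    proof (cases "p \<in> Z")
      case True
      then have "int m \<le> int (order (x p) G)" using G(2) by simp
      also have "\<dots> \<le> int (ram p) * int (order (x p) G)" using ram_pos[OF p(1)]
        by (simp add: mult_le_cancel_right1)
      finally show ?thesis unfolding ord[OF p(1)] using ord_poly[OF G(1) p(1)] p(2) m[OF p(1)] by simp
    next
      case False
      then have "X.ord p h = 0" using p(1) by (simp add: Z_def)
      then show ?thesis unfolding ord[OF p(1)] using ord_poly[OF G(1) p(1)] p(2) by simp
    qed
  next
    fix p assume p: "p \<in> X" "\<not> fin p"
    have "int m \<le> int (ram p) * int m" using ram_pos[OF p(1)] by (simp add: mult_le_cancel_right1)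
    then show "- (int (degree G + m) * int (ram p)) \<le> X.ord p (\<lambda>p. poly G (x p) * h p)"
      unfolding ord[OF p(1)] using ord_poly[OF G(1) p(1)] p(2) m[OF p(1)] by (simp add: algebra_simps)
  qed
  then show ?thesis using G(1) by blast
qed

text \<open>Adding kF, of degree 2k, raises the dimension by at most 2k; this rate is what limits
  the degree of the field extension.\<close>

lemma kF_dimle: obtains l where "\<And>k. X.dimle (X.L (kF k)) (l + 2 * k)"
proof -
  obtain l where l: "X.dimle (X.L (kF 0)) l" by (rule X.genus_finite_dim[OF genus fib_divisor])
  have "X.dimle (X.L (kF k)) (l + 2 * k)" for k
  proof (rule X.dimle_mono[OF l])
    show "finite (fiber X \<pi> P1_inf)" by (rule finite_fiber) simp
    show "fiber X \<pi> P1_inf \<subseteq> X" by (auto simp: fiber_def)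
    show "kF 0 p \<le> kF k p" for p by (simp add: fib_def)
    show "p \<notin> fiber X \<pi> P1_inf \<Longrightarrow> kF k p = kF 0 p" for p by (auto simp: fib_def fiber_def)
    have "divisor_degree (kF k) = (\<Sum>p\<in>fiber X \<pi> P1_inf. kF k p)"
      by (rule divisor_degree_eq) (use finite_fiber[of P1_inf] fib_support[of P1_inf] in auto)
    then show "(\<Sum>p\<in>fiber X \<pi> P1_inf. kF k p - kF 0 p) = int (2 * k)"
      using fib_degree[of "int k" P1_inf] by simp
  qed
  then show ?thesis by (rule that)
qed

definition generator :: "('n proj_space \<Rightarrow> complex) \<Rightarrow> bool" where
  "generator y \<longleftrightarrow> (\<forall>h. X.rational h \<longrightarrow> (\<exists>a b. R a \<and> R b \<and> rat_eq X h (\<lambda>p. a p + b p * y p)))"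

text \<open>Multiplying 1, y and G h by powers of x gives three functions per power, while the
  dimension of \<open>L(kF)\<close> grows only by two per step. The resulting relation over C[x] can
  be solved for h because y is not in C(x).\<close>

lemma non_R_generator:
  assumes y: "y \<in> X.L (kF K)" "\<not> R y"
  shows "generator y"
  unfolding generator_def
proof (intro allI impI)
  fix h assume h: "X.rational h"
  show "\<exists>a b. R a \<and> R b \<and> rat_eq X h (\<lambda>p. a p + b p * y p)"
  proof (cases "X.nz h")
    case False
    then have "rat_eq X h (\<lambda>_. 0)" using X.nz_cases[OF h] by blast
    then show ?thesis using R_const[of 0] by (intro exI[of _ "\<lambda>_. 0"]) simp
  next
    case True
    obtain G M where G: "G \<noteq> 0" "(\<lambda>p. poly G (x p) * h p) \<in> X.L (kF M)"
      using clear_poles[OF True] by blast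
    obtain l where l: "\<And>k. X.dimle (X.L (kF k)) (l + 2 * k)" by (rule kF_dimle) blast
    \<comment> \<open>With this N there are 3N + 3 functions in a space of dimension at most l + 2(N
      + K + M) = 3N.\<close>
    define N where "N = l + 2 * K + 2 * M"
    define F where "F = (\<lambda>t::nat. if t = 0 then (\<lambda>_. 1) else if t = 1 then y else (\<lambda>p. poly G (x p) * h p))"
    define b where "b = (\<lambda>(t, i) p. x p ^ i * F t p)"
    define J where "J = {..<3::nat} \<times> {..N}"
    have mem: "b j \<in> X.L (kF (N + K + M))" if j: "j \<in> J" for j
    proof -
      obtain t i where ti: "j = (t, i)" "t < 3" "i \<le> N" using j by (auto simp: J_def)
      have "F t \<in> X.L (kF (K + M))"
      proof -
        have "y \<in> X.L (kF (K + M))" using kF_poly_mult[OF y(1), of 1 "K + M"] by simp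
        moreover have "(\<lambda>p. poly G (x p) * h p) \<in> X.L (kF (K + M))" using kF_poly_mult[OF G(2), of 1 "K + M"] by simp
        ultimately show ?thesis using one_kF[of "K + M"] by (simp add: F_def)
      qed
      from kF_poly_mult[OF this, of "monom 1 i" "N + K + M"]
      have "(\<lambda>p. poly (monom 1 i) (x p) * F t p) \<in> X.L (kF (N + K + M))"
        using ti(3) by (simp add: degree_monom_eq)
      then show ?thesis by (simp add: b_def ti(1) poly_monom)
    qed
    have J: "finite J" "l + 2 * (N + K + M) < card J" by (simp_all add: J_def card_cartesian_product N_def)
    have "\<exists>c. (\<exists>j\<in>J. c j \<noteq> 0) \<and> rat_eq X (\<lambda>p. \<Sum>j\<in>J. c j * b j p) (\<lambda>_. 0)"
      by (rule X.dimle_dependent[OF l J(1) _ J(2)]) (rule mem)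
    then obtain c where c: "\<exists>j\<in>J. c j \<noteq> 0" "rat_eq X (\<lambda>p. \<Sum>j\<in>J. c j * b j p) (\<lambda>_. 0)"
      by (elim exE conjE)
    define P where "P = (\<lambda>t. \<Sum>i\<le>N. monom (c (t, i)) i)"
    have coeffP: "coeff (P t) i = c (t, i)" if "i \<le> N" for t i
      using that by (simp add: P_def coeff_sum)
    have sum: "(\<Sum>j\<in>J. c j * b j p) = poly (P 0) (x p) + poly (P 1) (x p) * y p + poly (P 2) (x p) * (poly G (x p) * h p)" for p
    proof -
      have "(\<Sum>j\<in>J. c j * b j p) = (\<Sum>t<3. \<Sum>i\<le>N. c (t, i) * (x p ^ i * F t p))"
        by (simp add: J_def b_def sum.cartesian_product case_prod_unfold)
      also have "\<dots> = (\<Sum>t<3. poly (P t) (x p) * F t p)"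
        by (simp add: P_def poly_sum poly_monom sum_distrib_right mult.assoc)
      finally show ?thesis by (simp add: F_def eval_nat_numeral)
    qed
    have rel: "rat_eq X (\<lambda>p. poly (P 0) (x p) + poly (P 1) (x p) * y p + poly (P 2) (x p) * (poly G (x p) * h p)) (\<lambda>_. 0)"
      using c(2) unfolding sum .
    \<comment> \<open>A relation without h would express y in C(x) or be a polynomial relation for
      x; either way all coefficients would vanish.\<close>
    have P2: "P 2 \<noteq> 0"
    proof
      assume P2: "P 2 = 0"
      have P1: "P 1 = 0"
      proof (rule ccontr)
        assume P1: "P 1 \<noteq> 0"
        have "rat_eq X y (\<lambda>p. poly (- P 0) (x p) / poly (P 1) (x p))"
          using rel X.nz_nonzero[OF poly_nz[OF P1]] unfolding X.rat_eq_ae P2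
          by eventually_elim (simp add: field_simps eq_neg_iff_add_eq_0)
        then show False using R_I[OF P1] y(2) by blast
      qed
      have "rat_eq X (\<lambda>p. poly (P 0) (x p)) (\<lambda>_. 0)" using rel unfolding P1 P2 by simp
      then have P0: "P 0 = 0" by (rule poly_zero)
      have "c j = 0" if j: "j \<in> J" for j
      proof -
        obtain t i where ti: "j = (t, i)" "t < 3" "i \<le> N" using j by (auto simp: J_def)
        have "t = 0 \<or> t = 1 \<or> t = 2" using ti(2) by auto
        then have "P t = 0" using P0 P1 P2 by blast
        then show ?thesis using coeffP[OF ti(3), of t] ti(1) by simp
      qed
      then show False using c(1) by blast
    qed
    have n: "P 2 * G \<noteq> 0" using P2 G(1) by simp
    define D where "D = (\<lambda>p. - inverse (poly (P 2 * G) (x p)))"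
    have "rat_eq X h (\<lambda>p. (D p * poly (P 0) (x p)) + (D p * poly (P 1) (x p)) * y p)"
      using rel X.nz_nonzero[OF poly_nz[OF n]] unfolding X.rat_eq_ae
    proof eventually_elim
      case (elim p)
      have "poly (P 2 * G) (x p) * h p = - (poly (P 0) (x p) + poly (P 1) (x p) * y p)"
        using elim(1) by (simp add: add_eq_0_iff mult.assoc)
      then show ?case using elim(2) unfolding D_def by (simp add: field_simps)
    qed
    moreover have "R D" unfolding D_def by (intro R_minus R_inverse R_poly)
    ultimately show ?thesis using R_mult[OF _ R_poly] by blast
  qed
qed

lemma generator_affine:
  assumes y: "generator y" "\<not> R y" and u: "R u" "X.nz u" and v: "R v"
  shows "generator (\<lambda>p. u p * (y p + v p))" "\<not> R (\<lambda>p. u p * (y p + v p))"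
proof -
  note u0 = X.nz_nonzero[OF u(2)]
  show "generator (\<lambda>p. u p * (y p + v p))" unfolding generator_def
  proof (intro allI impI)
    fix h assume "X.rational h"
    then obtain a b where ab: "R a" "R b" "rat_eq X h (\<lambda>p. a p + b p * y p)"
      using y(1) unfolding generator_def by blast
    have "rat_eq X h (\<lambda>p. (a p - b p * v p) + (b p / u p) * (u p * (y p + v p)))"
      using ab(3) u0 unfolding X.rat_eq_ae by eventually_elim (simp add: algebra_simps)
    then show "\<exists>a b. R a \<and> R b \<and> rat_eq X h (\<lambda>p. a p + b p * (u p * (y p + v p)))"
      using R_diff[OF ab(1) R_mult[OF ab(2) v]] R_divide[OF ab(2) u(1)] by blast
  qed
  show "\<not> R (\<lambda>p. u p * (y p + v p))"
  proof
    assume r: "R (\<lambda>p. u p * (y p + v p))"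
    have "rat_eq X (\<lambda>p. u p * (y p + v p) / u p - v p) y"
      using u0 unfolding X.rat_eq_ae by eventually_elim simp
    then show False using R_cong[OF R_diff[OF R_divide[OF r u(1)] v]] y(2) by blast
  qed
qed

end

section \<open>The equation y^2 = f(x) with f squarefree\<close>

locale hyperelliptic_model = double_cover +
  fixes y :: "'a proj_space \<Rightarrow> complex" and f :: "complex poly"
  assumes y_rational: "X.rational y" and y_non_R: "\<not> R y" and y_gen: "generator y"
    and f_squarefree: "rsquarefree f" and y_sq: "rat_eq X (\<lambda>p. y p ^ 2) (\<lambda>p. poly f (x p))"

context double_cover
begin

text \<open>Completing the square in y^2 = a + b y gives (y - b/2)^2 = A/C in C(x). Its class modulo
  squares is that of A C = q^2 f, and a rescaling leaves the squarefree part f.\<close>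

lemma ex_model: "\<exists>y f. hyperelliptic_model X \<pi> g s y f"
proof -
  obtain y K where yK: "y \<in> X.L (kF K)" "\<not> R y" using ex_non_R by blast
  note y = non_R_generator[OF yK] yK(2)
  have yr: "X.rational y" by (rule X.L_rational[OF yK(1)])
  obtain a b where ab: "R a" "R b" "rat_eq X (\<lambda>p. y p ^ 2) (\<lambda>p. a p + b p * y p)"
    using y(1) X.rational_power[OF yr] unfolding generator_def by blast
  define v where "v = (\<lambda>p. - (b p / 2))"
  define r where "r = (\<lambda>p. a p + b p ^ 2 / 4)"
  have v: "R v" unfolding v_def by (intro R_minus R_divide ab R_const)
  have "R r" unfolding r_def by (intro R_add R_divide R_power ab R_const)
  then obtain A C where AC: "C \<noteq> 0" "rat_eq X r (\<lambda>p. poly A (x p) / poly C (x p))" by (rule R_E)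
  have sq: "rat_eq X (\<lambda>p. (y p + v p) ^ 2) (\<lambda>p. poly A (x p) / poly C (x p))"
    using ab(3) AC(2) unfolding X.rat_eq_ae
  proof eventually_elim
    case (elim p)
    have "(y p + v p) ^ 2 = y p ^ 2 - b p * y p + b p ^ 2 / 4"
      unfolding v_def by (simp add: power2_eq_square field_simps)
    then show ?case using elim by (simp add: r_def)
  qed
  have A: "A \<noteq> 0"
  proof
    assume "A = 0"
    then have "rat_eq X y (\<lambda>p. - v p)"
      using sq unfolding X.rat_eq_ae by (auto elim!: eventually_mono simp: eq_neg_iff_add_eq_0)
    then show False using R_cong[OF R_minus[OF v] X.eqv_sym] y(2) by blast
  qed
  obtain q f where qf: "q \<noteq> 0" "A * C = q ^ 2 * f" "rsquarefree f"
    using complex_poly_squarefree_part[of "A * C"] A AC(1) by auto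
  \<comment> \<open>Indeed (C/q)^2 (A/C) = A C / q^2 = f.\<close>
  define u where "u = (\<lambda>p. poly C (x p) / poly q (x p))"
  have u: "R u" "X.nz u"
    unfolding u_def divide_inverse
    by (intro R_mult R_inverse R_poly X.nz_mult X.nz_inverse poly_nz AC(1) qf(1))+
  have "rat_eq X (\<lambda>p. (u p * (y p + v p)) ^ 2) (\<lambda>p. poly f (x p))"
    using sq X.nz_nonzero[OF poly_nz[OF AC(1)]] X.nz_nonzero[OF poly_nz[OF qf(1)]] unfolding X.rat_eq_ae
  proof eventually_elim
    case (elim p)
    have "poly (A * C) (x p) = poly (q ^ 2 * f) (x p)" using qf(2) by simp
    then have e: "poly A (x p) * poly C (x p) = poly q (x p) ^ 2 * poly f (x p)" by simp
    have "(u p * (y p + v p)) ^ 2 = (poly C (x p) / poly q (x p)) ^ 2 * (poly A (x p) / poly C (x p))"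
      unfolding power_mult_distrib elim(1) by (simp add: u_def)
    also have "\<dots> = (poly A (x p) * poly C (x p)) / poly q (x p) ^ 2"
      using elim(2,3) by (simp add: power2_eq_square)
    finally show ?case unfolding e using elim(3) by simp
  qed
  moreover have "X.rational (\<lambda>p. u p * (y p + v p))"
    by (intro X.rational_mult X.rational_add yr R_rational u v)
  ultimately have "hyperelliptic_model X \<pi> g s (\<lambda>p. u p * (y p + v p)) f"
    using generator_affine[OF y u v] qf(3) by unfold_locales
  then show ?thesis by blast
qed

end

text \<open>A quotient of linear forms: the numerator vanishes at p but not at q, the denominator at
  neither point.\<close>

lemma (in smooth_curve) ex_separating:
  assumes "p \<noteq> q" "p \<in> X" "q \<in> X"
  shows "\<exists>h. nz h \<and> ord p h > 0 \<and> ord q h = 0"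
proof -
  obtain F where F: "homogeneous_poly (Suc 0) F" "F (hcoords p) = 0" "F (hcoords q) \<noteq> 0"
    by (rule linear_form_sep[OF assms(1)])
  obtain G where G: "homogeneous_poly 1 G" "G (hcoords p) \<noteq> 0" "G (hcoords q) \<noteq> 0"
    by (rule linear_form_nonzero2[of p q]) auto
  define h where "h = (\<lambda>r. F (hcoords r) / G (hcoords r))"
  have reg: "regular_at X r h" if "G (hcoords r) \<noteq> 0" for r
    unfolding regular_at_def h_def using F(1) G(1) that
    by (intro exI[of _ "Suc 0"] exI[of _ F] exI[of _ G]) simp
  have v: "hasval r h (h r)" if "G (hcoords r) \<noteq> 0" for r
    unfolding hasval_def using reg[OF that] eqv_refl[of h] by blast
  have p0: "hasval p h 0" using v[OF G(2)] F(2) by (simp add: h_def)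
  have hq: "h q \<noteq> 0" using F(3) G(3) by (simp add: h_def)
  have n: "nz h" by (rule hasval_nonzero_nz[OF v[OF G(3)] hq assms(3)])
  show ?thesis
    using n ord_hasval(2)[OF assms(2) n] p0 ord_eq_0[OF assms(3) v[OF G(3)] hq] by blast
qed

section \<open>Local behaviour of y along a fiber\<close>

context hyperelliptic_model
begin

lemma f_nz: "f \<noteq> 0" using f_squarefree unfolding rsquarefree_def by blast

lemma order_f: "order z f = 0 \<or> order z f = 1" using f_squarefree unfolding rsquarefree_def by blast

lemma non_R_nz: "X.rational h \<Longrightarrow> \<not> R h \<Longrightarrow> X.nz h"
  using X.nz_cases[of h] R_cong[OF R_const X.eqv_sym] by blast

lemma y_nz: "X.nz y" by (rule non_R_nz[OF y_rational y_non_R])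

lemma ord_y:
  assumes p: "p \<in> X"
  shows "2 * X.ord p y = (if fin p then int (ram p) * int (order (x p) f) else - int (ram p) * int (degree f))"
  using X.ord_power[OF p y_nz, of 2] X.ord_cong[OF y_sq, of p] ord_poly[OF f_nz p] by simp

text \<open>Half the degree of f, rounded up: y has its poles in \<open>\<delta>\<close> F. The
  genus computation identifies it as g + 1, and the rounding decides whether infinity is a branch
  point.\<close>

definition \<delta> :: nat where "\<delta> = (degree f + 1) div 2"

text \<open>Near the fiber of \<open>p\<close> the generator is rescaled to \<open>yn p\<close>, whose square has order
  \<open>eps p \<in> {0, 1}\<close> on the base.\<close>

definition scale :: "'a proj_space \<Rightarrow> 'a proj_space \<Rightarrow> complex" where
  "scale p = (if fin p then (\<lambda>_. 1) else (\<lambda>q. inverse (x q) ^ \<delta>))"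

definition yn :: "'a proj_space \<Rightarrow> 'a proj_space \<Rightarrow> complex" where
  "yn p = (\<lambda>q. scale p q * y q)"

definition eps :: "'a proj_space \<Rightarrow> nat" where
  "eps p = (if fin p then order (x p) f else 2 * \<delta> - degree f)"

lemma eps_cases: "eps p = 0 \<or> eps p = 1"
  using order_f[of "x p"] unfolding eps_def \<delta>_def by presburger

lemma scale_R: "R (scale p)"
  unfolding scale_def using R_const[of 1] R_power[OF R_inverse[OF R_x]] by simp

lemma scale_nz: "X.nz (scale p)"
  unfolding scale_def using X.nz_power[OF X.nz_inverse[OF x_nz]] by simp

lemma yn_nz: "X.nz (yn p)"
  unfolding yn_def by (rule X.nz_mult[OF scale_nz y_nz])

lemma fin_fiber: "\<pi> q = \<pi> p \<Longrightarrow> fin q = fin p" "\<pi> q = \<pi> p \<Longrightarrow> x q = x p"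
  by (simp_all add: fin_def x_def)

lemma ord_x_inf: "q \<in> X \<Longrightarrow> \<not> fin q \<Longrightarrow> X.ord q x = - int (ram q)"
  using ord_x_diff[of q 0] by simp

lemma ord_scale:
  assumes "q \<in> X" "\<pi> q = \<pi> p"
  shows "X.ord q (scale p) = (if fin p then 0 else int (ram q) * int \<delta>)"
proof (cases "fin p")
  case False
  then have "X.ord q x = - int (ram q)" using ord_x_inf[OF assms(1)] fin_fiber(1)[OF assms(2)] by simp
  then show ?thesis unfolding scale_def
    using False X.ord_power[OF assms(1) X.nz_inverse[OF x_nz]] X.ord_inverse[OF assms(1) x_nz] by simp
qed (use assms(1) in \<open>simp add: scale_def\<close>)

lemma ord_yn:
  assumes "q \<in> X" "\<pi> q = \<pi> p"
  shows "2 * X.ord q (yn p) = int (ram q) * int (eps p)"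
proof -
  have o: "X.ord q (yn p) = X.ord q (scale p) + X.ord q y"
    unfolding yn_def by (rule X.ord_mult[OF assms(1) scale_nz y_nz])
  have "degree f \<le> 2 * \<delta>" unfolding \<delta>_def by presburger
  then show ?thesis
    using ord_y[OF assms(1)] fin_fiber[OF assms(2)] unfolding o ord_scale[OF assms]
    by (auto simp: eps_def of_nat_diff algebra_simps)
qed

lemma yn_gen:
  assumes "X.rational h"
  shows "\<exists>a b. R a \<and> R b \<and> rat_eq X h (\<lambda>q. a q + b q * yn p q)"
proof -
  obtain a b where ab: "R a" "R b" "rat_eq X h (\<lambda>p. a p + b p * y p)"
    using y_gen assms unfolding generator_def by blast
  have "rat_eq X h (\<lambda>q. a q + (b q / scale p q) * yn p q)"
    using ab(3) X.nz_nonzero[OF scale_nz[of p]] unfolding X.rat_eq_ae yn_def by eventually_elim simp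
  then show ?thesis using ab(1) R_divide[OF ab(2) scale_R] by blast
qed

lemma yn_sq: "R (\<lambda>q. yn p q ^ 2)"
proof -
  have "rat_eq X (\<lambda>q. scale p q ^ 2 * poly f (x q)) (\<lambda>q. yn p q ^ 2)"
    using y_sq unfolding X.rat_eq_ae yn_def by eventually_elim (simp add: power_mult_distrib)
  then show ?thesis by (rule R_cong[OF R_mult[OF R_power[OF scale_R] R_poly]])
qed

lemma ex_base_uniformizer:
  "\<exists>\<sigma>. R \<sigma> \<and> X.nz \<sigma> \<and> (\<forall>q\<in>X. \<pi> q = \<pi> p \<longrightarrow> X.ord q \<sigma> = int (ram q))"
proof (cases "fin p")
  case True
  have "X.ord q (\<lambda>r. x r - x p) = int (ram q)" if "q \<in> X" "\<pi> q = \<pi> p" for q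
    using ord_x_diff[OF that(1), of "x p"] fin_fiber[OF that(2)] True by simp
  then show ?thesis using R_diff[OF R_x R_const] x_diff_nz by blast
next
  case False
  have "X.ord q (\<lambda>r. inverse (x r)) = int (ram q)" if "q \<in> X" "\<pi> q = \<pi> p" for q
    using X.ord_inverse[OF that(1) x_nz] ord_x_inf[OF that(1)] fin_fiber[OF that(2)] False by simp
  then show ?thesis using R_inverse[OF R_x] X.nz_inverse[OF x_nz] by blast
qed

lemma sum_swap_eq: "rat_eq X h (\<lambda>q. a q + b q) \<Longrightarrow> rat_eq X h (\<lambda>q. b q + a q)"
  by (simp add: add.commute)

text \<open>Orders are meaningful only for nonzero functions, so the local arguments must first
  dispose of the cases where a component vanishes.\<close>

lemma R_two_nz:
  assumes "rat_eq X h (\<lambda>q. a q + b q * yn p q)" "X.nz h" "R a" "R b"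
  obtains "\<not> X.nz b" "rat_eq X h a" | "\<not> X.nz a" "X.nz b" "rat_eq X h (\<lambda>q. b q * yn p q)" | "X.nz a" "X.nz b"
proof (cases "X.nz b")
  case False
  then have "rat_eq X b (\<lambda>_. 0)" using X.nz_cases[OF R_rational[OF assms(4)]] by blast
  then have "rat_eq X h a" using assms(1) unfolding X.rat_eq_ae by eventually_elim simp
  then show ?thesis using that(1) False by blast
next
  case b: True
  show ?thesis
  proof (cases "X.nz a")
    case False
    then have "rat_eq X a (\<lambda>_. 0)" using X.nz_cases[OF R_rational[OF assms(3)]] by blast
    then have "rat_eq X h (\<lambda>q. b q * yn p q)" using assms(1) unfolding X.rat_eq_ae by eventually_elim simp
    then show ?thesis using that(2) False b by blast
  qed (use that(3) b in blast)
qed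

text \<open>If \<open>yn p\<close> takes the same nonzero value at two points of a fiber, the norm
  \<open>a\<^sup>2 - b\<^sup>2 yn\<^sup>2\<close> shows that no function \<open>a + b yn\<close> tells the two points apart.\<close>

lemma ord_norm:
  assumes pq: "p \<in> X" "q \<in> X" "\<pi> q = \<pi> p" and e: "eps p = 0"
    and c: "X.hasval p (yn p) c" "X.hasval q (yn p) c" and h: "X.nz h"
  shows "\<exists>k. X.ord p h = int (ram p) * k \<and> X.ord q h = int (ram q) * k"
proof -
  have yn0: "X.ord p (yn p) = 0" "X.ord q (yn p) = 0"
    using ord_yn[of p p] ord_yn[of q p] pq e by simp_all
  obtain a b where ab: "R a" "R b" "rat_eq X h (\<lambda>q. a q + b q * yn p q)"
    using yn_gen[OF X.nz_rational[OF h], of p] by blast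
  have Rk: "\<exists>k. X.ord p r = int (ram p) * k \<and> X.ord q r = int (ram q) * k" if "R r" "X.nz r" for r
    using R_ord[OF that, of p] pq by blast
  have b_ord: "X.ord r (\<lambda>q. b q * yn p q) = X.ord r b" if "X.nz b" "r = p \<or> r = q" for r
    using X.ord_mult[OF _ that(1) yn_nz[of p], of r] yn0 pq that(2) by auto
  show ?thesis
  proof (rule R_two_nz[OF ab(3) h ab(1,2)])
    assume "rat_eq X h a"
    then show ?thesis using Rk[OF ab(1) X.nz_cong[OF h]] X.ord_cong by metis
  next
    assume nb: "X.nz b" and hb: "rat_eq X h (\<lambda>q. b q * yn p q)"
    then show ?thesis using Rk[OF ab(2) nb] b_ord[OF nb] X.ord_cong[OF hb] by simp
  next
    assume na: "X.nz a" and nb: "X.nz b"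
    obtain i where i: "X.ord p a = int (ram p) * i" "X.ord q a = int (ram q) * i" using Rk[OF ab(1) na] by blast
    obtain j where j: "X.ord p b = int (ram p) * j" "X.ord q b = int (ram q) * j" using Rk[OF ab(2) nb] by blast
    have nby: "X.nz (\<lambda>q. b q * yn p q)" by (rule X.nz_mult[OF nb yn_nz])
    have rpos: "0 < int (ram p)" "0 < int (ram q)" using ram_pos pq by auto
    \<comment> \<open>If one component has strictly smaller order, it dominates at both points at
      once, and its order has the required shape.\<close>
    consider "i < j" | "j < i" | "i = j" by linarith
    then show ?thesis
    proof cases
      case 1
      then have "X.ord r a < X.ord r (\<lambda>q. b q * yn p q)" if "r = p \<or> r = q" for r
        using that b_ord[OF nb that] i j rpos by auto
      then have "X.ord r h = X.ord r a" if "r = p \<or> r = q" for r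
        using X.ord_add_less(2)[OF _ na nby, of r] X.ord_cong[OF ab(3)] that pq by auto
      then show ?thesis using i by auto
    next
      case 2
      then have lt: "X.ord r (\<lambda>q. b q * yn p q) < X.ord r a" if "r = p \<or> r = q" for r
        using that b_ord[OF nb that] i j rpos by auto
      have "X.ord r h = X.ord r b" if "r = p \<or> r = q" for r
        using X.ord_add_less(2)[OF _ nby na lt[OF that]] X.ord_cong[OF sum_swap_eq[OF ab(3)], of r] b_ord[OF nb that] that pq by auto
      then show ?thesis using j by auto
    next
      case 3
      obtain \<sigma> where \<sigma>: "R \<sigma>" "X.nz \<sigma>" "\<And>q. q \<in> X \<Longrightarrow> \<pi> q = \<pi> p \<Longrightarrow> X.ord q \<sigma> = int (ram q)"
        using ex_base_uniformizer[of p] by blast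
      \<comment> \<open>Scaling by a power of a function of x turns both components into units at p
        and at q, with common values there.\<close>
      define \<tau> where "\<tau> = (\<lambda>q. \<sigma> q powi (- i))"
      have \<tau>: "R \<tau>" "X.nz \<tau>" unfolding \<tau>_def by (rule R_powi[OF \<sigma>(1)], rule X.nz_powi[OF \<sigma>(2)])
      have \<tau>ord: "X.ord p \<tau> = - (int (ram p) * i)" "X.ord q \<tau> = - (int (ram q) * i)"
        unfolding \<tau>_def using X.ord_powi[OF _ \<sigma>(2)] \<sigma>(3) pq by simp_all
      define a1 where "a1 = (\<lambda>q. a q * \<tau> q)"
      define b1 where "b1 = (\<lambda>q. b q * \<tau> q)"
      have R1: "R a1" "R b1" unfolding a1_def b1_def by (intro R_mult ab \<tau>)+
      have n1: "X.nz a1" "X.nz b1" unfolding a1_def b1_def by (intro X.nz_mult na nb \<tau>)+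
      have "X.ord p a1 = 0" "X.ord p b1 = 0"
        unfolding a1_def b1_def using X.ord_mult[OF pq(1) na \<tau>(2)] X.ord_mult[OF pq(1) nb \<tau>(2)] \<tau>ord i j 3 by simp_all
      then obtain \<alpha> \<beta> where \<alpha>: "\<alpha> \<noteq> 0" "X.hasval p a1 \<alpha>" and \<beta>: "X.hasval p b1 \<beta>"
        using X.ord_0_hasval[OF pq(1)] n1 by metis
      have \<alpha>q: "X.hasval q a1 \<alpha>" and \<beta>q: "X.hasval q b1 \<beta>"
        by (rule R_hasval[OF R1(1) pq \<alpha>(2)], rule R_hasval[OF R1(2) pq \<beta>])
      have nh: "X.nz (\<lambda>q. h q * \<tau> q)" by (rule X.nz_mult[OF h \<tau>(2)])
      have hord: "X.ord p (\<lambda>q. h q * \<tau> q) = X.ord p h - int (ram p) * i"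
        "X.ord q (\<lambda>q. h q * \<tau> q) = X.ord q h - int (ram q) * i"
        using X.ord_mult[OF pq(1) h \<tau>(2)] X.ord_mult[OF pq(2) h \<tau>(2)] \<tau>ord by simp_all
      have heq: "rat_eq X (\<lambda>q. a1 q + b1 q * yn p q) (\<lambda>q. h q * \<tau> q)"
        using ab(3) unfolding X.rat_eq_ae a1_def b1_def by eventually_elim (simp add: algebra_simps)
      show ?thesis
      proof (cases "\<alpha> + \<beta> * c = 0")
        case False
        have "X.hasval r (\<lambda>q. h q * \<tau> q) (\<alpha> + \<beta> * c)" if "r = p \<or> r = q" for r
          using that \<alpha>(2) \<alpha>q \<beta> \<beta>q c by (intro X.hasval_cong[OF _ heq] X.hasval_add X.hasval_mult) auto
        then have "X.ord r (\<lambda>q. h q * \<tau> q) = 0" if "r = p \<or> r = q" for r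
          using X.ord_eq_0[OF _ _ False, of r] that pq by blast
        then show ?thesis using hord by (intro exI[of _ i]) auto
      next
        \<comment> \<open>Here a and b yn cancel to leading order, but then the conjugate a - b yn
          has the nonzero value 2\<alpha> at both points. The norm, which lies in C(x), therefore
          has the same orders as the scaled h.\<close>
        case True
        have k: "X.hasval r (\<lambda>q. a1 q - b1 q * yn p q) (\<alpha> - \<beta> * c)" if "r = p \<or> r = q" for r
          using that \<alpha>(2) \<alpha>q \<beta> \<beta>q c by (intro X.hasval_diff X.hasval_mult) auto
        have k0: "\<alpha> - \<beta> * c \<noteq> 0" using True \<alpha>(1) by (simp add: eq_neg_iff_add_eq_0[symmetric])
        have kord: "X.ord r (\<lambda>q. a1 q - b1 q * yn p q) = 0" if "r = p \<or> r = q" for r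
          using X.ord_eq_0[OF _ k[OF that] k0] that pq by blast
        have kn: "X.nz (\<lambda>q. a1 q - b1 q * yn p q)"
          by (rule X.hasval_nonzero_nz[OF k k0 pq(1)]) simp
        have Nn: "X.nz (\<lambda>q. (h q * \<tau> q) * (a1 q - b1 q * yn p q))" by (rule X.nz_mult[OF nh kn])
        have Neq: "rat_eq X (\<lambda>q. a1 q ^ 2 - b1 q ^ 2 * yn p q ^ 2) (\<lambda>q. (h q * \<tau> q) * (a1 q - b1 q * yn p q))"
          using heq unfolding X.rat_eq_ae
        proof eventually_elim
          case (elim q)
          show ?case unfolding elim[symmetric] by (simp add: power2_eq_square algebra_simps)
        qed
        have NR: "R (\<lambda>q. (h q * \<tau> q) * (a1 q - b1 q * yn p q))"
          by (rule R_cong[OF R_diff[OF R_power[OF R1(1)] R_mult[OF R_power[OF R1(2)] yn_sq]] Neq])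
        obtain m where m: "X.ord p (\<lambda>q. (h q * \<tau> q) * (a1 q - b1 q * yn p q)) = int (ram p) * m"
          "X.ord q (\<lambda>q. (h q * \<tau> q) * (a1 q - b1 q * yn p q)) = int (ram q) * m" using Rk[OF NR Nn] by blast
        have "X.ord p h - int (ram p) * i = int (ram p) * m" "X.ord q h - int (ram q) * i = int (ram q) * m"
          using m X.ord_mult[OF pq(1) nh kn] X.ord_mult[OF pq(2) nh kn] kord[of p] kord[of q] hord by simp_all
        then show ?thesis by (intro exI[of _ "m + i"]) (auto simp: algebra_simps)
      qed
    qed
  qed
qed

text \<open>If \<open>yn p\<close> were a unit at a fixed point, \<open>ord_norm\<close> with both
  points equal to p would make every order at p even, contradicting a uniformizer.\<close>

lemma eps_fixed: assumes p: "p \<in> X" "s p = p" shows "eps p = 1"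
proof (rule ccontr)
  assume "eps p \<noteq> 1"
  then have e: "eps p = 0" using eps_cases by blast
  have "X.ord p (yn p) = 0" using ord_yn[of p p] p(1) e by simp
  then obtain c where c: "X.hasval p (yn p) c" using X.ord_0_hasval[OF p(1) yn_nz] by blast
  obtain t where t: "uniformizer X p t" using X.uniformizer_exists[OF p(1)] by blast
  obtain k where "X.ord p t = int (ram p) * k"
    using ord_norm[OF p(1) p(1) refl e c c X.uniformizer_nz[OF t p(1)]] by blast
  moreover have "X.ord p t = 1" by (rule X.ord_uniformizer[OF p(1) t])
  ultimately have "(1::int) = 2 * k" using ram_eq_fixed[OF p(1)] p(2) by simp
  then show False by presburger
qed

text \<open>Here \<open>ram p\<close> is 1, so \<open>eps p\<close> is twice an order and hence 0.
  If \<open>yn p\<close> had equal values at p and \<open>s p\<close>, \<open>ord_norm\<close> would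
  forbid the existing function that vanishes at p and is a unit at \<open>s p\<close>.\<close>

lemma eps_not_fixed:
  assumes p: "p \<in> X" "s p \<noteq> p"
  shows "eps p = 0" "X.hasval p (yn p) c \<Longrightarrow> X.hasval (s p) (yn p) c' \<Longrightarrow> c \<noteq> c'"
proof -
  have r: "ram p = 1" "ram (s p) = 1"
    using ram_eq_fixed[OF p(1)] ram_eq_fixed[OF s_in[OF p(1)]] p(2) s_s[OF p(1)] by auto
  have "2 * X.ord p (yn p) = int (eps p)" using ord_yn[of p p] p(1) r by simp
  moreover have "2 * z \<noteq> 1" for z :: int by presburger
  ultimately show e: "eps p = 0" using eps_cases[of p] by (metis of_nat_1)
  assume c: "X.hasval p (yn p) c" "X.hasval (s p) (yn p) c'"
  show "c \<noteq> c'"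
  proof
    assume "c = c'"
    obtain h where h: "X.nz h" "X.ord p h > 0" "X.ord (s p) h = 0"
      using X.ex_separating[of p "s p"] p s_in[OF p(1)] by metis
    obtain k where "X.ord p h = int (ram p) * k" "X.ord (s p) h = int (ram (s p)) * k"
      using ord_norm[OF p(1) s_in[OF p(1)] pi_s[OF p(1)] e c(1) _ h(1)] c(2) \<open>c = c'\<close> by blast
    then show False using h(2,3) r by simp
  qed
qed

text \<open>No cancellation between a and b yn can hide a pole. At a fixed point their orders have
  different parity. Elsewhere a cancellation would have to occur at p and at \<open>s p\<close>,
  where \<open>yn p\<close> takes different values.\<close>

lemma regular_components:
  assumes p: "p \<in> X" and ab: "R a" "R b" "rat_eq X h (\<lambda>q. a q + b q * yn p q)" and h: "X.nz h"
    and ord: "0 \<le> X.ord p h" "0 \<le> X.ord (s p) h"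
  shows "(X.nz a \<longrightarrow> 0 \<le> X.ord p a) \<and> (X.nz b \<longrightarrow> 0 \<le> X.ord p b)"
proof -
  have b_ord: "X.ord p (\<lambda>q. b q * yn p q) = X.ord p b + X.ord p (yn p)" if "X.nz b"
    by (rule X.ord_mult[OF p that yn_nz])
  have ev: "\<exists>k. X.ord p r = int (ram p) * k" if "R r" "X.nz r" for r using R_ord[OF that, of p] p by blast
  have yp: "2 * X.ord p (yn p) = int (ram p) * int (eps p)" using ord_yn[of p p] p by simp
  have fixed: "s p = p \<Longrightarrow> ram p = 2 \<and> X.ord p (yn p) = 1"
    using ram_eq_fixed[OF p] eps_fixed[OF p] yp by simp
  have nfixed: "s p \<noteq> p \<Longrightarrow> ram p = 1 \<and> X.ord p (yn p) = 0"
    using ram_eq_fixed[OF p] eps_not_fixed(1)[OF p] yp by simp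
  show ?thesis
  proof (rule R_two_nz[OF ab(3) h ab(1,2)])
    assume "\<not> X.nz b" "rat_eq X h a"
    then show ?thesis using ord(1) X.ord_cong[of h a p] by simp
  next
    assume na: "\<not> X.nz a" and nb: "X.nz b" and hb: "rat_eq X h (\<lambda>q. b q * yn p q)"
    obtain k where k: "X.ord p b = int (ram p) * k" using ev[OF ab(2) nb] by blast
    have "0 \<le> X.ord p b + X.ord p (yn p)" using ord(1) X.ord_cong[OF hb, of p] b_ord[OF nb] by simp
    then have "0 \<le> X.ord p b" using k fixed nfixed by (cases "s p = p") auto
    then show ?thesis using na by blast
  next
    assume na: "X.nz a" and nb: "X.nz b"
    have nby: "X.nz (\<lambda>q. b q * yn p q)" by (rule X.nz_mult[OF nb yn_nz])
    obtain i where i: "X.ord p a = int (ram p) * i" using ev[OF ab(1) na] by blast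
    obtain j where j: "X.ord p b = int (ram p) * j" using ev[OF ab(2) nb] by blast
    show ?thesis
    proof (cases "s p = p")
      case True
      then have r: "ram p = 2" "X.ord p (yn p) = 1" using fixed by auto
      have "X.ord p a = 2 * i" "X.ord p (\<lambda>q. b q * yn p q) = 2 * j + 1" using b_ord[OF nb] r i j by simp_all
      \<comment> \<open>Orders of functions of x are even at a ramification point, while
        \<open>yn p\<close> has order 1.\<close>
      moreover have "2 * i \<noteq> 2 * j + 1" by presburger
      ultimately consider "X.ord p a < X.ord p (\<lambda>q. b q * yn p q)" | "X.ord p (\<lambda>q. b q * yn p q) < X.ord p a"
        by linarith
      then show ?thesis
      proof cases
        case 1
        then have "X.ord p h = X.ord p a"
          using X.ord_add_less(2)[OF p na nby] X.ord_cong[OF ab(3)] by simp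
        then show ?thesis using 1 ord(1) b_ord[OF nb] r j by simp
      next
        case 2
        then have "X.ord p h = X.ord p (\<lambda>q. b q * yn p q)"
          using X.ord_add_less(2)[OF p nby na] X.ord_cong[OF sum_swap_eq[OF ab(3)]] by simp
        then show ?thesis using 2 ord(1) b_ord[OF nb] r j by simp
      qed
    next
      case False
      \<comment> \<open>The worst pole of the two components. If n < 0, scaling by the power -n of a
        base uniformizer makes at least one component a unit at p but lets h vanish at both
        points.\<close>
      define n where "n = min (X.ord p a) (X.ord p b)"
      have sp: "s p \<in> X" "\<pi> (s p) = \<pi> p" using s_in[OF p] pi_s[OF p] by auto
      have r: "ram p = 1" "ram (s p) = 1"
        using ram_eq_fixed[OF p] ram_eq_fixed[OF sp(1)] False s_s[OF p] by auto
      show ?thesis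
      proof (rule ccontr)
        assume "\<not> ?thesis"
        then have n: "n < 0" using na nb unfolding n_def by auto
        obtain \<sigma> where \<sigma>: "R \<sigma>" "X.nz \<sigma>" "\<And>q. q \<in> X \<Longrightarrow> \<pi> q = \<pi> p \<Longrightarrow> X.ord q \<sigma> = int (ram q)"
          using ex_base_uniformizer[of p] by blast
        define \<tau> where "\<tau> = (\<lambda>q. \<sigma> q powi (- n))"
        have \<tau>: "R \<tau>" "X.nz \<tau>" unfolding \<tau>_def by (rule R_powi[OF \<sigma>(1)], rule X.nz_powi[OF \<sigma>(2)])
        have \<tau>ord: "X.ord p \<tau> = - n" "X.ord (s p) \<tau> = - n"
          unfolding \<tau>_def using X.ord_powi[OF _ \<sigma>(2)] \<sigma>(3) p sp r by simp_all
        define a1 where "a1 = (\<lambda>q. a q * \<tau> q)"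
        define b1 where "b1 = (\<lambda>q. b q * \<tau> q)"
        have R1: "R a1" "R b1" unfolding a1_def b1_def by (intro R_mult ab \<tau>)+
        have n1: "X.nz a1" "X.nz b1" unfolding a1_def b1_def by (intro X.nz_mult na nb \<tau>)+
        have o1: "X.ord p a1 = X.ord p a - n" "X.ord p b1 = X.ord p b - n"
          unfolding a1_def b1_def using X.ord_mult[OF p na \<tau>(2)] X.ord_mult[OF p nb \<tau>(2)] \<tau>ord by simp_all
        then have "0 \<le> X.ord p a1" "0 \<le> X.ord p b1" unfolding n_def by auto
        then obtain \<alpha> \<beta> where \<alpha>: "X.hasval p a1 \<alpha>" and \<beta>: "X.hasval p b1 \<beta>"
          using X.ord_hasval(1)[OF p] n1 by metis
        have \<alpha>q: "X.hasval (s p) a1 \<alpha>" and \<beta>q: "X.hasval (s p) b1 \<beta>"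
          by (rule R_hasval[OF R1(1) p sp \<alpha>], rule R_hasval[OF R1(2) p sp \<beta>])
        have "X.ord (s p) (yn p) = 0" using ord_yn[OF sp] eps_not_fixed(1)[OF p False] by simp
        then obtain c' where c': "X.hasval (s p) (yn p) c'" using X.ord_0_hasval[OF sp(1) yn_nz] by blast
        have "X.ord p (yn p) = 0" using nfixed[OF False] by blast
        then obtain c where c: "X.hasval p (yn p) c" using X.ord_0_hasval[OF p yn_nz] by blast
        have cc: "c \<noteq> c'" by (rule eps_not_fixed(2)[OF p False c c'])
        have nh: "X.nz (\<lambda>q. h q * \<tau> q)" by (rule X.nz_mult[OF h \<tau>(2)])
        have heq: "rat_eq X (\<lambda>q. a1 q + b1 q * yn p q) (\<lambda>q. h q * \<tau> q)"
          using ab(3) unfolding X.rat_eq_ae a1_def b1_def by eventually_elim (simp add: algebra_simps)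
        have "0 < X.ord p (\<lambda>q. h q * \<tau> q)" "0 < X.ord (s p) (\<lambda>q. h q * \<tau> q)"
          using X.ord_mult[OF p h \<tau>(2)] X.ord_mult[OF sp(1) h \<tau>(2)] \<tau>ord n ord by simp_all
        then have h0: "X.hasval p (\<lambda>q. h q * \<tau> q) 0" "X.hasval (s p) (\<lambda>q. h q * \<tau> q) 0"
          using X.ord_hasval(2)[OF p nh] X.ord_hasval(2)[OF sp(1) nh] by blast+
        have "X.hasval p (\<lambda>q. h q * \<tau> q) (\<alpha> + \<beta> * c)"
          by (rule X.hasval_cong[OF X.hasval_add[OF \<alpha> X.hasval_mult[OF \<beta> c]] heq])
        then have 1: "\<alpha> + \<beta> * c = 0" using X.hasval_unique[OF _ h0(1) p] by blast
        have "X.hasval (s p) (\<lambda>q. h q * \<tau> q) (\<alpha> + \<beta> * c')"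
          by (rule X.hasval_cong[OF X.hasval_add[OF \<alpha>q X.hasval_mult[OF \<beta>q c']] heq])
        then have 2: "\<alpha> + \<beta> * c' = 0" using X.hasval_unique[OF _ h0(2) sp(1)] by blast
        \<comment> \<open>Two linear equations in the values \<alpha>, \<beta> with distinct
          coefficients c, \<open>c'\<close> force both to vanish, against the minimality of
          n.\<close>
        have "\<beta> * (c - c') = (\<alpha> + \<beta> * c) - (\<alpha> + \<beta> * c')" by (simp add: algebra_simps)
        then have "\<beta> = 0" using 1 2 cc by simp
        then have "\<alpha> = 0" using 1 by simp
        have "0 < X.ord p a1" "0 < X.ord p b1"
          using X.ord_hasval(2)[OF p n1(1)] X.ord_hasval(2)[OF p n1(2)] \<alpha> \<beta> \<open>\<alpha> = 0\<close> \<open>\<beta> = 0\<close> by simp_all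
        then show False using o1 unfolding n_def by auto
      qed
    qed
  qed
qed

end

section \<open>Principal divisors of polynomials, and the involution\<close>

context double_cover
begin

definition poly_div :: "complex poly \<Rightarrow> 'n proj_space \<Rightarrow> int" where
  "poly_div A p = (if p \<in> X then X.ord p (\<lambda>q. poly A (x q)) else 0)"

text \<open>The divisor of x - a is the fiber over a minus the fiber over infinity, both of degree
  2.\<close>

lemma poly_div_degree:
  assumes "A \<noteq> 0"
  shows "poly_div A \<in> divisors X \<and> divisor_degree (poly_div A) = 0"
  using assms
proof (induction A rule: complex_poly_linear_induct)
  case (const c)
  then have "poly_div [:c:] = (\<lambda>_. 0)" by (auto simp: poly_div_def)
  then show ?case by (simp add: divisors_def divisor_degree_def)
next
  case (linear a A)
  define D where "D = (\<lambda>p. 1 * fib (P1_point a) p + (-1) * fib P1_inf p)"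
  have D1: "D \<in> divisors X" unfolding D_def by (rule divisors_add[OF fib_divisor fib_divisor])
  have "divisor_degree D = divisor_degree (\<lambda>p. 1 * fib (P1_point a) p) + divisor_degree (\<lambda>p. (-1) * fib P1_inf p)"
    unfolding D_def by (rule divisor_degree_add[OF fib_divisor fib_divisor])
  then have D2: "divisor_degree D = 0" unfolding fib_degree by simp
  have "poly_div ([:-a, 1:] * A) p = D p + poly_div A p" for p
  proof (cases "p \<in> X")
    case True
    have "\<pi> p = P1_point a \<longleftrightarrow> fin p \<and> x p = a"
    proof
      assume "fin p \<and> x p = a"
      then show "\<pi> p = P1_point a" using P1_coord_inj[OF _ P1_point(1)] P1_point(2) unfolding fin_def x_def by metis
    qed (simp add: fin_def x_def P1_point)
    moreover have "(\<lambda>q. poly ([:-a, 1:] * A) (x q)) = (\<lambda>q. (x q - a) * poly A (x q))"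
      by (simp add: algebra_simps)
    ultimately show ?thesis
      using True X.ord_mult[OF True x_diff_nz poly_nz[OF linear.hyps], of a] ord_x_diff[OF True, of a]
      by (simp add: poly_div_def D_def fib_def fin_def)
  qed (simp add: poly_div_def D_def fib_def)
  then have "poly_div ([:-a, 1:] * A) = (\<lambda>p. D p + poly_div A p)" by blast
  then show ?case using linear.IH D2 divisors_add[OF D1, of "poly_div A"] divisor_degree_add[OF D1, of "poly_div A"] by simp
qed

lemma ae_swap:
  assumes "eventually P X.ae" shows "eventually (\<lambda>p. P (s p)) X.ae"
proof -
  have "{p\<in>X. \<not> P (s p)} \<subseteq> s ` {q\<in>X. \<not> P q}"
  proof
    fix p assume p: "p \<in> {p\<in>X. \<not> P (s p)}"
    then have "s p \<in> {q\<in>X. \<not> P q}" "p = s (s p)" using s_in s_s by auto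
    then show "p \<in> s ` {q\<in>X. \<not> P q}" by blast
  qed
  then show ?thesis using assms unfolding X.eventually_ae using finite_subset by blast
qed

lemma R_swap: assumes "R a" shows "rat_eq X (\<lambda>p. a (s p)) a"
proof -
  obtain A C where AC: "C \<noteq> 0" "rat_eq X a (\<lambda>p. poly A (x p) / poly C (x p))" using assms by (rule R_E)
  show ?thesis
    using ae_swap[OF AC(2)[unfolded X.rat_eq_ae]] AC(2) X.eventually_ae_X unfolding X.rat_eq_ae
    by eventually_elim (simp add: x_s)
qed

end

text \<open>Coefficients of a pair of polynomials A, B are indexed by a disjoint sum, so that A F1 +
  B F2 is one linear combination.\<close>

lemma sum_poly_Plus:
  fixes F1 F2 z :: complex and c :: "nat + nat \<Rightarrow> complex"
  shows "(\<Sum>i\<in>{..k} <+> {..l}. c i * (case i of Inl i \<Rightarrow> z ^ i * F1 | Inr i \<Rightarrow> z ^ i * F2)) =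
    poly (\<Sum>i\<le>k. monom (c (Inl i)) i) z * F1 + poly (\<Sum>i\<le>l. monom (c (Inr i)) i) z * F2"
  by (subst sum.Plus) (simp_all add: poly_sum poly_monom sum_distrib_right mult.assoc)

section \<open>The genus and the number of fixed points\<close>

context hyperelliptic_model
begin

text \<open>Regularity of both components at finite points makes them polynomials; regularity over
  infinity, after dividing h by x^k, bounds their degrees. The second bound is smaller by
  \<open>\<delta>\<close>, the pole that y itself contributes.\<close>

lemma kF_decomposition:
  assumes h: "h \<in> X.L (kF k)" and k: "\<delta> \<le> k"
  shows "\<exists>A B. degree A \<le> k \<and> degree B \<le> k - \<delta> \<and> rat_eq X h (\<lambda>q. poly A (x q) + poly B (x q) * y q)"
proof (cases "X.nz h")
  case False
  then have "rat_eq X h (\<lambda>_. 0)" using X.nz_cases[OF X.L_rational[OF h]] by blast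
  then show ?thesis by (intro exI[of _ 0]) simp
next
  case True
  obtain a b where ab: "R a" "R b" "rat_eq X h (\<lambda>p. a p + b p * y p)"
    using y_gen X.L_rational[OF h] unfolding generator_def by blast
  have fin: "(X.nz a \<longrightarrow> 0 \<le> X.ord p a) \<and> (X.nz b \<longrightarrow> 0 \<le> X.ord p b)" if p: "p \<in> X" "fin p" for p
  proof (rule regular_components[OF p(1) ab(1,2) _ True])
    show "rat_eq X h (\<lambda>q. a q + b q * yn p q)" using ab(3) p(2) by (simp add: yn_def scale_def)
    show "0 \<le> X.ord p h" by (rule kF_D(1)[OF h True p])
    show "0 \<le> X.ord (s p) h"
      by (rule kF_D(1)[OF h True s_in[OF p(1)]]) (use p fin_fiber(1)[OF pi_s[OF p(1)]] in simp)
  qed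
  obtain A where A: "rat_eq X a (\<lambda>p. poly A (x p))" using R_regular_poly[OF ab(1)] fin by blast
  obtain B where B: "rat_eq X b (\<lambda>p. poly B (x p))" using R_regular_poly[OF ab(2)] fin by blast
  obtain p where p: "p \<in> X" "\<not> fin p" by (rule ex_inf)
  \<comment> \<open>This factor cancels the pole of h over infinity, making regularity there a
    statement about degrees.\<close>
  define \<tau> where "\<tau> = (\<lambda>q. inverse (x q) ^ k)"
  have \<tau>: "R \<tau>" "X.nz \<tau>" unfolding \<tau>_def
    by (rule R_power[OF R_inverse[OF R_x]], rule X.nz_power[OF X.nz_inverse[OF x_nz]])
  have \<tau>ord: "X.ord q \<tau> = int k * int (ram q)" if "q \<in> X" "\<not> fin q" for q
    unfolding \<tau>_def using X.ord_power[OF that(1) X.nz_inverse[OF x_nz]] X.ord_inverse[OF that(1) x_nz] ord_x_inf[OF that] by simp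
  \<comment> \<open>Over infinity \<open>yn p\<close> is y divided by x^\<delta>, so the coefficient
    of \<open>yn p\<close> carries the inverse of that factor.\<close>
  define b' where "b' = (\<lambda>q. b q * \<tau> q * inverse (scale p q))"
  have "(X.nz (\<lambda>q. a q * \<tau> q) \<longrightarrow> 0 \<le> X.ord p (\<lambda>q. a q * \<tau> q)) \<and> (X.nz b' \<longrightarrow> 0 \<le> X.ord p b')"
  proof (rule regular_components[OF p(1)])
    show "R (\<lambda>q. a q * \<tau> q)" "R b'" unfolding b'_def by (intro R_mult ab \<tau> R_inverse scale_R)+
    show "X.nz (\<lambda>q. h q * \<tau> q)" by (rule X.nz_mult[OF True \<tau>(2)])
    show "rat_eq X (\<lambda>q. h q * \<tau> q) (\<lambda>q. a q * \<tau> q + b' q * yn p q)"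
      using ab(3) X.nz_nonzero[OF scale_nz[of p]] unfolding X.rat_eq_ae b'_def yn_def
      by eventually_elim (simp add: algebra_simps)
    have "0 \<le> X.ord q (\<lambda>q. h q * \<tau> q)" if q: "q \<in> X" "\<not> fin q" for q
      using X.ord_mult[OF q(1) True \<tau>(2)] \<tau>ord[OF q] kF_D(2)[OF h True q] by simp
    then show "0 \<le> X.ord p (\<lambda>q. h q * \<tau> q)" "0 \<le> X.ord (s p) (\<lambda>q. h q * \<tau> q)"
      using p s_in[OF p(1)] fin_fiber(1)[OF pi_s[OF p(1)]] by simp_all
  qed
  note inf = this
  have "degree A \<le> k"
  proof (cases "A = 0")
    case False
    have na: "X.nz a" by (rule X.nz_cong[OF poly_nz[OF False] X.eqv_sym[OF A]])
    have "0 \<le> X.ord p a + X.ord p \<tau>" using inf X.nz_mult[OF na \<tau>(2)] X.ord_mult[OF p(1) na \<tau>(2)] by simp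
    then have "int (ram p) * int (degree A) \<le> int (ram p) * int k"
      using \<tau>ord[OF p] X.ord_cong[OF A, of p] ord_poly[OF False p(1)] p(2) by (simp add: mult.commute)
    then show ?thesis using ram_pos[OF p(1)] by (simp add: mult_le_cancel_left)
  qed simp
  moreover have "degree B \<le> k - \<delta>"
  proof (cases "B = 0")
    case False
    have nb: "X.nz b" by (rule X.nz_cong[OF poly_nz[OF False] X.eqv_sym[OF B]])
    note nbt = X.nz_mult[OF nb \<tau>(2)]
    note ns = X.nz_inverse[OF scale_nz[of p]]
    have "0 \<le> X.ord p b'" using inf X.nz_mult[OF nbt ns] unfolding b'_def by blast
    then have "0 \<le> X.ord p b + X.ord p \<tau> - X.ord p (scale p)"
      unfolding b'_def using X.ord_mult[OF p(1) nbt ns] X.ord_mult[OF p(1) nb \<tau>(2)] X.ord_inverse[OF p(1) scale_nz] by simp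
    then have "int (ram p) * (int (degree B) + int \<delta>) \<le> int (ram p) * int k"
      using \<tau>ord[OF p] X.ord_cong[OF B, of p] ord_poly[OF False p(1)] ord_scale[OF p(1) refl] p(2)
      by (simp add: algebra_simps)
    then have "int (degree B) + int \<delta> \<le> int k" using ram_pos[OF p(1)] by (simp add: mult_le_cancel_left)
    then show ?thesis by simp
  qed simp
  moreover have "rat_eq X h (\<lambda>q. poly A (x q) + poly B (x q) * y q)"
    using ab(3) A B unfolding X.rat_eq_ae by eventually_elim simp
  ultimately show ?thesis by blast
qed

text \<open>The space \<open>L(kF)\<close> with k = \<open>\<delta>\<close> is spanned by the
  \<delta> + 1 powers of x and y alone. Riemann's inequality 2\<delta> + 1 - g \<le> \<delta> + 2
  gives the bound.\<close>

lemma delta_le: "\<delta> \<le> g + 1"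
proof -
  obtain l b where lb: "X.indep {..<l} b" "\<And>i. i < l \<Longrightarrow> b i \<in> X.L (kF \<delta>)"
      "divisor_degree (kF \<delta>) + 1 - int g \<le> int l"
    using X.genus_lower[OF genus fib_divisor] by blast
  define F where "F = (\<lambda>i q. case i of Inl i \<Rightarrow> x q ^ i * 1 | Inr i \<Rightarrow> x q ^ i * y q)"
  have "\<forall>i\<in>{..<l}. \<exists>c. rat_eq X (b i) (\<lambda>q. \<Sum>j\<in>{..\<delta>} <+> {..\<delta> - \<delta>}. c j * F j q)"
  proof
    fix i assume "i \<in> {..<l}"
    then have "b i \<in> X.L (kF \<delta>)" using lb(2) by simp
    from kF_decomposition[OF this order_refl] obtain A B where AB: "degree A \<le> \<delta>" "degree B \<le> \<delta> - \<delta>"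
      "rat_eq X (b i) (\<lambda>q. poly A (x q) + poly B (x q) * y q)" by blast
    define c where "c = case_sum (coeff A) (coeff B)"
    have "(\<Sum>j\<in>{..\<delta>} <+> {..\<delta> - \<delta>}. c j * F j q) = poly A (x q) + poly B (x q) * y q" for q
      unfolding F_def sum_poly_Plus c_def using poly_sum_coeff[OF AB(1)] poly_sum_coeff[OF AB(2)]
      by (simp add: poly_sum poly_monom)
    then show "\<exists>c. rat_eq X (b i) (\<lambda>q. \<Sum>j\<in>{..\<delta>} <+> {..\<delta> - \<delta>}. c j * F j q)"
      using AB(3) by (intro exI[of _ c]) simp
  qed
  from bchoice[OF this] obtain c where c: "\<And>i. i \<in> {..<l} \<Longrightarrow>
      rat_eq X (b i) (\<lambda>q. \<Sum>j\<in>{..\<delta>} <+> {..\<delta> - \<delta>}. c i j * F j q)" by blast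
  have "card {..<l} \<le> card ({..\<delta>} <+> {..\<delta> - \<delta>})"
    by (rule X.card_indep_le_span[OF _ _ lb(1) c]) auto
  then have "l \<le> \<delta> + 2" by (simp add: card_Plus)
  then show ?thesis using lb(3) fib_degree[of "int \<delta>" P1_inf] by simp
qed

lemma y_kF: "y \<in> X.L (kF \<delta>)"
proof (rule kF_I[OF y_rational])
  fix p assume p: "p \<in> X" "fin p"
  have "0 \<le> 2 * X.ord p y" using ord_y[OF p(1)] p(2) by simp
  then show "0 \<le> X.ord p y" by simp
next
  fix p assume p: "p \<in> X" "\<not> fin p"
  have "int (ram p) * int (degree f) \<le> int (ram p) * (2 * int \<delta>)"
    unfolding \<delta>_def by (intro mult_left_mono) auto
  then show "- (int \<delta> * int (ram p)) \<le> X.ord p y" using ord_y[OF p(1)] p(2) by (simp add: algebra_simps)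
qed

lemma poly_y_independent:
  assumes "rat_eq X (\<lambda>q. poly A (x q) + poly B (x q) * y q) (\<lambda>_. 0)"
  shows "A = 0" "B = 0"
proof -
  show B: "B = 0"
  proof (rule ccontr)
    assume B: "B \<noteq> 0"
    have "rat_eq X y (\<lambda>p. poly (- A) (x p) / poly B (x p))"
      using assms X.nz_nonzero[OF poly_nz[OF B]] unfolding X.rat_eq_ae
      by eventually_elim (simp add: field_simps eq_neg_iff_add_eq_0)
    then show False using R_I[OF B] y_non_R by blast
  qed
  show "A = 0" by (rule poly_zero) (use assms B in simp)
qed

text \<open>The upper bound holds only above \<open>D0\<close>, which may have finite points outside
  every kF. Adding the divisor of G(x), of degree 0, remedies this, and division by G carries
  \<open>L(kF)\<close> over. Counting gives (k + 1) + (k - \<delta> + 1) \<le> 2k + 1 - g.\<close>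

lemma delta_ge: "g + 1 \<le> \<delta>"
proof -
  obtain D0 where D0: "D0 \<in> divisors X"
    and up: "\<And>D. D \<in> divisors X \<Longrightarrow> (\<And>p. D0 p \<le> D p) \<Longrightarrow>
       \<exists>m. X.dimle (X.L D) m \<and> int m = divisor_degree D + 1 - int g"
    by (rule X.genus_upper[OF genus]) blast
  define Z where "Z = {p. D0 p \<noteq> 0}"
  have Z: "finite Z" "Z \<subseteq> X" using D0 unfolding Z_def divisors_def by auto
  define m where "m = nat (\<Sum>p\<in>Z. \<bar>D0 p\<bar>)"
  have m: "D0 p \<le> int m" for p
  proof (cases "p \<in> Z")
    case True
    have "\<bar>D0 p\<bar> \<le> (\<Sum>p\<in>Z. \<bar>D0 p\<bar>)" by (rule member_le_sum[OF True _ Z(1)]) simp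
    then show ?thesis unfolding m_def by simp
  qed (simp add: Z_def)
  define G where "G = (\<Prod>z\<in>x ` Z. [:-z, 1:] ^ m)"
  have G: "G \<noteq> 0" "\<And>z. z \<in> x ` Z \<Longrightarrow> m \<le> order z G"
    unfolding G_def using prod_linear_power_order[of "x ` Z"] Z(1) by auto
  \<comment> \<open>Over infinity the divisor of G takes away \<open>degree G\<close> fibers,
    leaving m + \<delta>; the part m dominates \<open>D0\<close>, and k \<ge> \<delta> leaves room
    for y.\<close>
  define k where "k = degree G + m + \<delta>"
  define D1 where "D1 = (\<lambda>p. kF k p + poly_div G p)"
  have D1: "D1 \<in> divisors X" unfolding D1_def
    using poly_div_degree[OF G(1)] by (intro divisors_add fib_divisor) blast
  have D1deg: "divisor_degree D1 = 2 * int k" unfolding D1_def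
    using divisor_degree_add[OF fib_divisor, of "poly_div G" "int k" P1_inf] poly_div_degree[OF G(1)]
      fib_degree[of "int k" P1_inf] by simp
  have le: "D0 p \<le> D1 p" for p
  proof (cases "p \<in> X")
    case False
    then have "D0 p = 0" using Z(2) by (auto simp: Z_def)
    then show ?thesis using False by (simp add: D1_def poly_div_def fib_def)
  next
    case X: True
    note r = ram_pos[OF X]
    show ?thesis
    proof (cases "fin p")
      case True
      have o: "D1 p = int (ram p) * int (order (x p) G)"
        unfolding D1_def using kF_eq[OF X, of k] ord_poly[OF G(1) X] True X by (simp add: poly_div_def)
      show ?thesis
      proof (cases "p \<in> Z")
        case True
        then have "int m \<le> int (order (x p) G)" using G(2) by simp
        also have "\<dots> \<le> int (ram p) * int (order (x p) G)" using r by (simp add: mult_le_cancel_right1)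
        finally show ?thesis using m[of p] o by simp
      qed (use o in \<open>simp add: Z_def\<close>)
    next
      case False
      have o: "D1 p = int (ram p) * (int m + int \<delta>)"
        unfolding D1_def using kF_eq[OF X, of k] ord_poly[OF G(1) X] False X
        by (simp add: poly_div_def k_def algebra_simps)
      have "int m \<le> 1 * (int m + int \<delta>)" by simp
      also have "\<dots> \<le> int (ram p) * (int m + int \<delta>)" using r by (intro mult_right_mono) auto
      finally show ?thesis using m[of p] o by simp
    qed
  qed
  obtain M where M: "X.dimle (X.L D1) M" "int M = 2 * int k + 1 - int g" using up[OF D1 le] D1deg by auto
  define Q where "Q = (\<lambda>q. inverse (poly G (x q)))"
  have Q: "X.nz Q" unfolding Q_def by (rule X.nz_inverse[OF poly_nz[OF G(1)]])
  define F where "F = (\<lambda>i q. case i of Inl i \<Rightarrow> x q ^ i * Q q | Inr i \<Rightarrow> x q ^ i * (y q * Q q))"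
  let ?I = "{..k} <+> {..k - \<delta>}"
  have div: "(\<lambda>q. h q * Q q) \<in> X.L D1" if h: "h \<in> X.L (kF k)" for h
  proof (rule X.L_I[OF X.rational_mult[OF X.L_rational[OF h] X.nz_rational[OF Q]]])
    fix p assume n: "X.nz (\<lambda>q. h q * Q q)" and p: "p \<in> X"
    have "rat_eq X (\<lambda>q. (h q * Q q) * poly G (x q)) h"
      using X.nz_nonzero[OF poly_nz[OF G(1)]] unfolding X.rat_eq_ae Q_def by eventually_elim simp
    then have hn: "X.nz h" by (rule X.nz_cong[OF X.nz_mult[OF n poly_nz[OF G(1)]]])
    show "- D1 p \<le> X.ord p (\<lambda>q. h q * Q q)"
      using X.ord_mult[OF p hn Q] X.ord_inverse[OF p poly_nz[OF G(1)]] X.L_ord[OF h hn p] p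
      by (simp add: D1_def poly_div_def Q_def)
  qed
  have mem: "F i \<in> X.L D1" if i: "i \<in> ?I" for i
  proof (cases i)
    case (Inl j)
    then have "(\<lambda>q. poly (monom 1 j) (x q)) \<in> X.L (kF k)" using i by (intro poly_kF) (auto simp: degree_monom_eq)
    from div[OF this] show ?thesis by (simp add: F_def Inl poly_monom)
  next
    case (Inr j)
    then have "degree (monom (1::complex) j) + \<delta> \<le> k" using i by (auto simp: degree_monom_eq k_def)
    from div[OF kF_poly_mult[OF y_kF this]] show ?thesis by (simp add: F_def Inr poly_monom mult.assoc)
  qed
  have "X.indep ?I F" unfolding X.indep_def
  proof (intro allI impI ballI)
    fix c i assume c: "rat_eq X (\<lambda>q. \<Sum>i\<in>?I. c i * F i q) (\<lambda>_. 0)" and i: "i \<in> ?I"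
    define A where "A = (\<Sum>i\<le>k. monom (c (Inl i)) i)"
    define B where "B = (\<Sum>i\<le>k - \<delta>. monom (c (Inr i)) i)"
    have sum: "(\<Sum>i\<in>?I. c i * F i q) = poly A (x q) * Q q + poly B (x q) * (y q * Q q)" for q
      unfolding F_def A_def B_def by (rule sum_poly_Plus)
    have "rat_eq X (\<lambda>q. poly A (x q) + poly B (x q) * y q) (\<lambda>_. 0)"
      using c X.nz_nonzero[OF Q] unfolding sum X.rat_eq_ae
    proof eventually_elim
      case (elim q)
      have "(poly A (x q) + poly B (x q) * y q) * Q q = 0" using elim(1) by (simp add: algebra_simps)
      then show ?case using elim(2) by simp
    qed
    from poly_y_independent[OF this] have AB: "A = 0" "B = 0" .
    show "c i = 0"
    proof (cases i)
      case (Inl j)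
      then have "coeff A j = c i" using i by (auto simp: A_def coeff_sum)
      then show ?thesis using AB by simp
    next
      case (Inr j)
      then have "coeff B j = c i" using i by (auto simp: B_def coeff_sum)
      then show ?thesis using AB by simp
    qed
  qed
  from X.dimleD[OF M(1) _ this mem] have "card ?I \<le> M" by simp
  then have "k + 1 + (k - \<delta> + 1) \<le> M" by (simp add: card_Plus)
  then show ?thesis using M(2) unfolding k_def by simp
qed

lemma eps_iff: "p \<in> X \<Longrightarrow> eps p = 1 \<longleftrightarrow> s p = p"
  using eps_fixed[of p] eps_not_fixed(1)[of p] by (cases "s p = p") simp_all

text \<open>Finite fixed points correspond to the roots of f, and infinity is a fixed point exactly
  when the degree of f is odd. Together there are 2\<delta> of them.\<close>

lemma card_fixed_points: "card {p\<in>X. s p = p} = 2 * g + 2"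
proof -
  let ?A = "{p\<in>X. s p = p \<and> fin p}" and ?B = "{p\<in>X. s p = p \<and> \<not> fin p}"
  have root: "order z f = 1 \<longleftrightarrow> poly f z = 0" for z
    using order_f[of z] order_eq_0_iff[OF f_nz, of z] by linarith
  have "bij_betw x ?A {z. poly f z = 0}"
  proof (rule bij_betwI')
    fix p q assume pq: "p \<in> ?A" "q \<in> ?A"
    show "x p = x q \<longleftrightarrow> p = q"
    proof
      assume "x p = x q"
      then have "\<pi> p = \<pi> q" using x_eq_pi pq by blast
      then have "q = p \<or> q = s p" using quot pq by blast
      then show "p = q" using pq by auto
    qed simp
  next
    fix p assume p: "p \<in> ?A"
    then have "eps p = 1" using eps_fixed by blast
    then show "x p \<in> {z. poly f z = 0}" using p root[of "x p"] by (simp add: eps_def)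
  next
    fix z assume z: "z \<in> {z. poly f z = 0}"
    obtain p where p: "p \<in> X" "fin p" "x p = z" by (rule ex_x)
    have "eps p = 1" using z p root[of z] by (simp add: eps_def)
    then show "\<exists>p\<in>?A. z = x p" using eps_iff[OF p(1)] p by blast
  qed
  note bij = this
  have A: "card ?A = degree f" using bij_betw_same_card[OF bij] card_roots_rsquarefree[OF f_squarefree] by simp
  have finA: "finite ?A" using bij_betw_finite[OF bij] poly_roots_finite[OF f_nz] by blast
  obtain p0 where p0: "p0 \<in> X" "\<not> fin p0" by (rule ex_inf)
  \<comment> \<open>Over infinity \<open>eps\<close> is 2\<delta> - deg f, which is 1 for odd degree
    and 0 for even degree; a fixed point is alone in its fiber.\<close>
  have B: "?B = (if odd (degree f) then {p0} else {})"
  proof -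
    have e: "eps p = 2 * \<delta> - degree f" if "\<not> fin p" for p using that by (simp add: eps_def)
    show ?thesis
    proof (cases "odd (degree f)")
      case True
      then have "2 * \<delta> - degree f = 1" unfolding \<delta>_def by presburger
      then have f0: "s p0 = p0" using e[OF p0(2)] eps_iff[OF p0(1)] by simp
      have "p = p0" if "p \<in> ?B" for p
      proof -
        have "\<pi> p0 = \<pi> p" using that p0(2) by (simp add: fin_def)
        then show ?thesis using quot[OF p0(1), of p] that f0 by auto
      qed
      then have "?B = {p0}" using p0 f0 by blast
      then show ?thesis using True by simp
    next
      case False
      then have "2 * \<delta> - degree f = 0" unfolding \<delta>_def by presburger
      then have "p \<notin> ?B" for p using e[of p] eps_fixed[of p] by fastforce
      then have "?B = {}" by blast
      then show ?thesis using False by simp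
    qed
  qed
  have AB: "{p\<in>X. s p = p} = ?A \<union> ?B" by auto
  have cB: "card ?B = (if odd (degree f) then 1 else 0)" unfolding B by simp
  have finB: "finite ?B" unfolding B by simp
  have "card {p\<in>X. s p = p} = card ?A + card ?B"
    unfolding AB by (rule card_Un_disjoint[OF finA finB]) blast
  also have "\<dots> = 2 * \<delta>" unfolding A cB \<delta>_def by presburger
  finally show ?thesis using delta_le delta_ge by simp
qed

text \<open>At almost all points y(p) and y(s p) have the same square f(x) but are different, so
  they are negatives of each other.\<close>

lemma y_swap: "rat_eq X (\<lambda>p. y (s p)) (\<lambda>p. - y p)"
proof -
  have "finite {p\<in>X. s p = p}" by (rule card_ge_0_finite) (simp add: card_fixed_points)
  then have nf: "\<forall>\<^sub>F p in X.ae. s p \<noteq> p" by (simp add: X.eventually_ae)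
  have v: "\<forall>\<^sub>F p in X.ae. X.hasval p y (y p)" by (rule X.rational_hasval[OF y_rational])
  show ?thesis
    using nf v ae_swap[OF v] y_sq[unfolded X.rat_eq_ae] ae_swap[OF y_sq[unfolded X.rat_eq_ae]] fin_ae X.eventually_ae_X
    unfolding X.rat_eq_ae
  proof eventually_elim
    case (elim p)
    have "yn p = y" using elim(6) by (simp add: yn_def scale_def)
    then have "y p \<noteq> y (s p)" using eps_not_fixed(2)[OF elim(7,1)] elim(2,3) by simp
    moreover have "y (s p) ^ 2 = y p ^ 2" using elim(4,5,7) by (simp add: x_s)
    ultimately show ?case by (auto simp: power2_eq_iff)
  qed
qed

text \<open>Anti-invariance kills the component in C(x), so Y = b yn. At a fixed point b has even
  order and \<open>yn p\<close> has order 1.\<close>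

lemma odd_anti_invariant:
  assumes Y: "X.nz Y" "rat_eq X (\<lambda>p. Y (s p)) (\<lambda>p. - Y p)" and p: "p \<in> X" "s p = p"
  shows "odd (X.ord p Y)"
proof -
  obtain a b where ab: "R a" "R b" "rat_eq X Y (\<lambda>q. a q + b q * yn p q)"
    using yn_gen[OF X.nz_rational[OF Y(1)], of p] by blast
  have ys: "rat_eq X (\<lambda>q. yn p (s q)) (\<lambda>q. - yn p q)"
    using y_swap R_swap[OF scale_R[of p]] unfolding X.rat_eq_ae yn_def by eventually_elim simp
  have "rat_eq X Y (\<lambda>q. b q * yn p q)"
    using ab(3) ae_swap[OF ab(3)[unfolded X.rat_eq_ae]] R_swap[OF ab(1)] R_swap[OF ab(2)] ys Y(2)
    unfolding X.rat_eq_ae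
  proof eventually_elim
    case (elim q)
    \<comment> \<open>The swap fixes a and b and negates yn; comparison with Y itself leaves 2a =
      0.\<close>
    have "- Y q = a q - b q * yn p q" using elim(2,3,4,5,6) by simp
    then have "2 * a q = 0" using elim(1) by (simp add: algebra_simps)
    then show ?case using elim(1) by simp
  qed
  note Yb = this
  have nb: "X.nz b"
  proof (rule ccontr)
    assume "\<not> X.nz b"
    then have "rat_eq X b (\<lambda>_. 0)" using X.nz_cases[OF R_rational[OF ab(2)]] by blast
    then have "rat_eq X Y (\<lambda>_. 0)" using Yb unfolding X.rat_eq_ae by eventually_elim simp
    then show False using Y(1) unfolding X.nz_def by blast
  qed
  have r: "ram p = 2" using ram_eq_fixed[OF p(1)] p(2) by simp
  obtain k where "X.ord p b = int (ram p) * k" using R_ord[OF ab(2) nb, of p] p(1) by blast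
  moreover have "X.ord p (yn p) = 1" using ord_yn[of p p] p(1) r eps_fixed[OF p] by simp
  ultimately have "X.ord p Y = 2 * k + 1"
    using X.ord_cong[OF Yb, of p] X.ord_mult[OF p(1) nb yn_nz] r by simp
  then show ?thesis by simp
qed

end

context double_cover
begin

theorem card_fixed: "card {p\<in>X. s p = p} = 2 * g + 2"
  using ex_model hyperelliptic_model.card_fixed_points by blast

theorem ex_anti_invariant: "\<exists>y. X.nz y \<and> rat_eq X (\<lambda>p. y (s p)) (\<lambda>p. - y p)"
  using ex_model hyperelliptic_model.y_nz hyperelliptic_model.y_swap by blast

theorem anti_invariant_odd:
  assumes "X.nz Y" "rat_eq X (\<lambda>p. Y (s p)) (\<lambda>p. - Y p)" "p \<in> X" "s p = p"
  shows "odd (X.ord p Y)"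
  using ex_model hyperelliptic_model.odd_anti_invariant[OF _ assms] by blast

end

section \<open>The ramification of a Frey-Kani covering\<close>

lemma filter_replicate_mset: "filter_mset P (replicate_mset k z) = (if P z then replicate_mset k z else {#})"
  by (induction k) auto

text \<open>Separates a fiber into exceptional points S, unramified points A, and a rest of index 2;
  only the size of the rest is unknown, and the index sum determines it.\<close>

lemma filter_image_mset_split:
  fixes \<rho> :: "'a \<Rightarrow> nat"
  assumes F: "finite F" and S: "S \<subseteq> F" and A: "A \<subseteq> F - S"
    and \<rho>: "\<And>r. r \<in> A \<Longrightarrow> \<rho> r = 1" "\<And>r. r \<in> F - S - A \<Longrightarrow> \<rho> r = 2"
  shows "filter_mset (\<lambda>e. e \<noteq> 1) (image_mset \<rho> (mset_set F)) =
      filter_mset (\<lambda>e. e \<noteq> 1) (image_mset \<rho> (mset_set S)) + replicate_mset (card (F - S - A)) 2"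
    and "(\<Sum>r\<in>F. \<rho> r) = card A + 2 * card (F - S - A) + (\<Sum>r\<in>S. \<rho> r)"
proof -
  define B where "B = F - S - A"
  have fin: "finite S" "finite A" "finite B" unfolding B_def using F S A finite_subset by blast+
  have FU: "F = S \<union> (A \<union> B)" unfolding B_def using S A by blast
  have dis: "S \<inter> (A \<union> B) = {}" "A \<inter> B = {}" unfolding B_def using A by blast+
  have "mset_set F = mset_set S + (mset_set A + mset_set B)"
    by (subst FU) (use fin dis in \<open>simp add: mset_set_Union\<close>)
  moreover have "image_mset \<rho> (mset_set A) = image_mset (\<lambda>_. 1) (mset_set A)"
    using \<rho>(1) fin by (intro image_mset_cong) auto
  moreover have "image_mset \<rho> (mset_set B) = image_mset (\<lambda>_. 2) (mset_set B)"
    using \<rho>(2) fin unfolding B_def by (intro image_mset_cong) auto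
  ultimately show "filter_mset (\<lambda>e. e \<noteq> 1) (image_mset \<rho> (mset_set F)) =
      filter_mset (\<lambda>e. e \<noteq> 1) (image_mset \<rho> (mset_set S)) + replicate_mset (card (F - S - A)) 2"
    by (simp add: image_mset_const_eq filter_replicate_mset flip: B_def)
  have "(\<Sum>r\<in>F. \<rho> r) = (\<Sum>r\<in>S. \<rho> r) + ((\<Sum>r\<in>A. \<rho> r) + (\<Sum>r\<in>B. \<rho> r))"
    by (subst FU) (use fin dis in \<open>simp add: sum.union_disjoint\<close>)
  moreover have "(\<Sum>r\<in>A. \<rho> r) = card A" "(\<Sum>r\<in>B. \<rho> r) = 2 * card B"
    using \<rho> unfolding B_def by simp_all
  ultimately show "(\<Sum>r\<in>F. \<rho> r) = card A + 2 * card (F - S - A) + (\<Sum>r\<in>S. \<rho> r)" by (simp flip: B_def)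
qed

lemma ex_sorted_enumeration:
  fixes a :: "'a \<Rightarrow> nat"
  assumes "finite S"
  obtains ts where "distinct ts" "set ts = S" "length ts = card S" "sorted_wrt (\<lambda>s t. a t \<le> a s) ts"
proof -
  obtain xs where xs: "set xs = S" "distinct xs" using finite_distinct_list[OF assms] by blast
  have "sorted_wrt (\<lambda>s t. a s \<le> a t) (sort_key a xs)" using sorted_sort_key[of a xs] by (simp add: sorted_map)
  then have "sorted_wrt (\<lambda>s t. a t \<le> a s) (rev (sort_key a xs))" by (simp add: sorted_wrt_rev)
  then show ?thesis using xs that[of "rev (sort_key a xs)"] distinct_card[OF xs(2)] by simp
qed

section \<open>Ramification indices of \<open>\<psi>\<close> and \<open>\<phi>\<close>\<close>

locale frey_kani = C: double_cover C \<pi>C 2 w + E: double_cover E \<pi>E 1 v +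
    psi: curve_covering C E \<psi> n + phi: curve_covering P1 P1 \<phi> n
  for C :: "'a::finite proj_space set" and \<pi>C w and E :: "'b::finite proj_space set" and \<pi>E v \<psi> \<phi> n +
  assumes even_n: "even n"
    and psi_w: "p \<in> C \<Longrightarrow> \<psi> (w p) = v (\<psi> p)"
    and phi_piC: "p \<in> C \<Longrightarrow> \<phi> (\<pi>C p) = \<pi>E (\<psi> p)"
begin

abbreviation e :: "'a proj_space \<Rightarrow> nat" where "e \<equiv> ram_index C E \<psi>"
abbreviation \<rho> :: "2 proj_space \<Rightarrow> nat" where "\<rho> \<equiv> ram_index P1 P1 \<phi>"
abbreviation fr :: "2 proj_space \<Rightarrow> nat multiset" where "fr \<equiv> fiber_ramification P1 P1 \<phi>"

text \<open>Both sides are the order at p of one pulled back uniformizer, computed along the two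
  paths of the commutative square.\<close>

lemma ram_compose:
  assumes p: "p \<in> C"
  shows "\<rho> (\<pi>C p) * ram_index C P1 \<pi>C p = ram_index E P1 \<pi>E (\<psi> p) * e p"
proof -
  obtain t where t: "uniformizer P1 (\<phi> (\<pi>C p)) t" using C.Y.uniformizer_exists by blast
  have tn: "C.Y.nz t" by (rule C.Y.uniformizer_nz[OF t]) simp
  have ot: "ord_at P1 (\<phi> (\<pi>C p)) t = 1" by (rule C.Y.ord_uniformizer[OF _ t]) simp
  have "ord_at C p (\<lambda>q. t (\<phi> (\<pi>C q))) = int (ram_index C P1 \<pi>C p) * ord_at P1 (\<pi>C p) (\<lambda>r. t (\<phi> r))"
    by (rule C.ord_pullback[OF p phi.nz_pullback[OF tn]])
  also have "ord_at P1 (\<pi>C p) (\<lambda>r. t (\<phi> r)) = int (\<rho> (\<pi>C p)) * ord_at P1 (\<phi> (\<pi>C p)) t"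
    by (rule phi.ord_pullback[OF _ tn]) simp
  finally have 1: "ord_at C p (\<lambda>q. t (\<phi> (\<pi>C q))) = int (\<rho> (\<pi>C p) * ram_index C P1 \<pi>C p)"
    using ot by (simp add: mult.commute)
  have "ord_at C p (\<lambda>q. t (\<pi>E (\<psi> q))) = int (e p) * ord_at E (\<psi> p) (\<lambda>r. t (\<pi>E r))"
    by (rule psi.ord_pullback[OF p E.nz_pullback[OF tn]])
  also have "ord_at E (\<psi> p) (\<lambda>r. t (\<pi>E r)) = int (ram_index E P1 \<pi>E (\<psi> p)) * ord_at P1 (\<pi>E (\<psi> p)) t"
    by (rule E.ord_pullback[OF psi.in_Y[OF p] tn])
  finally have 2: "ord_at C p (\<lambda>q. t (\<pi>E (\<psi> q))) = int (ram_index E P1 \<pi>E (\<psi> p) * e p)"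
    using ot phi_piC[OF p] by (simp add: mult.commute)
  have "rat_eq C (\<lambda>q. t (\<phi> (\<pi>C q))) (\<lambda>q. t (\<pi>E (\<psi> q)))"
    using C.X.eventually_ae_X unfolding C.X.rat_eq_ae by eventually_elim (simp add: phi_piC)
  from C.X.ord_cong[OF this, of p] show ?thesis using 1 2 by (simp only: of_nat_eq_iff)
qed

text \<open>A fixed point of w maps to a fixed point of v, so the indices of the two projections
  either agree or leave a factor 2 on the side of \<open>\<psi>\<close>.\<close>

lemma rho_eq:
  assumes p: "p \<in> C"
  shows "\<rho> (\<pi>C p) = (if w p \<noteq> p \<and> v (\<psi> p) = \<psi> p then 2 * e p else e p)"
proof -
  have "w p = p \<Longrightarrow> v (\<psi> p) = \<psi> p" using psi_w[OF p] by simp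
  then show ?thesis
    using ram_compose[OF p] C.ram_eq_fixed[OF p] E.ram_eq_fixed[OF psi.in_Y[OF p]] by (auto split: if_splits)
qed

text \<open>The points p and \<open>w p\<close> have the same image under \<open>\<pi>C\<close>, and
  the case distinction in \<open>rho_eq\<close> is the same for both.\<close>

lemma e_w: assumes p: "p \<in> C" shows "e (w p) = e p"
proof -
  note wp = C.s_in[OF p]
  have "w (w p) = w p \<longleftrightarrow> w p = p" using C.s_s[OF p] by auto
  moreover have "v (v (\<psi> p)) = v (\<psi> p) \<longleftrightarrow> v (\<psi> p) = \<psi> p" using E.s_s[OF psi.in_Y[OF p]] by auto
  ultimately show ?thesis
    using rho_eq[OF p] rho_eq[OF wp] C.pi_s[OF p] psi_w[OF p] by (auto split: if_splits)
qed

text \<open>A function on \<open>E\<close> that is anti-invariant under \<open>v\<close> pulls back to a function on \<open>C\<close> that is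
  anti-invariant under \<open>w\<close>, and anti-invariant functions have odd order at fixed points.\<close>

lemma e_odd: assumes p: "p \<in> C" "w p = p" shows "odd (e p)"
proof -
  obtain y where y: "E.X.nz y" "rat_eq E (\<lambda>q. y (v q)) (\<lambda>q. - y q)" using E.ex_anti_invariant by blast
  have "rat_eq C (\<lambda>q. y (\<psi> (w q))) (\<lambda>q. - y (\<psi> q))"
    using psi.eqv_pullback[OF y(2)] C.X.eventually_ae_X unfolding C.X.rat_eq_ae
    by eventually_elim (simp add: psi_w)
  from C.anti_invariant_odd[OF psi.nz_pullback[OF y(1)] this p]
  have "odd (int (e p) * ord_at E (\<psi> p) y)" using psi.ord_pullback[OF p(1) y(1)] by simp
  then show ?thesis by simp
qed

section \<open>Branch points of the two projections and the fibers of \<open>\<phi>\<close>\<close>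

definition Wp :: "2 proj_space set" where "Wp = \<pi>C ` {p\<in>C. w p = p}"
definition Tp :: "2 proj_space set" where "Tp = \<pi>E ` {q\<in>E. v q = q}"
text \<open>How many of the six branch points of \<open>\<pi>C\<close> lie over t; this distribution
  decides the type.\<close>

definition a :: "2 proj_space \<Rightarrow> nat" where "a t = card {r\<in>Wp. \<phi> r = t}"

lemma Wp_iff: assumes p: "p \<in> C" shows "\<pi>C p \<in> Wp \<longleftrightarrow> w p = p"
proof
  assume "\<pi>C p \<in> Wp"
  then obtain q where q: "q \<in> C" "w q = q" "\<pi>C q = \<pi>C p" unfolding Wp_def by auto
  then show "w p = p" using C.quot[OF q(1) p] by auto
qed (use p in \<open>auto simp: Wp_def\<close>)

lemma Tp_iff: assumes p: "p \<in> E" shows "\<pi>E p \<in> Tp \<longleftrightarrow> v p = p"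
proof
  assume "\<pi>E p \<in> Tp"
  then obtain q where q: "q \<in> E" "v q = q" "\<pi>E q = \<pi>E p" unfolding Tp_def by auto
  then show "v p = p" using E.quot[OF q(1) p] by auto
qed (use p in \<open>auto simp: Tp_def\<close>)

lemma phi_Tp: "p \<in> C \<Longrightarrow> \<phi> (\<pi>C p) \<in> Tp \<longleftrightarrow> v (\<psi> p) = \<psi> p"
  using Tp_iff[OF psi.in_Y] phi_piC by simp

lemma card_Wp: "card Wp = 6"
proof -
  have "inj_on \<pi>C {p\<in>C. w p = p}"
  proof (rule inj_onI)
    fix p q assume pq: "p \<in> {p\<in>C. w p = p}" "q \<in> {p\<in>C. w p = p}" "\<pi>C p = \<pi>C q"
    then have "q = p \<or> q = w p" using C.quot by blast
    then show "p = q" using pq by auto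
  qed
  then show ?thesis unfolding Wp_def using C.card_fixed by (simp add: card_image)
qed

lemma card_Tp: "card Tp = 4"
proof -
  have "inj_on \<pi>E {p\<in>E. v p = p}"
  proof (rule inj_onI)
    fix p q assume pq: "p \<in> {p\<in>E. v p = p}" "q \<in> {p\<in>E. v p = p}" "\<pi>E p = \<pi>E q"
    then have "q = p \<or> q = v p" using E.quot by blast
    then show "p = q" using pq by auto
  qed
  then show ?thesis unfolding Tp_def using E.card_fixed by (simp add: card_image)
qed

lemma finite_Wp: "finite Wp" by (rule card_ge_0_finite) (simp add: card_Wp)
lemma finite_Tp: "finite Tp" by (rule card_ge_0_finite) (simp add: card_Tp)

lemma Wp_Tp: "r \<in> Wp \<Longrightarrow> \<phi> r \<in> Tp"
proof -
  assume "r \<in> Wp"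
  then obtain p where p: "p \<in> C" "w p = p" "r = \<pi>C p" unfolding Wp_def by auto
  then show ?thesis using phi_Tp[OF p(1)] psi_w[OF p(1)] by simp
qed

lemma sum_a: "(\<Sum>t\<in>Tp. a t) = 6"
proof -
  have "(\<Sum>t\<in>Tp. \<Sum>r\<in>{r\<in>Wp. \<phi> r = t}. 1::nat) = (\<Sum>r\<in>Wp. 1)"
    by (rule sum.group[OF finite_Wp finite_Tp]) (use Wp_Tp in blast)
  then show ?thesis by (simp add: a_def card_Wp)
qed

text \<open>S collects the images of the points where \<open>\<psi>\<close> ramifies. Elsewhere over
  a branch point of \<open>\<pi>E\<close> the index is 1 at branch points of \<open>\<pi>C\<close>
  and 2 at all other points.\<close>

lemma fiber_profile:
  assumes t: "t \<in> Tp" and S: "S \<subseteq> {r. \<phi> r = t}"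
    and e1: "\<And>p. p \<in> C \<Longrightarrow> \<phi> (\<pi>C p) = t \<Longrightarrow> \<pi>C p \<notin> S \<Longrightarrow> e p = 1"
  shows "\<exists>k. fr t = filter_mset (\<lambda>e. e \<noteq> 1) (image_mset \<rho> (mset_set S)) + replicate_mset k 2 \<and>
    n = card ({r\<in>Wp. \<phi> r = t} - S) + 2 * k + (\<Sum>r\<in>S. \<rho> r)"
proof -
  let ?F = "fiber P1 \<phi> t" and ?A = "{r\<in>Wp. \<phi> r = t} - S"
  have F: "finite ?F" "S \<subseteq> ?F" "?A \<subseteq> ?F - S" using phi.finite_fiber[of t] S by (auto simp: fiber_def)
  have \<rho>: "\<rho> r = (if r \<in> Wp then 1 else 2)" if r: "r \<in> ?F - S" for r
  proof -
    obtain p where p: "p \<in> C" "\<pi>C p = r" using C.surj[of r] by blast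
    then have "e p = 1" using e1[OF p(1)] r by (auto simp: fiber_def)
    moreover have "v (\<psi> p) = \<psi> p" using phi_Tp[OF p(1)] p(2) r t by (auto simp: fiber_def)
    ultimately show ?thesis using rho_eq[OF p(1)] Wp_iff[OF p(1)] p(2) by simp
  qed
  have A: "\<And>r. r \<in> ?A \<Longrightarrow> \<rho> r = 1" "\<And>r. r \<in> ?F - S - ?A \<Longrightarrow> \<rho> r = 2"
    using \<rho> by (auto simp: fiber_def)
  note split = filter_image_mset_split[where \<rho> = \<rho>, OF F A]
  have "n = (\<Sum>r\<in>?F. \<rho> r)" using phi.sum_fiber[of t] by simp
  then show ?thesis unfolding fiber_ramification_def using split by blast
qed

text \<open>Away from the branch points of \<open>\<pi>E\<close> nothing doubles, so
  \<open>\<phi>\<close> inherits the indices of \<open>\<psi>\<close>.\<close>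

lemma fiber_profile_outside:
  assumes t: "t \<notin> Tp" and S: "S \<subseteq> {r. \<phi> r = t}"
    and e1: "\<And>p. p \<in> C \<Longrightarrow> \<phi> (\<pi>C p) = t \<Longrightarrow> \<pi>C p \<notin> S \<Longrightarrow> e p = 1"
  shows "fr t = filter_mset (\<lambda>e. e \<noteq> 1) (image_mset \<rho> (mset_set S))"
proof -
  let ?F = "fiber P1 \<phi> t"
  have F: "finite ?F" "S \<subseteq> ?F" "?F - S \<subseteq> ?F - S" using phi.finite_fiber[of t] S by (auto simp: fiber_def)
  have \<rho>: "\<rho> r = 1" if r: "r \<in> ?F - S" for r
  proof -
    obtain p where p: "p \<in> C" "\<pi>C p = r" using C.surj[of r] by blast
    then have "e p = 1" using e1[OF p(1)] r by (auto simp: fiber_def)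
    moreover have "v (\<psi> p) \<noteq> \<psi> p" using phi_Tp[OF p(1)] p(2) r t by (auto simp: fiber_def)
    ultimately show ?thesis using rho_eq[OF p(1)] p(2) by simp
  qed
  have "r \<in> ?F - S - (?F - S) \<Longrightarrow> \<rho> r = 2" for r by blast
  from filter_image_mset_split(1)[where \<rho> = \<rho>, OF F \<rho> this] show ?thesis unfolding fiber_ramification_def by simp
qed

text \<open>Over a point of \<open>Tp\<close> the degree is n = a t + 2k, and as n is even, so is
  \<open>a t\<close>.\<close>

lemma unramified_fiber:
  assumes "\<And>p. p \<in> C \<Longrightarrow> \<phi> (\<pi>C p) = t \<Longrightarrow> e p = 1"
  shows "t \<notin> Tp \<Longrightarrow> fr t = {#}"
    "t \<in> Tp \<Longrightarrow> \<exists>b. a t = 2 * b \<and> b \<le> n div 2 \<and> fr t = replicate_mset (n div 2 - b) 2"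
proof -
  show "t \<notin> Tp \<Longrightarrow> fr t = {#}" using fiber_profile_outside[of t "{}"] assms by simp
  assume t: "t \<in> Tp"
  obtain k where k: "fr t = replicate_mset k 2" "n = a t + 2 * k"
    using fiber_profile[OF t, of "{}"] assms by (auto simp: a_def)
  obtain m where m: "n = 2 * m" using even_n by blast
  show "\<exists>b. a t = 2 * b \<and> b \<le> n div 2 \<and> fr t = replicate_mset (n div 2 - b) 2"
  \<comment> \<open>With n = 2m the number b of pairs of branch points is m - k.\<close>
  proof (intro exI[of _ "m - k"] conjI)
    have "k \<le> m" "n div 2 = m" using k(2) m by arith+
    then show "fr t = replicate_mset (n div 2 - (m - k)) 2" using k(1) by simp
  qed (use k(2) m in arith)+
qed

lemma has_ramificationI:
  assumes "distinct qs" "map fr qs = map fiber_data_mset T"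
    and "\<forall>xs\<in>set T. \<forall>(m, k)\<in>set xs. k \<ge> 0" and "\<And>q. q \<notin> set qs \<Longrightarrow> fr q = {#}"
  shows "has_ramification P1 P1 \<phi> T"
  unfolding has_ramification_def using assms by (intro conjI exI[of _ qs]) auto

text \<open>The listed types fix an order of the fibers, whereas the enumeration puts the special
  fiber first; a permutation reconciles them.\<close>

lemma permuted_ramificationI:
  assumes ts: "distinct ts" "set ts = Tp" "\<And>q. q \<notin> Tp \<Longrightarrow> fr q = {#}"
    and qs: "mset qs = mset ts" "map fr qs = map fiber_data_mset T"
    and T: "\<forall>xs\<in>set T. \<forall>(m, k)\<in>set xs. k \<ge> 0"
  shows "has_ramification P1 P1 \<phi> T"
proof (rule has_ramificationI[OF _ qs(2) T])
  show "distinct qs" using ts(1) mset_eq_imp_distinct_iff[OF qs(1)] by blast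
  show "fr q = {#}" if "q \<notin> set qs" for q
    using ts(2) mset_eq_setD[OF qs(1)] that by (intro ts(3)) simp
qed

lemma int_half:
  assumes "n = 2 * m"
  shows "int n div 2 = int m" "(int n - 2) div 2 = int m - 1" "(int n - 4) div 2 = int m - 2"
    "(int n - 6) div 2 = int m - 3" "(int n - 8) div 2 = int m - 4" "(int n - 10) div 2 = int m - 5"
  using assms by simp_all

text \<open>Valid also for negative differences, where both sides are 0; this turns integer
  exponents into multiplicities.\<close>

lemma nat_int_diff: "nat (int m - numeral k) = m - numeral k" "nat (int m - 1) = m - 1"
  by (simp_all add: nat_minus_as_int)

text \<open>Index 2 is even, so \<open>p1\<close> is not fixed by w. Its image has index 2 as well
  and can only be \<open>p2\<close>; whether the two points lie in one fiber of
  \<open>\<psi>\<close> is irrelevant here, so Case II uses this too.\<close>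

lemma case_I_swap:
  assumes p: "p1 \<in> C" "p2 \<in> C" "e p1 = 2" "\<And>p. p \<in> C \<Longrightarrow> p \<noteq> p1 \<Longrightarrow> p \<noteq> p2 \<Longrightarrow> e p = 1"
  shows "w p1 = p2 \<and> p1 \<noteq> p2"
proof -
  have ne: "w p1 \<noteq> p1" using e_odd[OF p(1)] p(3) by auto
  moreover have "e (w p1) = 2" using e_w[OF p(1)] p(3) by simp
  then have "w p1 = p1 \<or> w p1 = p2" using p(4)[OF C.s_in[OF p(1)]] by fastforce
  ultimately show ?thesis by auto
qed

lemma special_enumeration:
  assumes t0: "t0 \<in> Tp"
  obtains t1 t2 t3 where "distinct [t0, t1, t2, t3]" "Tp = {t0, t1, t2, t3}" "a t2 \<le> a t1" "a t3 \<le> a t2"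
    "a t0 + a t1 + a t2 + a t3 = 6"
proof -
  obtain ts where ts: "distinct ts" "set ts = Tp - {t0}" "length ts = card (Tp - {t0})" "sorted_wrt (\<lambda>s t. a t \<le> a s) ts"
    by (rule ex_sorted_enumeration[of "Tp - {t0}" a]) (use finite_Tp in auto)
  have "length ts = 3" using ts(3) t0 card_Tp finite_Tp by simp
  then obtain t1 t2 t3 where l: "ts = [t1, t2, t3]" by (auto simp: numeral_eq_Suc length_Suc_conv)
  have d: "distinct [t0, t1, t2, t3]" "Tp = {t0, t1, t2, t3}" using ts(1,2) l t0 by auto
  have "(\<Sum>t\<in>Tp. a t) = a t0 + a t1 + a t2 + a t3" unfolding d(2) using d(1) by simp
  then show ?thesis using that[OF d] ts(4) sum_a by (simp add: l)
qed

text \<open>Since w swaps \<open>p1\<close> and \<open>p2\<close>, v swaps their distinct images. So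
  the common image \<open>r\<close> lies over a fifth branch point outside \<open>Tp\<close> with
  index 2, and the four fibers over \<open>Tp\<close> see no ramification of
  \<open>\<psi>\<close>.\<close>

lemma generic_case:
  assumes "case_I C E \<psi>"
  shows "\<exists>T\<in>generic_types (int n). has_ramification P1 P1 \<phi> T"
proof -
  obtain p1 p2 where p: "p1 \<in> C" "p2 \<in> C" "e p1 = 2" "e p2 = 2" "\<psi> p1 \<noteq> \<psi> p2"
    "\<And>p. p \<in> C \<Longrightarrow> p \<noteq> p1 \<Longrightarrow> p \<noteq> p2 \<Longrightarrow> e p = 1"
    using assms unfolding case_I_def by blast
  have w: "w p1 = p2" "p1 \<noteq> p2" using case_I_swap[OF p(1-3,6)] by auto
  have v: "v (\<psi> p1) \<noteq> \<psi> p1" using psi_w[OF p(1)] w p(5) by auto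
  define r where "r = \<pi>C p1"
  define t5 where "t5 = \<phi> r"
  have r2: "\<pi>C p2 = r" using C.pi_s[OF p(1)] w by (simp add: r_def)
  have t5: "t5 \<notin> Tp" using phi_Tp[OF p(1)] v by (simp add: t5_def r_def)
  have "fr t5 = filter_mset (\<lambda>e. e \<noteq> 1) (image_mset \<rho> (mset_set {r}))"
  proof (rule fiber_profile_outside[OF t5])
    fix q assume "q \<in> C" "\<pi>C q \<notin> {r}"
    then show "e q = 1" using p(6) r2 by (auto simp: r_def)
  qed (simp add: t5_def)
  moreover have "\<rho> r = 2" unfolding r_def using rho_eq[OF p(1)] v p(3) by simp
  ultimately have fr5: "fr t5 = {#2#}" by simp
  have other: "e q = 1" if "t \<noteq> t5" "q \<in> C" "\<phi> (\<pi>C q) = t" for q t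
  proof -
    have "q \<noteq> p1" "q \<noteq> p2" using that(1,3) r2 by (auto simp: t5_def r_def)
    then show ?thesis using p(6)[OF that(2)] by blast
  qed
  have out: "fr t = {#}" if "t \<notin> Tp" "t \<noteq> t5" for t
    by (rule unramified_fiber(1)[OF other[OF that(2)] that(1)])
  have inT: "\<exists>b. a t = 2 * b \<and> b \<le> n div 2 \<and> fr t = replicate_mset (n div 2 - b) 2" if "t \<in> Tp" for t
    by (rule unramified_fiber(2)[OF other that]) (use that t5 in auto)
  obtain m where m: "n = 2 * m" using even_n by blast
  obtain ts where ts: "distinct ts" "set ts = Tp" "length ts = card Tp" "sorted_wrt (\<lambda>s t. a t \<le> a s) ts"
    by (rule ex_sorted_enumeration[OF finite_Tp])
  obtain t1 t2 t3 t4 where l: "ts = [t1, t2, t3, t4]"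
    using ts(3) card_Tp by (auto simp: numeral_eq_Suc length_Suc_conv)
  have d: "distinct [t1, t2, t3, t4]" "Tp = {t1, t2, t3, t4}" using ts(1,2) l by auto
  have "(\<Sum>t\<in>Tp. a t) = a t1 + a t2 + a t3 + a t4" unfolding d(2) using d(1) by simp
  then have sum: "a t1 + a t2 + a t3 + a t4 = 6" using sum_a by simp
  obtain b1 where b1: "a t1 = 2 * b1" "b1 \<le> m" "fr t1 = replicate_mset (m - b1) 2" using inT[of t1] d(2) m by auto
  obtain b2 where b2: "a t2 = 2 * b2" "b2 \<le> m" "fr t2 = replicate_mset (m - b2) 2" using inT[of t2] d(2) m by auto
  obtain b3 where b3: "a t3 = 2 * b3" "b3 \<le> m" "fr t3 = replicate_mset (m - b3) 2" using inT[of t3] d(2) m by auto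
  obtain b4 where b4: "a t4 = 2 * b4" "b4 \<le> m" "fr t4 = replicate_mset (m - b4) 2" using inT[of t4] d(2) m by auto
  have "b2 \<le> b1" "b3 \<le> b2" "b4 \<le> b3" using ts(4) b1(1) b2(1) b3(1) b4(1) by (simp_all add: l)
  moreover have "b1 + b2 + b3 + b4 = 3" using sum b1(1) b2(1) b3(1) b4(1) by simp
  \<comment> \<open>The half-counts are the partitions of 3 into at most four parts: 1 + 1 + 1, 2 +
    1 and 3.\<close>
  ultimately consider "b1 = 1" "b2 = 1" "b3 = 1" "b4 = 0" | "b1 = 2" "b2 = 1" "b3 = 0" "b4 = 0"
    | "b1 = 3" "b2 = 0" "b3 = 0" "b4 = 0" by linarith
  note cases = this
  have dq: "distinct [t1, t2, t3, t4, t5]" using d t5 by auto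
  have oq: "fr q = {#}" if "q \<notin> set [t1, t2, t3, t4, t5]" for q using out[of q] that d(2) by auto
  note I = has_ramificationI[OF dq _ _ oq]
  show ?thesis
  proof (rule cases)
    assume b: "b1 = 1" "b2 = 1" "b3 = 1" "b4 = 0"
    have "has_ramification P1 P1 \<phi> [[(2, int m - 1)], [(2, int m - 1)], [(2, int m - 1)], [(2, int m)], [(2, 1)]]"
      by (rule I) (use b b1 b2 b3 b4 fr5 in \<open>simp_all add: fiber_data_mset_def nat_int_diff\<close>)
    then show ?thesis by (rule bexI) (simp add: generic_types_def int_half[OF m])
  next
    assume b: "b1 = 2" "b2 = 1" "b3 = 0" "b4 = 0"
    have "has_ramification P1 P1 \<phi> [[(2, int m - 2)], [(2, int m - 1)], [(2, int m)], [(2, int m)], [(2, 1)]]"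
      by (rule I) (use b b1 b2 b3 b4 fr5 in \<open>simp_all add: fiber_data_mset_def nat_int_diff\<close>)
    then show ?thesis by (rule bexI) (simp add: generic_types_def int_half[OF m])
  next
    assume b: "b1 = 3" "b2 = 0" "b3 = 0" "b4 = 0"
    have "has_ramification P1 P1 \<phi> [[(2, int m - 3)], [(2, int m)], [(2, int m)], [(2, int m)], [(2, 1)]]"
      by (rule I) (use b b1 b2 b3 b4 fr5 in \<open>simp_all add: fiber_data_mset_def nat_int_diff\<close>)
    then show ?thesis by (rule bexI) (simp add: generic_types_def int_half[OF m])
  qed
qed

text \<open>The index 4 takes two from the m of the special fiber, and each pair of branch points
  takes one, leaving m - 2 - b0 points of index 2.\<close>

lemma special_fiber_index_4:
  assumes t0: "t0 \<in> Tp" "a t0 = 2 * b0" and m: "n = 2 * m"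
    and fr0: "fr t0 = add_mset 4 (replicate_mset (m - 2 - b0) 2)" "b0 + 2 \<le> m"
    and e1: "\<And>p. p \<in> C \<Longrightarrow> \<phi> (\<pi>C p) \<noteq> t0 \<Longrightarrow> e p = 1"
  shows "\<exists>T\<in>degenerations_I (int n) \<union> degenerations_II (int n) \<union> degenerations_III (int n).
    has_ramification P1 P1 \<phi> T"
proof -
  have inT: "\<exists>b. a t = 2 * b \<and> b \<le> n div 2 \<and> fr t = replicate_mset (n div 2 - b) 2" if "t \<in> Tp" "t \<noteq> t0" for t
    by (rule unramified_fiber(2)[OF e1 that(1)]) (use that(2) in auto)
  have out: "fr t = {#}" if "t \<notin> Tp" for t
    by (rule unramified_fiber(1)[OF e1 that]) (use that t0(1) in auto)
  obtain t1 t2 t3 where d: "distinct [t0, t1, t2, t3]" "Tp = {t0, t1, t2, t3}" "a t2 \<le> a t1" "a t3 \<le> a t2"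
    "a t0 + a t1 + a t2 + a t3 = 6" by (rule special_enumeration[OF t0(1)])
  obtain b1 where b1: "a t1 = 2 * b1" "b1 \<le> m" "fr t1 = replicate_mset (m - b1) 2" using inT[of t1] d(1,2) m by auto
  obtain b2 where b2: "a t2 = 2 * b2" "b2 \<le> m" "fr t2 = replicate_mset (m - b2) 2" using inT[of t2] d(1,2) m by auto
  obtain b3 where b3: "a t3 = 2 * b3" "b3 \<le> m" "fr t3 = replicate_mset (m - b3) 2" using inT[of t3] d(1,2) m by auto
  have "b2 \<le> b1" "b3 \<le> b2" "b0 + b1 + b2 + b3 = 3" using d(3-5) t0(2) b1(1) b2(1) b3(1) by simp_all
  note b = this
  \<comment> \<open>The special fiber takes b0, and the sorted rest is a partition of 3 - b0; this
    gives the seven degenerations with an index 4 or its merged pair.\<close>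
  have "b0 = 0 \<or> b0 = 1 \<or> b0 = 2 \<or> b0 = 3" "b2 = 0 \<or> b2 = 1" "b3 = 0 \<or> b3 = 1" using b by arith+
  then consider "b0 = 0" "b1 = 3" "b2 = 0" "b3 = 0"
    | "b0 = 0" "b1 = 2" "b2 = 1" "b3 = 0"
    | "b0 = 0" "b1 = 1" "b2 = 1" "b3 = 1"
    | "b0 = 1" "b1 = 2" "b2 = 0" "b3 = 0"
    | "b0 = 1" "b1 = 1" "b2 = 1" "b3 = 0"
    | "b0 = 2" "b1 = 1" "b2 = 0" "b3 = 0"
    | "b0 = 3" "b1 = 0" "b2 = 0" "b3 = 0"
    using b by (elim disjE) auto
  note cases = this
  have "set [t0, t1, t2, t3] = Tp" using d(2) by simp
  note I = permuted_ramificationI[OF d(1) this out]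
  show ?thesis
  proof (rule cases)
    assume b: "b0 = 0" "b1 = 3" "b2 = 0" "b3 = 0"
    \<comment> \<open>The special fiber \<open>t0\<close> goes to the position where the listed type
      has its entry 4; the other cases are arranged likewise.\<close>
    have "has_ramification P1 P1 \<phi> [[(2, int m - 3)], [(4, 1), (2, int m - 2)], [(2, int m)], [(2, int m)]]"
      by (rule I[of "[t1, t0, t2, t3]"])
        (use b b1 b2 b3 fr0 in \<open>simp_all add: fiber_data_mset_def nat_int_diff add_mset_commute\<close>)
    then show ?thesis by (rule bexI) (simp add: degenerations_III_def int_half[OF m])
  next
    assume b: "b0 = 0" "b1 = 2" "b2 = 1" "b3 = 0"
    have "has_ramification P1 P1 \<phi> [[(2, int m - 2)], [(2, int m - 1)], [(4, 1), (2, int m - 2)], [(2, int m)]]"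
      by (rule I[of "[t1, t2, t0, t3]"])
        (use b b1 b2 b3 fr0 in \<open>simp_all add: fiber_data_mset_def nat_int_diff add_mset_commute\<close>)
    then show ?thesis by (rule bexI) (simp add: degenerations_II_def int_half[OF m])
  next
    assume b: "b0 = 0" "b1 = 1" "b2 = 1" "b3 = 1"
    have "has_ramification P1 P1 \<phi> [[(2, int m - 1)], [(2, int m - 1)], [(2, int m - 1)], [(4, 1), (2, int m - 2)]]"
      by (rule I[of "[t1, t2, t3, t0]"])
        (use b b1 b2 b3 fr0 in \<open>simp_all add: fiber_data_mset_def nat_int_diff add_mset_commute\<close>)
    then show ?thesis by (rule bexI) (simp add: degenerations_I_def int_half[OF m])
  next
    assume b: "b0 = 1" "b1 = 2" "b2 = 0" "b3 = 0"
    have "has_ramification P1 P1 \<phi> [[(2, int m - 2)], [(4, 1), (2, int m - 3)], [(2, int m)], [(2, int m)]]"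
      by (rule I[of "[t1, t0, t2, t3]"])
        (use b b1 b2 b3 fr0 in \<open>simp_all add: fiber_data_mset_def nat_int_diff add_mset_commute\<close>)
    then show ?thesis by (rule bexI) (simp add: degenerations_II_def int_half[OF m])
  next
    assume b: "b0 = 1" "b1 = 1" "b2 = 1" "b3 = 0"
    have "has_ramification P1 P1 \<phi> [[(2, int m - 1)], [(2, int m - 1)], [(4, 1), (2, int m - 3)], [(2, int m)]]"
      by (rule I[of "[t1, t2, t0, t3]"])
        (use b b1 b2 b3 fr0 in \<open>simp_all add: fiber_data_mset_def nat_int_diff add_mset_commute\<close>)
    then show ?thesis by (rule bexI) (simp add: degenerations_I_def int_half[OF m])
  next
    assume b: "b0 = 2" "b1 = 1" "b2 = 0" "b3 = 0"
    have "has_ramification P1 P1 \<phi> [[(4, 1), (2, int m - 4)], [(2, int m - 1)], [(2, int m)], [(2, int m)]]"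
      by (rule I[of "[t0, t1, t2, t3]"])
        (use b b1 b2 b3 fr0 in \<open>simp_all add: fiber_data_mset_def nat_int_diff add_mset_commute\<close>)
    then show ?thesis by (rule bexI) (simp add: degenerations_II_def int_half[OF m])
  next
    assume b: "b0 = 3" "b1 = 0" "b2 = 0" "b3 = 0"
    have "has_ramification P1 P1 \<phi> [[(2, int m)], [(2, int m)], [(2, int m)], [(4, 1), (2, int m - 5)]]"
      by (rule I[of "[t1, t2, t3, t0]"])
        (use b b1 b2 b3 fr0 in \<open>simp_all add: fiber_data_mset_def nat_int_diff add_mset_commute\<close>)
    then show ?thesis by (rule bexI) (simp add: degenerations_III_def int_half[OF m])
  qed
qed

text \<open>The point of index 3 is itself a branch point of \<open>\<pi>C\<close>, hence b0 \<ge>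
  1. The remaining 2 b0 - 1 branch points have index 1, so 2m = 3 + (2 b0 - 1) + 2k with k points of
  index 2.\<close>

lemma special_fiber_index_3:
  assumes t0: "t0 \<in> Tp" "a t0 = 2 * b0" and m: "n = 2 * m"
    and fr0: "fr t0 = add_mset 3 (replicate_mset (m - 1 - b0) 2)" "b0 + 1 \<le> m" "1 \<le> b0"
    and e1: "\<And>p. p \<in> C \<Longrightarrow> \<phi> (\<pi>C p) \<noteq> t0 \<Longrightarrow> e p = 1"
  shows "\<exists>T\<in>degenerations_I (int n) \<union> degenerations_II (int n) \<union> degenerations_III (int n).
    has_ramification P1 P1 \<phi> T"
proof -
  have inT: "\<exists>b. a t = 2 * b \<and> b \<le> n div 2 \<and> fr t = replicate_mset (n div 2 - b) 2" if "t \<in> Tp" "t \<noteq> t0" for t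
    by (rule unramified_fiber(2)[OF e1 that(1)]) (use that(2) in auto)
  have out: "fr t = {#}" if "t \<notin> Tp" for t
    by (rule unramified_fiber(1)[OF e1 that]) (use that t0(1) in auto)
  obtain t1 t2 t3 where d: "distinct [t0, t1, t2, t3]" "Tp = {t0, t1, t2, t3}" "a t2 \<le> a t1" "a t3 \<le> a t2"
    "a t0 + a t1 + a t2 + a t3 = 6" by (rule special_enumeration[OF t0(1)])
  obtain b1 where b1: "a t1 = 2 * b1" "b1 \<le> m" "fr t1 = replicate_mset (m - b1) 2" using inT[of t1] d(1,2) m by auto
  obtain b2 where b2: "a t2 = 2 * b2" "b2 \<le> m" "fr t2 = replicate_mset (m - b2) 2" using inT[of t2] d(1,2) m by auto
  obtain b3 where b3: "a t3 = 2 * b3" "b3 \<le> m" "fr t3 = replicate_mset (m - b3) 2" using inT[of t3] d(1,2) m by auto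
  have "b2 \<le> b1" "b3 \<le> b2" "b0 + b1 + b2 + b3 = 3" using d(3-5) t0(2) b1(1) b2(1) b3(1) by simp_all
  note b = this
  have "b0 = 0 \<or> b0 = 1 \<or> b0 = 2 \<or> b0 = 3" "b2 = 0 \<or> b2 = 1" "b3 = 0 \<or> b3 = 1" using b by arith+
  then consider "b0 = 1" "b1 = 2" "b2 = 0" "b3 = 0"
    | "b0 = 1" "b1 = 1" "b2 = 1" "b3 = 0"
    | "b0 = 2" "b1 = 1" "b2 = 0" "b3 = 0"
    | "b0 = 3" "b1 = 0" "b2 = 0" "b3 = 0"
    using b fr0(3) by (elim disjE) auto
  note cases = this
  have "set [t0, t1, t2, t3] = Tp" using d(2) by simp
  note I = permuted_ramificationI[OF d(1) this out]
  show ?thesis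
  proof (rule cases)
    assume b: "b0 = 1" "b1 = 2" "b2 = 0" "b3 = 0"
    have "has_ramification P1 P1 \<phi> [[(2, int m - 2)], [(3, 1), (2, int m - 2)], [(2, int m)], [(2, int m)]]"
      by (rule I[of "[t1, t0, t2, t3]"])
        (use b b1 b2 b3 fr0 in \<open>simp_all add: fiber_data_mset_def nat_int_diff add_mset_commute eval_nat_numeral\<close>)
    then show ?thesis by (rule bexI) (simp add: degenerations_II_def int_half[OF m])
  next
    assume b: "b0 = 1" "b1 = 1" "b2 = 1" "b3 = 0"
    have "has_ramification P1 P1 \<phi> [[(3, 1), (2, int m - 2)], [(2, int m - 1)], [(2, int m - 1)], [(2, int m)]]"
      by (rule I[of "[t0, t1, t2, t3]"])
        (use b b1 b2 b3 fr0 in \<open>simp_all add: fiber_data_mset_def nat_int_diff add_mset_commute eval_nat_numeral\<close>)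
    then show ?thesis by (rule bexI) (simp add: degenerations_I_def int_half[OF m])
  next
    assume b: "b0 = 2" "b1 = 1" "b2 = 0" "b3 = 0"
    have "has_ramification P1 P1 \<phi> [[(3, 1), (2, int m - 3)], [(2, int m - 1)], [(2, int m)], [(2, int m)]]"
      by (rule I[of "[t0, t1, t2, t3]"])
        (use b b1 b2 b3 fr0 in \<open>simp_all add: fiber_data_mset_def nat_int_diff add_mset_commute eval_nat_numeral\<close>)
    then show ?thesis by (rule bexI) (simp add: degenerations_II_def int_half[OF m])
  next
    assume b: "b0 = 3" "b1 = 0" "b2 = 0" "b3 = 0"
    have "has_ramification P1 P1 \<phi> [[(3, 1), (2, int m - 4)], [(2, int m)], [(2, int m)], [(2, int m)]]"
      by (rule I[of "[t0, t1, t2, t3]"])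
        (use b b1 b2 b3 fr0 in \<open>simp_all add: fiber_data_mset_def nat_int_diff add_mset_commute eval_nat_numeral\<close>)
    then show ?thesis by (rule bexI) (simp add: degenerations_III_def int_half[OF m])
  qed
qed

end

section \<open>The degenerate cases\<close>

context frey_kani
begin

text \<open>Now the swapped points have a common image, which v fixes. As \<open>p1\<close> is not
  fixed by w, its index 2 is doubled to 4 over a point of \<open>Tp\<close>.\<close>

lemma degenerate_case_II:
  assumes "case_II C E \<psi>"
  shows "\<exists>T\<in>degenerations_I (int n) \<union> degenerations_II (int n) \<union> degenerations_III (int n).
    has_ramification P1 P1 \<phi> T"
proof -
  obtain p1 p2 where p: "p1 \<in> C" "p2 \<in> C" "e p1 = 2" "\<psi> p1 = \<psi> p2"
    "\<And>p. p \<in> C \<Longrightarrow> p \<noteq> p1 \<Longrightarrow> p \<noteq> p2 \<Longrightarrow> e p = 1"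
    using assms unfolding case_II_def by blast
  have w: "w p1 = p2" "p1 \<noteq> p2" using case_I_swap[OF p(1-3,5)] by auto
  have v: "v (\<psi> p1) = \<psi> p1" using psi_w[OF p(1)] w p(4) by simp
  define r where "r = \<pi>C p1"
  define t0 where "t0 = \<phi> r"
  have r2: "\<pi>C p2 = r" using C.pi_s[OF p(1)] w by (simp add: r_def)
  have rW: "r \<notin> Wp" using Wp_iff[OF p(1)] w by (simp add: r_def)
  have t0: "t0 \<in> Tp" using phi_Tp[OF p(1)] v by (simp add: t0_def r_def)
  have r4: "\<rho> r = 4" unfolding r_def using rho_eq[OF p(1)] v w p(3) by simp
  have e1: "e q = 1" if "q \<in> C" "\<pi>C q \<noteq> r" for q
    using p(5)[OF that(1)] that(2) r2 by (auto simp: r_def)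
  obtain k where k: "fr t0 = filter_mset (\<lambda>e. e \<noteq> 1) (image_mset \<rho> (mset_set {r})) + replicate_mset k 2"
    "n = card ({q\<in>Wp. \<phi> q = t0} - {r}) + 2 * k + (\<Sum>r\<in>{r}. \<rho> r)"
    using fiber_profile[OF t0, of "{r}"] e1 t0_def by auto
  have "{q\<in>Wp. \<phi> q = t0} - {r} = {q\<in>Wp. \<phi> q = t0}" using rW by blast
  then have n: "n = a t0 + 2 * k + 4" using k(2) r4 by (simp add: a_def)
  obtain m where m: "n = 2 * m" using even_n by blast
  have b0: "a t0 = 2 * (m - 2 - k)" "m - 2 - k + 2 \<le> m" "m - 2 - (m - 2 - k) = k" using n m by arith+
  show ?thesis
  proof (rule special_fiber_index_4[OF t0 b0(1) m _ b0(2)])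
    show "fr t0 = add_mset 4 (replicate_mset (m - 2 - (m - 2 - k)) 2)" unfolding b0(3) using k(1) r4 by simp
    show "e q = 1" if "q \<in> C" "\<phi> (\<pi>C q) \<noteq> t0" for q using e1[OF that(1)] that(2) by (auto simp: t0_def)
  qed
qed

text \<open>Only one point has index 3, so w fixes it; then its image lies in \<open>Wp\<close> and
  the index 3 is not doubled.\<close>

lemma degenerate_case_III:
  assumes "case_III C E \<psi>"
  shows "\<exists>T\<in>degenerations_I (int n) \<union> degenerations_II (int n) \<union> degenerations_III (int n).
    has_ramification P1 P1 \<phi> T"
proof -
  obtain p1 where p: "p1 \<in> C" "e p1 = 3" "\<And>p. p \<in> C \<Longrightarrow> p \<noteq> p1 \<Longrightarrow> e p = 1"
    using assms unfolding case_III_def by blast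
  have w: "w p1 = p1"
  proof (rule ccontr)
    assume "w p1 \<noteq> p1"
    then have "e (w p1) = 1" by (rule p(3)[OF C.s_in[OF p(1)]])
    then show False using e_w[OF p(1)] p(2) by simp
  qed
  define r where "r = \<pi>C p1"
  define t0 where "t0 = \<phi> r"
  have rW: "r \<in> Wp" using Wp_iff[OF p(1)] w by (simp add: r_def)
  have t0: "t0 \<in> Tp" using Wp_Tp[OF rW] by (simp add: t0_def)
  have r3: "\<rho> r = 3" unfolding r_def using rho_eq[OF p(1)] w p(2) by simp
  have e1: "e q = 1" if "q \<in> C" "\<pi>C q \<noteq> r" for q
    using p(3)[OF that(1)] that(2) by (auto simp: r_def)
  obtain k where k: "fr t0 = filter_mset (\<lambda>e. e \<noteq> 1) (image_mset \<rho> (mset_set {r})) + replicate_mset k 2"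
    "n = card ({q\<in>Wp. \<phi> q = t0} - {r}) + 2 * k + (\<Sum>r\<in>{r}. \<rho> r)"
    using fiber_profile[OF t0, of "{r}"] e1 t0_def by auto
  have rA: "r \<in> {q\<in>Wp. \<phi> q = t0}" using rW by (simp add: t0_def)
  have fin: "finite {q\<in>Wp. \<phi> q = t0}" using finite_Wp by simp
  have "a t0 > 0" unfolding a_def using rA fin by (metis card_gt_0_iff empty_iff)
  \<comment> \<open>The special point is one of the \<open>a t0\<close> branch points and counts
    with index 3 instead of 1.\<close>
  moreover have "n = a t0 - 1 + 2 * k + 3" using k(2) r3 rA fin by (simp add: a_def)
  moreover obtain m where m: "n = 2 * m" using even_n by blast
  ultimately have b0: "a t0 = 2 * (m - 1 - k)" "m - 1 - k + 1 \<le> m" "1 \<le> m - 1 - k" "m - 1 - (m - 1 - k) = k"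
    by arith+
  show ?thesis
  proof (rule special_fiber_index_3[OF t0 b0(1) m _ b0(2,3)])
    show "fr t0 = add_mset 3 (replicate_mset (m - 1 - (m - 1 - k)) 2)" unfolding b0(4) using k(1) r3 by simp
    show "e q = 1" if "q \<in> C" "\<phi> (\<pi>C q) \<noteq> t0" for q using e1[OF that(1)] that(2) by (auto simp: t0_def)
  qed
qed

end

text \<open>A point of positive index contributes to the sum over its fiber, which is the
  degree.\<close>

lemma covering_degree_pos:
  assumes cov: "covering X Y f n" and p: "p \<in> X" "0 < ram_index X Y f p"
  shows "0 < n"
proof -
  have fp: "f p \<in> Y" using cov p(1) unfolding covering_def morphism_def by blast
  have fin: "finite (fiber X f (f p))" and sum: "(\<Sum>p\<in>fiber X f (f p). ram_index X Y f p) = n"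
    using cov fp unfolding covering_def by blast+
  have "ram_index X Y f p \<le> (\<Sum>p\<in>fiber X f (f p). ram_index X Y f p)"
    by (rule member_le_sum[OF _ _ fin]) (use p in \<open>auto simp: fiber_def\<close>)
  then show ?thesis using sum p(2) by simp
qed

lemma double_coverI:
  assumes "smooth_projective_curve X" "has_genus X g" "P1_quotient X s \<pi>" "\<And>p. p \<in> X \<Longrightarrow> s p \<in> X"
  shows "double_cover X \<pi> g s"
proof -
  have q: "covering X P1 \<pi> 2" "\<forall>p\<in>X. \<forall>q\<in>X. \<pi> p = \<pi> q \<longleftrightarrow> q = p \<or> q = s p"
    using assms(3) unfolding P1_quotient_def by blast+
  show ?thesis
    by unfold_locales (use assms P1_smooth q in auto)
qed

theorem theorem3p2:
  fixes C :: "'a::finite proj_space set" and E :: "'b::finite proj_space set"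
    and \<psi> :: "'a proj_space \<Rightarrow> 'b proj_space" and n :: nat
    and w :: "'a proj_space \<Rightarrow> 'a proj_space" and Or :: "'b proj_space"
    and \<pi>C :: "'a proj_space \<Rightarrow> 2 proj_space" and \<pi>E :: "'b proj_space \<Rightarrow> 2 proj_space"
    and \<phi> :: "2 proj_space \<Rightarrow> 2 proj_space"
  assumes "smooth_projective_curve C" and "has_genus C 2"
    and "smooth_projective_curve E" and "has_genus E 1"
    and "covering C E \<psi> n" and "even n"
    and "hyperelliptic_involution C w"
    and "Or \<in> E" and "\<forall>p\<in>C. \<psi> (w p) = ell_neg E Or (\<psi> p)"
    and "P1_quotient C w \<pi>C" and "P1_quotient E (ell_neg E Or) \<pi>E"
    and "frey_kani_covering C E \<psi> n \<pi>C \<pi>E \<phi>"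
  shows "(case_I C E \<psi> \<longrightarrow> (\<exists>T\<in>generic_types (int n). has_ramification P1 P1 \<phi> T)) \<and>
         (case_II C E \<psi> \<or> case_III C E \<psi> \<longrightarrow>
            (\<exists>T\<in>degenerations_I (int n) \<union> degenerations_II (int n) \<union> degenerations_III (int n).
               has_ramification P1 P1 \<phi> T))"
proof (cases "n = 0")
  case True
  \<comment> \<open>Evenness admits n = 0. All indices are then 0, so none of the three cases can
    occur.\<close>
  have unram: "ram_index C E \<psi> p = 0" if "p \<in> C" for p
    using covering_degree_pos[OF assms(5) that] True by auto
  then have "\<not> case_I C E \<psi>" "\<not> case_II C E \<psi>" "\<not> case_III C E \<psi>"
    unfolding case_I_def case_II_def case_III_def by auto
  then show ?thesis by blast
next
  case False
  then have n: "n > 0" by simp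
  let ?v = "ell_neg E Or"
  have wC: "w p \<in> C" if "p \<in> C" for p
    using assms(7) that unfolding hyperelliptic_involution_def involution_of_def morphism_def by blast
  interpret psi: curve_covering C E \<psi> n
    by unfold_locales (use assms n in auto)
  \<comment> \<open>As a definite description \<open>ell_neg\<close> does not yield a point of E by
    its form alone. Membership follows from surjectivity of \<open>\<psi>\<close> and its
    compatibility with w.\<close>
  have vE: "?v q \<in> E" if q: "q \<in> E" for q
  proof -
    obtain p where p: "p \<in> C" "\<psi> p = q" using psi.surj[OF q] by blast
    then have "?v q = \<psi> (w p)" using assms(9) by simp
    then show ?thesis using psi.in_Y[OF wC[OF p(1)]] by simp
  qed
  interpret C: double_cover C \<pi>C 2 w by (rule double_coverI[OF assms(1,2,10) wC])
  interpret E: double_cover E \<pi>E 1 ?v by (rule double_coverI[OF assms(3,4,11) vE])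
  interpret frey_kani C \<pi>C w E \<pi>E ?v \<psi> \<phi> n
    by unfold_locales (use assms n in \<open>auto simp: frey_kani_covering_def\<close>)
  show ?thesis using generic_case degenerate_case_II degenerate_case_III by blast
qed

end
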